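(* Let $\varepsilon>0$ and $\Lambda>0$. There are constants $C=C(\varepsilon,\Lambda)$, $C'=C'(\varepsilon)$ and $C_\Lambda=C_\Lambda(\Lambda)$ such that for every integer $\ell\geq 1$, every $\nu\in i\mathbb{R}$ and every $g\in\mathrm{SL}_2(\mathbb{C})$ the following hold. (a) We have $$\bigl|\varphi_{\nu,\ell}^{\ell,0}(g)\bigr|\leq C\left(\ell^{\varepsilon}\min\left(1,\ \frac{1}{\sqrt{\ell}\,\mathrm{dist}(g,\mathcal{S})}\right)+\ell^{-\Lambda}\right)$$ (the fraction being $+\infty$ if $\mathrm{dist}(g,\mathcal{S})=0$). Moreover, $|\varphi_{\nu,\ell}^{\ell,0}(g)|\leq C_\Lambda\,\ell^{-\Lambda}$ holds unless $D(g)\leq C_\Lambda\,\|g\|^2(\log\ell)/\sqrt{\ell}$. (b) We have $$\bigl|\varphi_{\nu,\ell}^{\ell,\pm\ell}(g)\bigr|\leq C'\,\|g\|^{-2+\varepsilon}\,\ell^{\varepsilon}.$$ Moreover, $|\varphi_{\nu,\ell}^{\ell,\pm\ell}(g)|\leq C_\Lambda\,\ell^{-\Lambda}$ holds unless $\mathrm{dist}(g,\mathcal{D})\leq C_\Lambda\,\|g\|\sqrt{\log\ell}/\sqrt{\ell}$.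
   Context: $G=\mathrm{SL}_2(\mathbb{C})$, $K=\mathrm{SU}_2(\mathbb{C})$ with probability Haar measure $dk$; $\mathcal{D}\subset G$ is the set of diagonal matrices in $G$; $\mathcal{S}\subset K$ is the set of all diagonal and all skew-diagonal matrices lying in $K$ (the normalizer in $K$ of the group of positive diagonal matrices). $\|g\|=\sqrt{\mathrm{tr}(gg^* )}$ is the Frobenius norm, and $\mathrm{dist}(g,\mathcal{H})=\inf_{h\in\mathcal{H}}\|g-h\|$. For $g=\begin{pmatrix}a&b\\c&d\end{pmatrix}$, $D(g)=\bigl||a|^2-|d|^2\bigr|+\bigl||b|^2-|c|^2\bigr|$. The spherical trace function is $$\varphi_{\nu,\ell}^{\ell}(g)=(2\ell+1)\int_K\psi_\ell(\kappa(k^{-1}gk))\,e^{(\nu-1)\rho(H(gk))}\,dk,$$ where $\psi_\ell\left(\begin{pmatrix}\alpha&\beta\\-\bar\beta&\bar\alpha\end{pmatrix}\right)=\bar\alpha^{2\ell}$ on $K$, and for $g=\begin{pmatrix}a&b\\c&d\end{pmatrix}\in G$, $\kappa(g)\in K$ is the matrix with first column $(a,c)^\top/\sqrt{|a|^2+|c|^2}$ and $e^{(\nu-1)\rho(H(g))}=(|a|^2+|c|^2)^{\nu-1}$ (Iwasawa projections for $G=KAN$). Its averaged version, for an integer $|q|\leq\ell$, is $$\varphi_{\nu,\ell}^{\ell,q}(g)=\frac1{2\pi}\int_0^{2\pi}\varphi_{\nu,\ell}^{\ell}\bigl(g\,\mathrm{diag}(e^{i\varrho},e^{-i\varrho})\bigr)e^{-2qi\varrho}\,d\varrho.$$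 *)

theory Defs
  imports "HOL-Probability.Probability"
begin

definition mat2 :: "complex \<Rightarrow> complex \<Rightarrow> complex \<Rightarrow> complex \<Rightarrow> complex^2^2" where
  "mat2 a b c d = vector [vector [a, b], vector [c, d]]"

definition ctranspose :: "complex^2^2 \<Rightarrow> complex^2^2" where
  "ctranspose g = map_matrix cnj (transpose g)"

definition SL2C :: "(complex^2^2) set" where
  "SL2C = {g. det g = 1}"

definition SU2 :: "(complex^2^2) set" where
  "SU2 = {k. k ** ctranspose k = mat 1 \<and> det k = 1}"

definition diag_SL2C :: "(complex^2^2) set" where
  "diag_SL2C = {g \<in> SL2C. g$1$2 = 0 \<and> g$2$1 = 0}"

definition mono_SU2 :: "(complex^2^2) set" where
  "mono_SU2 = {k \<in> SU2. k$1$2 = 0 \<and> k$2$1 = 0 \<or> k$1$1 = 0 \<and> k$2$2 = 0}"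

text \<open>\<open>SU2\<close> is compact, so left invariance and total mass 1 determine the (bi-invariant) Haar
  probability measure; existence is \<open>haar_prob_SU2_exists\<close> below.\<close>

definition haar_prob_SU2 :: "(complex^2^2) measure \<Rightarrow> bool" where
  "haar_prob_SU2 \<mu> \<longleftrightarrow>
     prob_space \<mu> \<and> sets \<mu> = sets (restrict_space borel SU2) \<and>
     (\<forall>h \<in> SU2. distr \<mu> \<mu> (\<lambda>k. h ** k) = \<mu>)"

definition psi :: "nat \<Rightarrow> complex^2^2 \<Rightarrow> complex" where
  "psi l k = cnj (k$1$1) ^ (2 * l)"

text \<open>This is \<open>exp (\<rho> (H g))\<close> for the decomposition \<open>G = K A N\<close> with \<open>N\<close> upper unitriangular.\<close>

definition iwasawa_height :: "complex^2^2 \<Rightarrow> real" where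
  "iwasawa_height g = (cmod (g$1$1))\<^sup>2 + (cmod (g$2$1))\<^sup>2"

text \<open>A matrix in \<open>SU2\<close> is determined by its first column \<open>(\<alpha>, \<gamma>)\<close>;
  its second column is \<open>(- cnj \<gamma>, cnj \<alpha>)\<close>.\<close>

definition iwasawa_kappa :: "complex^2^2 \<Rightarrow> complex^2^2" where
  "iwasawa_kappa g =
     (let r = complex_of_real (sqrt (iwasawa_height g)); \<alpha> = g$1$1 / r; \<gamma> = g$2$1 / r
      in mat2 \<alpha> (- cnj \<gamma>) \<gamma> (cnj \<alpha>))"

definition spherical_trace ::
    "(complex^2^2) measure \<Rightarrow> complex \<Rightarrow> nat \<Rightarrow> complex^2^2 \<Rightarrow> complex" where
  "spherical_trace \<mu> \<nu> l g =
     of_nat (2 * l + 1) *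
     (LINT k|\<mu>. psi l (iwasawa_kappa (matrix_inv k ** g ** k)) *
                complex_of_real (iwasawa_height (g ** k)) powr (\<nu> - 1))"

definition avg_spherical_trace ::
    "(complex^2^2) measure \<Rightarrow> complex \<Rightarrow> nat \<Rightarrow> int \<Rightarrow> complex^2^2 \<Rightarrow> complex" where
  "avg_spherical_trace \<mu> \<nu> l q g =
     1 / (2 * of_real pi) *
     integral {0..2 * pi}
       (\<lambda>\<rho>. spherical_trace \<mu> \<nu> l (g ** mat2 (cis \<rho>) 0 0 (cis (- \<rho>))) *
             exp (- 2 * of_int q * \<i> * of_real \<rho>))"

definition D_fun :: "complex^2^2 \<Rightarrow> real" where
  "D_fun g = \<bar>(cmod (g$1$1))\<^sup>2 - (cmod (g$2$2))\<^sup>2\<bar> + \<bar>(cmod (g$1$2))\<^sup>2 - (cmod (g$2$1))\<^sup>2\<bar>"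

text \<open>The library norm on \<^typ>\<open>complex^2^2\<close> is the Frobenius norm, so \<^const>\<open>infdist\<close> is the
  Frobenius distance to a (nonempty) set.\<close>

lemma norm_eq_Frobenius:
  fixes g :: "complex^2^2"
  shows "complex_of_real (norm g) = csqrt (trace (g ** ctranspose g))"
proof -
  have "trace (g ** ctranspose g) = complex_of_real ((norm g)\<^sup>2)"
    by (simp add: trace_def matrix_matrix_mult_def ctranspose_def transpose_def norm_vec_def
        L2_set_def sum_2 complex_norm_square flip: of_real_power)
  then show ?thesis
    by (simp add: csqrt_of_real_nonneg flip: of_real_power)
qed

lemma mat2_nth [simp]:
  "mat2 a b c d $ 1 $ 1 = a" "mat2 a b c d $ 1 $ 2 = b"
  "mat2 a b c d $ 2 $ 1 = c" "mat2 a b c d $ 2 $ 2 = d"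
  by (simp_all add: mat2_def)

lemma mat2_eta: "g = mat2 (g$1$1) (g$1$2) (g$2$1) (g$2$2)"
  by (simp add: vec_eq_iff forall_2)

lemma mat2_mult:
  "mat2 a b c d ** mat2 a' b' c' d' = 
     mat2 (a*a' + b*c') (a*b' + b*d') (c*a' + d*c') (c*b' + d*d')"
  by (simp add: vec_eq_iff forall_2 matrix_matrix_mult_def sum_2)

lemma mat_1_in_diag_mono: "mat 1 \<in> diag_SL2C" "mat 1 \<in> mono_SU2"
  by (simp_all add: diag_SL2C_def mono_SU2_def SL2C_def SU2_def det_2 mat_def ctranspose_def
      vec_eq_iff forall_2 matrix_matrix_mult_def sum_2 transpose_def)

lemma SU2_iff: "k \<in> SU2 \<longleftrightarrow> (\<exists>\<alpha> \<beta>. k = mat2 \<alpha> \<beta> (- cnj \<beta>) (cnj \<alpha>) \<and> (cmod \<alpha>)\<^sup>2 + (cmod \<beta>)\<^sup>2 = 1)"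
proof
  assume "k \<in> SU2"
  define a b c d where abcd: "a = k$1$1" "b = k$1$2" "c = k$2$1" "d = k$2$2"
  from \<open>k \<in> SU2\<close> have 1: "a * cnj a + b * cnj b = 1" "c * cnj a + d * cnj b = 0"
    "a * d - b * c = 1"
    by (auto simp: SU2_def det_2 mat_def ctranspose_def vec_eq_iff forall_2 abcd
      matrix_matrix_mult_def sum_2 transpose_def)
  have "d = cnj a" 
  proof -
    have "cnj a = cnj a * (a * d - b * c)" using 1 by simp
    also have "\<dots> = d * (a * cnj a + b * cnj b) - b * (c * cnj a + d * cnj b)"
      by (simp add: algebra_simps)
    finally show ?thesis using 1 by simp
  qed
  moreover have "c = - cnj b"
  proof -
    have "- cnj b = - cnj b * (a * d - b * c)" using 1 by simp
    also have "\<dots> = c * (a * cnj a + b * cnj b) - a * (c * cnj a + d * cnj b)"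
      by (simp add: algebra_simps)
    finally show ?thesis using 1 by simp
  qed
  moreover have "(cmod a)\<^sup>2 + (cmod b)\<^sup>2 = 1"
  proof -
    have "complex_of_real ((cmod a)\<^sup>2 + (cmod b)\<^sup>2) = 1"
      using 1 by (simp add: complex_norm_square del: of_real_power)
    then show ?thesis by (simp only: of_real_eq_1_iff)
  qed
  ultimately show "\<exists>\<alpha> \<beta>. k = mat2 \<alpha> \<beta> (- cnj \<beta>) (cnj \<alpha>) \<and> (cmod \<alpha>)\<^sup>2 + (cmod \<beta>)\<^sup>2 = 1"
    using mat2_eta[of k] unfolding abcd[symmetric] by (intro exI[of _ a] exI[of _ b]) simp
next
  assume "\<exists>\<alpha> \<beta>. k = mat2 \<alpha> \<beta> (- cnj \<beta>) (cnj \<alpha>) \<and> (cmod \<alpha>)\<^sup>2 + (cmod \<beta>)\<^sup>2 = 1"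
  then obtain a b where k: "k = mat2 a b (- cnj b) (cnj a)" and ab: "(cmod a)\<^sup>2 + (cmod b)\<^sup>2 = 1" by blast
  have "complex_of_real ((cmod a)\<^sup>2 + (cmod b)\<^sup>2) = 1" using ab by simp
  then have "a * cnj a + b * cnj b = 1" 
    by (simp add: complex_norm_square del: of_real_power)
  then show "k \<in> SU2"
    by (simp add: k SU2_def det_2 mat_def ctranspose_def vec_eq_iff forall_2
      matrix_matrix_mult_def sum_2 transpose_def algebra_simps)
qed

text \<open>Existence of the Haar measure: normalised Lebesgue measure on the unit ball of
  \<^typ>\<open>real^4\<close>, projected radially to the unit sphere, which is \<open>SU2\<close>.\<close>

definition to_SU2 :: "real^4 \<Rightarrow> complex^2^2" where
  "to_SU2 x = (if x = 0 then mat 1 else 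
     (let a = Complex (x$1 / norm x) (x$2 / norm x); b = Complex (x$3 / norm x) (x$4 / norm x)
      in mat2 a b (- cnj b) (cnj a)))"

lemma norm_real4: "(norm (x::real^4))\<^sup>2 = (x$1)\<^sup>2 + (x$2)\<^sup>2 + (x$3)\<^sup>2 + (x$4)\<^sup>2"
  by (simp add: norm_vec_def L2_set_def sum_4)

lemma to_SU2_in: "to_SU2 x \<in> SU2"
proof (cases "x = 0")
  case True
  then show ?thesis using mat_1_in_diag_mono by (simp add: to_SU2_def mono_SU2_def)
next
  case False
  have "(x$1 / norm x)\<^sup>2 + (x$2 / norm x)\<^sup>2 + (x$3 / norm x)\<^sup>2 + (x$4 / norm x)\<^sup>2 = 1"
    using False by (simp add: power_divide flip: add_divide_distrib norm_real4)
  with False show ?thesis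
    by (auto simp: SU2_iff to_SU2_def Let_def cmod_power2 intro!: exI)
qed

lemma borel_measurable_to_SU2: "to_SU2 \<in> borel_measurable borel"
proof -
  have "continuous_on (- {0}) (\<lambda>x. (\<chi> i j. to_SU2 x $ i $ j))"
  proof (intro continuous_on_vec_lambda)
    fix i j :: 2
    have *: "to_SU2 x $ i $ j = (let a = Complex (x$1 / norm x) (x$2 / norm x); b = Complex (x$3 / norm x) (x$4 / norm x)
      in if i = 1 then (if j = 1 then a else b) else if j = 1 then - cnj b else cnj a)" if "x \<in> -{0}" for x
      using that exhaust_2[of i] exhaust_2[of j] by (auto simp: to_SU2_def Let_def)
    show "continuous_on (- {0}) (\<lambda>x. to_SU2 x $ i $ j)"
      using exhaust_2[of i] exhaust_2[of j]
      by (auto simp: * Let_def Complex_eq cong: continuous_on_cong_simp intro!: continuous_intros)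
  qed
  then have c: "continuous_on (- {0}) to_SU2" by simp
  have "(\<lambda>x. if x \<in> -{0} then to_SU2 x else mat 1) \<in> borel_measurable borel"
    by (rule borel_measurable_continuous_on_if) (auto intro: c)
  also have "(\<lambda>x. if x \<in> -{0} then to_SU2 x else mat 1) = to_SU2"
    by (auto simp: to_SU2_def)
  finally show ?thesis .
qed

lemma SU2_mult:
  assumes "h \<in> SU2" "k \<in> SU2"
  shows "h ** k \<in> SU2"
proof -
  have "ctranspose (h ** k) = ctranspose k ** ctranspose h"
    by (simp add: ctranspose_def vec_eq_iff matrix_matrix_mult_def transpose_def mult.commute)
  then have "(h ** k) ** ctranspose (h ** k) = h ** ((k ** ctranspose k) ** ctranspose h)"
    by (simp only: matrix_mul_assoc)
  then show ?thesis
    using assms by (simp add: SU2_def det_mul)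
qed

lemma SU2_left_mult_orthogonal:
  assumes "h \<in> SU2"
  shows "\<exists>T. orthogonal_transformation T \<and> (\<forall>x. x \<noteq> 0 \<longrightarrow> to_SU2 (T x) = h ** to_SU2 x)"
proof -
  obtain a b where h: "h = mat2 a b (- cnj b) (cnj a)" and ab: "(cmod a)\<^sup>2 + (cmod b)\<^sup>2 = 1"
    using assms unfolding SU2_iff by blast
  define p q r s where pqrs: "p = Re a" "q = Im a" "r = Re b" "s = Im b"
  have 1: "p\<^sup>2 + q\<^sup>2 + r\<^sup>2 + s\<^sup>2 = 1" using ab by (simp add: cmod_power2 pqrs)
  define T :: "real^4 \<Rightarrow> real^4" where "T = (\<lambda>x. \<chi> i.
     if i = 1 then p * x$1 - q * x$2 - r * x$3 - s * x$4
     else if i = 2 then p * x$2 + q * x$1 + r * x$4 - s * x$3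
     else if i = 3 then p * x$3 - q * x$4 + r * x$1 + s * x$2
     else p * x$4 + q * x$3 - r * x$2 + s * x$1)"
  have T_nth: "T x $ 1 = p * x$1 - q * x$2 - r * x$3 - s * x$4"
     "T x $ 2 = p * x$2 + q * x$1 + r * x$4 - s * x$3"
     "T x $ 3 = p * x$3 - q * x$4 + r * x$1 + s * x$2"
     "T x $ 4 = p * x$4 + q * x$3 - r * x$2 + s * x$1" for x
    by (simp_all add: T_def)
  have norm: "norm (T x) = norm x" for x
  proof -
    have "(norm (T x))\<^sup>2 = (p\<^sup>2 + q\<^sup>2 + r\<^sup>2 + s\<^sup>2) * (norm x)\<^sup>2"
      unfolding norm_real4 T_nth by algebra
    then show ?thesis using 1 by simp
  qed
  have "linear T"
    by (rule linearI) (simp_all add: vec_eq_iff forall_4 T_nth algebra_simps)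
  then have "orthogonal_transformation T"
    by (simp add: orthogonal_transformation norm)
  moreover have "to_SU2 (T x) = h ** to_SU2 x" if "x \<noteq> 0" for x
  proof -
    have "T x \<noteq> 0" using norm[of x] that by auto
    then show ?thesis using that
      by (simp add: to_SU2_def Let_def norm h mat2_mult)
         (simp add: vec_eq_iff forall_2 complex_eq_iff T_nth pqrs add_divide_distrib diff_divide_distrib algebra_simps)
  qed
  ultimately show ?thesis by blast
qed

lemma lborel_distr_orthogonal:
  fixes T :: "real^4 \<Rightarrow> real^4"
  assumes T: "orthogonal_transformation T"
  shows "distr lborel borel T = lborel"
proof (rule lborel_eqI[symmetric])
  have lin: "linear T" using T orthogonal_transformation_linear by blast
  then have m: "T \<in> borel_measurable borel"
    by (simp add: linear_linear linear_continuous_on borel_measurable_continuous_onI)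
  fix l u :: "real^4" assume lu: "\<And>b. b \<in> Basis \<Longrightarrow> l \<bullet> b \<le> u \<bullet> b"
  have i: "orthogonal_transformation (inv T)" by (rule orthogonal_transformation_inv[OF T])
  have "T -` box l u = inv T ` box l u"
    using orthogonal_transformation_bij[OF T] by (simp add: bij_vimage_eq_inv_image)
  then have *: "T -` box l u \<in> lmeasurable" "measure lebesgue (T -` box l u) = measure lebesgue (box l u)"
    using measurable_orthogonal_image[OF i, of "box l u"] measure_orthogonal_image[OF i, of "box l u"] by auto
  have s: "T -` box l u \<in> sets borel" using measurable_sets[OF m, of "box l u"] by simp
  have "emeasure (distr lborel borel T) (box l u) = emeasure lborel (T -` box l u)"
    using m by (simp add: emeasure_distr)
  also have "\<dots> = emeasure lebesgue (T -` box l u)" using s by (simp add: emeasure_completion)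
  also have "\<dots> = ennreal (measure lebesgue (T -` box l u))"
    by (rule emeasure_eq_measure2[OF *(1)])
  also have "\<dots> = ennreal (measure lborel (box l u))" using *(2) by (simp add: measure_completion)
  also have "\<dots> = (\<Prod>b\<in>Basis. (u - l) \<bullet> b)"
    using lu by (simp add: measure_lborel_box_eq)
  finally show "emeasure (distr lborel borel T) (box l u) = (\<Prod>b\<in>Basis. (u - l) \<bullet> b)" .
qed simp

lemma haar_prob_SU2_exists: "\<exists>\<mu>. haar_prob_SU2 \<mu>"
proof -
  define U :: "(real^4) set" where "U = cball 0 1 - {0}"
  have U: "U \<in> sets borel" by (simp add: U_def)
  have vU: "emeasure lborel U = emeasure lborel (cball (0::real^4) 1)"
    unfolding U_def by (rule emeasure_Diff_null_set) auto
  have U0: "emeasure lborel U \<noteq> 0" and Uf: "emeasure lborel U \<noteq> \<infinity>"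
    unfolding vU by (auto simp: emeasure_cball unit_ball_vol_def less_imp_neq[symmetric] 
       ennreal_eq_0_iff not_le Gamma_real_pos divide_pos_pos)
  define L where "L = uniform_measure lborel U"
  interpret L: prob_space L unfolding L_def using U0 Uf by (rule prob_space_uniform_measure)
  define R where "R = restrict_space (borel :: (complex^2^2) measure) SU2"
  have f: "to_SU2 \<in> measurable L R"
    unfolding R_def L_def
    by (intro measurable_restrict_space2) (use borel_measurable_to_SU2 to_SU2_in in \<open>auto simp: measurable_def\<close>)
  define \<mu> where "\<mu> = distr L R to_SU2"
  have spR: "space R = SU2" by (simp add: R_def space_restrict_space)
  have "distr \<mu> \<mu> (\<lambda>k. h ** k) = \<mu>" if h: "h \<in> SU2" for h
  proof -
    have "(\<lambda>k. h ** k) \<in> borel_measurable borel"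
      by (intro borel_measurable_continuous_onI)
         (auto simp: matrix_matrix_mult_def intro!: continuous_intros)
    then have mh: "(\<lambda>k. h ** k) \<in> measurable R R" unfolding R_def
      by (intro measurable_restrict_space3) (use SU2_mult h in auto)
    obtain T where T: "orthogonal_transformation T" 
      and Th: "\<And>x. x \<noteq> 0 \<Longrightarrow> to_SU2 (T x) = h ** to_SU2 x"
      using SU2_left_mult_orthogonal[OF h] by blast
    have mT: "T \<in> borel_measurable borel"
      using orthogonal_transformation_linear[OF T]
      by (simp add: linear_linear linear_continuous_on borel_measurable_continuous_onI)
    have nT: "norm (T x) = norm x" for x using T by (simp add: orthogonal_transformation)
    have TU: "T x \<in> U \<longleftrightarrow> x \<in> U" for x 
      using nT[of x] by (auto simp: U_def)
    show ?thesis
    proof (rule measure_eqI)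
      fix A assume "A \<in> sets (distr \<mu> \<mu> ((**) h))"
      then have A: "A \<in> sets R" by (simp add: \<mu>_def)
      have fs: "to_SU2 -` B \<in> sets borel" if "B \<in> sets R" for B 
        using measurable_sets[OF f that] by (simp add: L_def)
      have e: "emeasure \<mu> B = emeasure lborel (U \<inter> to_SU2 -` B) / emeasure lborel U" if "B \<in> sets R" for B
        using f fs[OF that] that U unfolding \<mu>_def by (simp add: emeasure_distr L_def)
      let ?B = "(\<lambda>k. h ** k) -` A \<inter> SU2"
      have B: "?B \<in> sets R" using measurable_sets[OF mh A] by (simp add: spR)
      have mh': "(\<lambda>k. h ** k) \<in> measurable \<mu> \<mu>" using mh by (simp add: \<mu>_def)
      have "emeasure (distr \<mu> \<mu> ((**) h)) A = emeasure \<mu> ?B"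
        using mh' A by (simp add: emeasure_distr \<mu>_def spR)
      also have "\<dots> = emeasure lborel (U \<inter> to_SU2 -` ?B) / emeasure lborel U" by (rule e[OF B])
      also have "U \<inter> to_SU2 -` ?B = T -` (U \<inter> to_SU2 -` A)"
      proof -
        have "x \<noteq> 0" if "x \<in> U" for x using that by (simp add: U_def)
        then show ?thesis by (auto simp: TU Th to_SU2_in)
      qed
      also have "emeasure lborel \<dots> = emeasure (distr lborel borel T) (U \<inter> to_SU2 -` A)"
        using mT U fs[OF A] by (simp add: emeasure_distr)
      also have "\<dots> = emeasure lborel (U \<inter> to_SU2 -` A)" by (simp add: lborel_distr_orthogonal[OF T])
      also have "\<dots> / emeasure lborel U = emeasure \<mu> A" by (rule e[OF A, symmetric])
      finally show "emeasure (distr \<mu> \<mu> ((**) h)) A = emeasure \<mu> A" .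
    qed simp
  qed
  moreover have "prob_space \<mu>" unfolding \<mu>_def by (rule L.prob_space_distr[OF f])
  moreover have "sets \<mu> = sets (restrict_space borel SU2)" by (simp add: \<mu>_def R_def)
  ultimately show ?thesis unfolding haar_prob_SU2_def by blast
qed

end

theory Submission
  imports Defs
begin

text \<open>Averaging over the diagonal torus turns the spherical trace function into a matrix coefficient of a single weight \<open>q\<close>,
  an integral over the unit sphere of \<open>\<complex>\<^sup>2\<close>. For the extreme weights \<open>q = \<plusminus>\<ell>\<close> the absolute value of the integrand is
  concentrated where both \<open>x\<close> and \<open>g x\<close> are close to a coordinate axis, which forces one off-diagonal entry
  of \<open>g\<close> to be small. The functional equation exchanges \<open>g\<close> and its adjoint, so that the other off-diagonal entry is small
  as well; hence \<open>g\<close> is close to \<open>\<D>\<close>. Absolute values suffice, so all bounds are uniform in \<open>\<nu>\<close>.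

  For \<open>q = 0\<close>, the monomial \<open>(u v)\<^sup>\<ell>\<close> is, up to a factor of size about \<open>2\<^sup>-\<^sup>2\<^sup>\<ell> \<surd>\<ell>\<close>, the average of
  \<open>\<zeta>\<^sup>-\<^sup>\<ell> (u + \<zeta> v)\<^sup>2\<^sup>\<ell>\<close> over the unit circle. So the coefficient of weight \<open>0\<close> at \<open>g\<close> is an average of extreme
  coefficients at \<open>k\<^sub>1\<^sup>-\<^sup>1 g k\<^sub>2\<close>, with \<open>k\<^sub>1, k\<^sub>2\<close> taking the axes to the equator. Localization at \<open>\<D>\<close> then reads
  \<open>a \<approx> \<omega> d\<close> and \<open>b \<approx> \<omega>' c\<close> for two independent points \<open>\<omega>, \<omega>'\<close> of the unit circle.
  Comparing absolute values bounds \<open>D(g)\<close>; the measure of the admissible \<open>(\<omega>, \<omega>')\<close> gives the bound in terms of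
  the distance to \<open>\<S>\<close>.\<close>

section \<open>Lebesgue measure on \<open>\<complex>\<^sup>2\<close> and \<open>SL\<^sub>2(\<complex>)\<close>\<close>

text \<open>Extreme weight vectors concentrate at points, so absolute values lose little there. At
  weight 0 they lose too much: for the upper unitriangular \<open>g\<close> with corner 1 there is
  an \<open>x\<close> such that \<open>x\<close> and \<open>g x\<close> both lie on the equator, so
  the absolute value of the integrand shows no rapid decay although \<open>D_fun g = 1\<close>.
  Averaging over rotations recovers the decay at the price of a factor \<open>sqrt l\<close> from
  the central binomial coefficient. With \<open>\<delta> = sqrt (K * ln l / l)\<close>: if a rotated
  matrix has off-diagonal part above \<open>\<delta> * norm g\<close>, its extreme coefficient is
  below a prescribed power of \<open>l\<close> once \<open>K\<close> is large. The remaining angles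
  form sets of measures \<open>P\<close> and \<open>P'\<close>, where \<open>P * max |a| |d|\<close>
  and \<open>P' * max |b| |c|\<close> are at most of size \<open>\<delta> * norm g\<close>. The
  larger maximum is comparable to \<open>norm g\<close>, so \<open>P * P'\<close> is at most of size
  \<open>\<delta>\<close>, and times the smaller maximum of size \<open>\<delta>^2 * norm g\<close>.
  For small \<open>\<delta>\<close> the smaller maximum controls the distance to \<S> up to a
  multiple of \<open>\<delta>\<close>. After the factor \<open>sqrt l\<close> this leaves
  \<open>sqrt (ln l)\<close>, respectively \<open>ln l / (sqrt l * dist)\<close>.\<close>

definition act :: "complex^2^2 \<Rightarrow> complex \<times> complex \<Rightarrow> complex \<times> complex" where
  "act g x = (g$1$1 * fst x + g$1$2 * snd x, g$2$1 * fst x + g$2$2 * snd x)"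

lemma act_mat2: "act (mat2 a b c d) x = (a * fst x + b * snd x, c * fst x + d * snd x)"
  by (simp add: act_def)

lemma act_mult: "act (g ** h) x = act g (act h x)"
  by (simp add: act_def matrix_matrix_mult_def sum_2 algebra_simps)

lemma borel_measurable_fst_snd [measurable]:
  "fst \<in> borel_measurable (borel :: (complex \<times> complex) measure)"
  "snd \<in> borel_measurable (borel :: (complex \<times> complex) measure)"
  by (intro borel_measurable_continuous_onI continuous_intros)+

lemma cnj_borel_measurable [measurable]: "cnj \<in> borel_measurable borel"
  by (intro borel_measurable_continuous_onI continuous_intros)

lemma act_measurable [measurable]: "act g \<in> borel_measurable borel"
  unfolding act_def by (intro borel_measurable_Pair) measurable

lemma nn_integral_lborel_pair:
  fixes f :: "'a::euclidean_space \<times> 'b::euclidean_space \<Rightarrow> ennreal"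
  assumes [measurable]: "f \<in> borel_measurable borel"
  shows "(\<integral>\<^sup>+x. f x \<partial>lborel) = (\<integral>\<^sup>+u. \<integral>\<^sup>+v. f (u, v) \<partial>lborel \<partial>lborel)"
    and "(\<integral>\<^sup>+x. f x \<partial>lborel) = (\<integral>\<^sup>+v. \<integral>\<^sup>+u. f (u, v) \<partial>lborel \<partial>lborel)"
proof -
  have f: "f \<in> borel_measurable (lborel \<Otimes>\<^sub>M lborel)"
    by (simp add: lborel_prod)
  show "(\<integral>\<^sup>+x. f x \<partial>lborel) = (\<integral>\<^sup>+u. \<integral>\<^sup>+v. f (u, v) \<partial>lborel \<partial>lborel)"
    using lborel.nn_integral_fst[OF f] by (simp add: lborel_prod)
  show "(\<integral>\<^sup>+x. f x \<partial>lborel) = (\<integral>\<^sup>+v. \<integral>\<^sup>+u. f (u, v) \<partial>lborel \<partial>lborel)"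
    using lborel_pair.nn_integral_snd[OF f] by (simp add: lborel_prod)
qed

lemma nn_integral_lborel_plus:
  fixes f :: "'a::euclidean_space \<Rightarrow> ennreal"
  assumes [measurable]: "f \<in> borel_measurable borel"
  shows "(\<integral>\<^sup>+u. f (u + t) \<partial>lborel) = (\<integral>\<^sup>+u. f u \<partial>lborel)"
proof -
  have "(\<integral>\<^sup>+u. f u \<partial>lborel) = (\<integral>\<^sup>+u. f u \<partial>distr lborel borel ((+) t))"
    by (simp add: lborel_distr_plus)
  also have "\<dots> = (\<integral>\<^sup>+u. f (t + u) \<partial>lborel)"
    by (subst nn_integral_distr) auto
  finally show ?thesis by (simp add: add.commute)
qed

lemma nn_integral_lborel_upper_shear:
  fixes f :: "complex \<times> complex \<Rightarrow> ennreal"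
  assumes [measurable]: "f \<in> borel_measurable borel"
  shows "(\<integral>\<^sup>+x. f (act (mat2 1 b 0 1) x) \<partial>lborel) = (\<integral>\<^sup>+x. f x \<partial>lborel)"
proof -
  have "(\<integral>\<^sup>+x. f (act (mat2 1 b 0 1) x) \<partial>lborel) = (\<integral>\<^sup>+v. \<integral>\<^sup>+u. f (u + b * v, v) \<partial>lborel \<partial>lborel)"
    by (subst nn_integral_lborel_pair(2)) (simp_all add: act_mat2)
  also have "\<dots> = (\<integral>\<^sup>+v. \<integral>\<^sup>+u. f (u, v) \<partial>lborel \<partial>lborel)"
    by (intro nn_integral_cong nn_integral_lborel_plus) measurable
  finally show ?thesis by (simp add: nn_integral_lborel_pair(2))
qed

lemma nn_integral_lborel_lower_shear:
  fixes f :: "complex \<times> complex \<Rightarrow> ennreal"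
  assumes [measurable]: "f \<in> borel_measurable borel"
  shows "(\<integral>\<^sup>+x. f (act (mat2 1 0 c 1) x) \<partial>lborel) = (\<integral>\<^sup>+x. f x \<partial>lborel)"
proof -
  have "(\<integral>\<^sup>+x. f (act (mat2 1 0 c 1) x) \<partial>lborel) = (\<integral>\<^sup>+u. \<integral>\<^sup>+v. f (u, v + c * u) \<partial>lborel \<partial>lborel)"
    by (subst nn_integral_lborel_pair(1)) (simp_all add: act_mat2 add.commute)
  also have "\<dots> = (\<integral>\<^sup>+u. \<integral>\<^sup>+v. f (u, v) \<partial>lborel \<partial>lborel)"
    by (intro nn_integral_cong nn_integral_lborel_plus) measurable
  finally show ?thesis by (simp add: nn_integral_lborel_pair(1))
qed

lemma SL2C_mat2: "mat2 a b c d \<in> SL2C \<longleftrightarrow> a * d - b * c = 1"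
  by (simp add: SL2C_def det_2)

text \<open>\<open>SL\<^sub>2\<close> of a field is generated by shears, and shears preserve Lebesgue measure by Fubini.\<close>

lemma nn_integral_lborel_SL2C:
  fixes f :: "complex \<times> complex \<Rightarrow> ennreal"
  assumes g: "g \<in> SL2C" and [measurable]: "f \<in> borel_measurable borel"
  shows "(\<integral>\<^sup>+x. f (act g x) \<partial>lborel) = (\<integral>\<^sup>+x. f x \<partial>lborel)"
proof -
  have *: "(\<integral>\<^sup>+x. f (act g x) \<partial>lborel) = (\<integral>\<^sup>+x. f x \<partial>lborel)"
    if g: "g \<in> SL2C" and c: "g$2$1 \<noteq> 0" and [measurable]: "f \<in> borel_measurable borel"
    for g and f :: "complex \<times> complex \<Rightarrow> ennreal"
  proof -
    define a b c d where abcd: "a = g$1$1" "b = g$1$2" "c = g$2$1" "d = g$2$2"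
    have det: "a * d - b * c = 1" using g by (simp add: SL2C_def det_2 abcd)
    have c0: "c \<noteq> 0" using c by (simp add: abcd)
    \<comment> \<open>A matrix with \<open>c \<noteq> 0\<close> is a product upper, lower, upper
      shear. These \<open>p\<close> and \<open>q\<close> give the diagonal entries; the determinant
      then forces the upper right entry.\<close>
    define p q where pq: "p = (a - 1) / c" "q = (d - 1) / c"
    have "1 + p * c = a" "c * q + 1 = d" "q + p * d = b"
      using det c0 by (simp_all add: pq field_simps)
    then have "g = mat2 1 p 0 1 ** (mat2 1 0 c 1 ** mat2 1 q 0 1)"
      by (subst mat2_eta[of g]) (simp add: mat2_mult flip: abcd)
    then have "(\<integral>\<^sup>+x. f (act g x) \<partial>lborel) =
      (\<integral>\<^sup>+x. f (act (mat2 1 p 0 1) (act (mat2 1 0 c 1) (act (mat2 1 q 0 1) x))) \<partial>lborel)"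
      by (simp add: act_mult)
    also have "\<dots> = (\<integral>\<^sup>+x. f (act (mat2 1 p 0 1) (act (mat2 1 0 c 1) x)) \<partial>lborel)"
      by (rule nn_integral_lborel_upper_shear) measurable
    also have "\<dots> = (\<integral>\<^sup>+x. f (act (mat2 1 p 0 1) x) \<partial>lborel)"
      by (rule nn_integral_lborel_lower_shear) measurable
    also have "\<dots> = (\<integral>\<^sup>+x. f x \<partial>lborel)"
      by (rule nn_integral_lborel_upper_shear) measurable
    finally show ?thesis .
  qed
  show ?thesis
  proof (cases "g$2$1 = 0")
    case True
    \<comment> \<open>For an upper triangular \<open>g\<close> the entry \<open>g$1$1\<close> is
      nonzero, so one lower shear leads back to the generic case.\<close>
    define h where "h = mat2 1 0 1 1 ** g"
    have h: "h = mat2 (g$1$1) (g$1$2) (g$1$1) (g$1$2 + g$2$2)"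
      using True by (subst h_def, subst (1) mat2_eta[of g]) (simp add: mat2_mult)
    have "g$1$1 * g$2$2 = 1" using g True by (simp add: SL2C_def det_2)
    then have h': "h \<in> SL2C" "h$2$1 \<noteq> 0"
      by (auto simp: h SL2C_mat2 algebra_simps)
    have "g = mat2 1 0 (-1) 1 ** h"
      using True by (subst mat2_eta[of g]) (simp add: h mat2_mult)
    then have "(\<integral>\<^sup>+x. f (act g x) \<partial>lborel) = (\<integral>\<^sup>+x. f (act (mat2 1 0 (-1) 1) (act h x)) \<partial>lborel)"
      by (simp add: act_mult)
    also have "\<dots> = (\<integral>\<^sup>+x. f (act (mat2 1 0 (-1) 1) x) \<partial>lborel)"
      by (rule *[OF h', where f = "\<lambda>x. f (act (mat2 1 0 (-1) 1) x)"]) measurable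
    also have "\<dots> = (\<integral>\<^sup>+x. f x \<partial>lborel)"
      by (rule nn_integral_lborel_lower_shear) measurable
    finally show ?thesis .
  next
    case False
    then show ?thesis using * g by simp
  qed
qed

section \<open>Conjugations and dilations\<close>

lemma nn_integral_lborel_cnj:
  fixes f :: "complex \<Rightarrow> ennreal"
  assumes [measurable]: "f \<in> borel_measurable borel"
  shows "(\<integral>\<^sup>+u. f (cnj u) \<partial>lborel) = (\<integral>\<^sup>+u. f u \<partial>lborel)"
proof -
  define c :: "complex \<Rightarrow> real" where "c j = (if j = 1 then 1 else -1)" for j
  have T: "0 + (\<Sum>j\<in>Basis. (c j * (x \<bullet> j)) *\<^sub>R j) = cnj x" for x
    by (simp add: Basis_complex_def c_def inner_complex_def complex_eq_iff)
  have "lborel = density (distr lborel borel cnj) (\<lambda>_. (\<Prod>j\<in>Basis. \<bar>c j\<bar>))"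
    using lborel_affine_euclidean[where c = c and t = 0] unfolding T by (auto simp: c_def)
  also have "(\<lambda>_::complex. ennreal (\<Prod>j\<in>Basis. \<bar>c j\<bar>)) = (\<lambda>_. 1)"
    by (simp add: c_def Basis_complex_def)
  finally have "lborel = distr lborel borel cnj" by (simp add: density_1)
  then have "(\<integral>\<^sup>+u. f u \<partial>lborel) = (\<integral>\<^sup>+u. f u \<partial>distr lborel borel cnj)" by simp
  then show ?thesis by (simp add: nn_integral_distr)
qed

lemma nn_integral_lborel_cnj_snd:
  fixes f :: "complex \<times> complex \<Rightarrow> ennreal"
  assumes [measurable]: "f \<in> borel_measurable borel"
  shows "(\<integral>\<^sup>+x. f (fst x, cnj (snd x)) \<partial>lborel) = (\<integral>\<^sup>+x. f x \<partial>lborel)"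
proof -
  have "(\<integral>\<^sup>+x. f (fst x, cnj (snd x)) \<partial>lborel) = (\<integral>\<^sup>+u. \<integral>\<^sup>+v. f (u, cnj v) \<partial>lborel \<partial>lborel)"
    by (subst nn_integral_lborel_pair(1))
       (auto intro!: measurable_compose[OF borel_measurable_Pair assms])
  also have "\<dots> = (\<integral>\<^sup>+u. \<integral>\<^sup>+v. f (u, v) \<partial>lborel \<partial>lborel)"
    by (intro nn_integral_cong nn_integral_lborel_cnj) measurable
  finally show ?thesis by (simp add: nn_integral_lborel_pair(1))
qed

lemma nn_integral_lborel_cnj_fst:
  fixes f :: "complex \<times> complex \<Rightarrow> ennreal"
  assumes [measurable]: "f \<in> borel_measurable borel"
  shows "(\<integral>\<^sup>+x. f (cnj (fst x), snd x) \<partial>lborel) = (\<integral>\<^sup>+x. f x \<partial>lborel)"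
proof -
  have "(\<integral>\<^sup>+x. f (cnj (fst x), snd x) \<partial>lborel) = (\<integral>\<^sup>+v. \<integral>\<^sup>+u. f (cnj u, v) \<partial>lborel \<partial>lborel)"
    by (subst nn_integral_lborel_pair(2))
       (auto intro!: measurable_compose[OF borel_measurable_Pair assms])
  also have "\<dots> = (\<integral>\<^sup>+v. \<integral>\<^sup>+u. f (u, v) \<partial>lborel \<partial>lborel)"
    by (intro nn_integral_cong nn_integral_lborel_cnj) measurable
  finally show ?thesis by (simp add: nn_integral_lborel_pair(2))
qed

lemma nn_integral_lborel_scale:
  fixes f :: "complex \<times> complex \<Rightarrow> ennreal"
  assumes [measurable]: "f \<in> borel_measurable borel" and t: "t > 0"
  shows "(\<integral>\<^sup>+x. f x \<partial>lborel) = ennreal (t ^ 4) * (\<integral>\<^sup>+x. f (t *\<^sub>R x) \<partial>lborel)"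
proof -
  have D: "DIM(complex \<times> complex) = 4" by simp
  have "(\<integral>\<^sup>+x. f x \<partial>lborel) = (\<integral>\<^sup>+x. f x \<partial>density (distr lborel borel (\<lambda>x. 0 + t *\<^sub>R x)) (\<lambda>_. ennreal (\<bar>t\<bar> ^ DIM(complex \<times> complex))))"
    by (subst lborel_affine[of t 0]) (use t in auto)
  also have "\<dots> = ennreal (t ^ 4) * (\<integral>\<^sup>+x. f (t *\<^sub>R x) \<partial>lborel)"
    unfolding D using t by (simp add: nn_integral_density nn_integral_distr nn_integral_cmult)
  finally show ?thesis .
qed

section \<open>The invariant measure on the sphere\<close>

definition homogeneous :: "(complex \<times> complex \<Rightarrow> ennreal) \<Rightarrow> bool" where
  "homogeneous F \<longleftrightarrow> F \<in> borel_measurable borel \<and> (\<forall>t>0. \<forall>x. ennreal (t ^ 4) * F (t *\<^sub>R x) = F x)"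

text \<open>Positivity is only asked almost everywhere, which admits \<open>cmod (snd x)\<close>.
  Its shell is a product region and suits integrands supported near
  \<open>fst x = 0\<close>.\<close>

definition radius_fun :: "(complex \<times> complex \<Rightarrow> real) \<Rightarrow> bool" where
  "radius_fun \<rho> \<longleftrightarrow> \<rho> \<in> borel_measurable borel \<and> (\<forall>t>0. \<forall>x. \<rho> (t *\<^sub>R x) = t * \<rho> x) \<and> (AE x in lborel. \<rho> x > 0)"

definition shell :: "(complex \<times> complex \<Rightarrow> real) \<Rightarrow> (complex \<times> complex) set" where
  "shell \<rho> = {x. 1 \<le> \<rho> x \<and> \<rho> x < 2}"

lemma radius_fun_measurable: "radius_fun \<rho> \<Longrightarrow> \<rho> \<in> borel_measurable borel"
  by (simp add: radius_fun_def)

lemma homogeneous_measurable: "homogeneous F \<Longrightarrow> F \<in> borel_measurable borel"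
  by (simp add: homogeneous_def)

lemma shell_sets: "radius_fun \<rho> \<Longrightarrow> shell \<rho> \<in> sets borel"
proof -
  assume "radius_fun \<rho>"
  note [measurable] = radius_fun_measurable[OF this]
  show ?thesis unfolding shell_def by measurable
qed

text \<open>A homogeneous \<open>F\<close> of degree \<open>-4\<close> makes \<open>F dx\<close> invariant under dilations, and every dyadic
  shell is a fundamental domain for the dilations by powers of 2.\<close>

lemma shell_integral_indep:
  assumes F: "homogeneous F" and r: "radius_fun \<rho>" and r': "radius_fun \<rho>'"
  shows "(\<integral>\<^sup>+x\<in>shell \<rho>. F x \<partial>lborel) = (\<integral>\<^sup>+x\<in>shell \<rho>'. F x \<partial>lborel)"
proof -
  note [measurable] = homogeneous_measurable[OF F] radius_fun_measurable[OF r] radius_fun_measurable[OF r']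
  define N where "N = density lborel F"
  have sN [measurable_cong]: "sets N = sets borel" by (simp add: N_def)
  have N: "emeasure N B = (\<integral>\<^sup>+x\<in>B. F x \<partial>lborel)" if "B \<in> sets borel" for B
    using that by (simp add: N_def emeasure_density)
  define A where "A \<rho> k = {x. \<rho> x > 0 \<and> \<lfloor>log 2 (\<rho> x)\<rfloor> = k}" for \<rho> :: "complex \<times> complex \<Rightarrow> real" and k
  have A_sets: "A \<rho> k \<in> sets borel" if "radius_fun \<rho>" for \<rho> k
  proof -
    note [measurable] = radius_fun_measurable[OF that]
    show ?thesis unfolding A_def by measurable
  qed
  have A0: "shell \<rho> = A \<rho> 0" for \<rho>
    unfolding shell_def A_def using floor_log_eq_powr_iff[of _ 2 0] by force
  have scale: "emeasure N {x. t *\<^sub>R x \<in> B} = emeasure N B" if [measurable]: "B \<in> sets borel" and t: "t > 0" for t B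
  proof -
    have "{x. t *\<^sub>R x \<in> B} \<in> sets borel"
      using measurable_sets[of "\<lambda>x. t *\<^sub>R x" borel borel B] by (simp add: vimage_def)
    then have "emeasure N {x. t *\<^sub>R x \<in> B} = (\<integral>\<^sup>+x. F x * indicator B (t *\<^sub>R x) \<partial>lborel)"
      by (simp add: N indicator_def cong: if_cong)
    also have "\<dots> = (\<integral>\<^sup>+x. ennreal (t ^ 4) * (F (t *\<^sub>R x) * indicator B (t *\<^sub>R x)) \<partial>lborel)"
      using F t by (intro nn_integral_cong) (metis homogeneous_def mult.assoc)
    also have "\<dots> = ennreal (t ^ 4) * (\<integral>\<^sup>+x. F (t *\<^sub>R x) * indicator B (t *\<^sub>R x) \<partial>lborel)"
      by (rule nn_integral_cmult) measurable
    also have "\<dots> = emeasure N B"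
      using nn_integral_lborel_scale[of "\<lambda>x. F x * indicator B x" t] t by (simp add: N)
    finally show ?thesis .
  qed
  have A_scale: "2 powr (- real_of_int k) *\<^sub>R x \<in> A \<rho> j \<longleftrightarrow> x \<in> A \<rho> (j + k)" if "radius_fun \<rho>" for \<rho> j k x
  proof -
    have e: "\<rho> (2 powr (- real_of_int k) *\<^sub>R x) = 2 powr (- real_of_int k) * \<rho> x"
      using that unfolding radius_fun_def by (metis powr_gt_zero zero_neq_numeral)
    show ?thesis
      by (auto simp: A_def e log_mult zero_less_mult_iff simp del: scaleR_Pair)
  qed
  have split: "emeasure N B = (\<Sum>n. emeasure N (B \<inter> A \<rho> (e n)))"
    if "radius_fun \<rho>" "bij e" and B: "B \<in> sets borel" for B \<rho> and e :: "nat \<Rightarrow> int"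
  proof -
    have "AE x in N. \<rho> x > 0"
      unfolding N_def using that by (subst AE_density) (auto simp: radius_fun_def)
    then have "emeasure N B = emeasure N (\<Union>n. B \<inter> A \<rho> (e n))"
    proof (intro emeasure_eq_AE)
      show "AE x in N. x \<in> B \<longleftrightarrow> x \<in> (\<Union>n. B \<inter> A \<rho> (e n))"
        using \<open>AE x in N. \<rho> x > 0\<close>
      proof eventually_elim
        case (elim x)
        obtain n where "e n = \<lfloor>log 2 (\<rho> x)\<rfloor>" using \<open>bij e\<close> by (metis bij_pointE)
        with elim show ?case by (auto simp: A_def intro!: exI[of _ n])
      qed
    qed (use B A_sets[OF \<open>radius_fun \<rho>\<close>] in \<open>auto simp: sN\<close>)
    also have "\<dots> = (\<Sum>n. emeasure N (B \<inter> A \<rho> (e n)))"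
    proof (rule suminf_emeasure[symmetric])
      show "disjoint_family (\<lambda>n. B \<inter> A \<rho> (e n))"
        using bij_is_inj[OF \<open>bij e\<close>] by (auto simp: disjoint_family_on_def A_def inj_def)
    qed (use B A_sets[OF \<open>radius_fun \<rho>\<close>] in \<open>auto simp: sN\<close>)
    finally show ?thesis .
  qed
  have "emeasure N (A \<rho> 0) = (\<Sum>n. emeasure N (A \<rho> 0 \<inter> A \<rho>' (int_decode n)))"
    by (rule split[OF r' bij_int_decode A_sets[OF r]])
  \<comment> \<open>Dilation by \<open>2 powr (- k)\<close> carries
    \<open>A \<rho> 0 \<inter> A \<rho>' k\<close> to
    \<open>A \<rho> (- k) \<inter> A \<rho>' 0\<close>. As \<open>- k\<close> also runs through all
    integers, the pieces reassemble the other shell.\<close>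
  also have "\<dots> = (\<Sum>n. emeasure N (A \<rho>' 0 \<inter> A \<rho> (- int_decode n)))"
  proof (intro suminf_cong)
    fix n
    define k where "k = int_decode n"
    have "emeasure N (A \<rho>' 0 \<inter> A \<rho> (- k)) = emeasure N {x. 2 powr (- real_of_int k) *\<^sub>R x \<in> A \<rho>' 0 \<inter> A \<rho> (- k)}"
      by (rule scale[symmetric]) (use A_sets r r' in auto)
    also have "{x. 2 powr (- real_of_int k) *\<^sub>R x \<in> A \<rho>' 0 \<inter> A \<rho> (- k)} = A \<rho> 0 \<inter> A \<rho>' k"
      using A_scale[OF r, of k _ "-k"] A_scale[OF r', of k _ 0] by auto
    finally show "emeasure N (A \<rho> 0 \<inter> A \<rho>' (int_decode n)) = emeasure N (A \<rho>' 0 \<inter> A \<rho> (- int_decode n))"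
      by (simp add: k_def)
  qed
  also have "\<dots> = emeasure N (A \<rho>' 0)"
  proof (rule split[OF r _ A_sets[OF r'], symmetric])
    have "bij (uminus \<circ> int_decode)" by (rule bij_comp[OF bij_int_decode bij_uminus])
    then show "bij (\<lambda>n. - int_decode n)" by (simp add: comp_def)
  qed
  finally show ?thesis
    unfolding A0 by (simp add: N A_sets r r')
qed

lemma norm_pair_sq: "(norm x)\<^sup>2 = (cmod (fst x))\<^sup>2 + (cmod (snd x))\<^sup>2" for x :: "complex \<times> complex"
  by (simp add: norm_prod_def)

lemma SU2_mat2: "mat2 \<alpha> \<beta> (- cnj \<beta>) (cnj \<alpha>) \<in> SU2 \<longleftrightarrow> (cmod \<alpha>)\<^sup>2 + (cmod \<beta>)\<^sup>2 = 1"
proof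
  assume "mat2 \<alpha> \<beta> (- cnj \<beta>) (cnj \<alpha>) \<in> SU2"
  then obtain a b where "mat2 \<alpha> \<beta> (- cnj \<beta>) (cnj \<alpha>) = mat2 a b (- cnj b) (cnj a)" and ab: "(cmod a)\<^sup>2 + (cmod b)\<^sup>2 = 1"
    unfolding SU2_iff by blast
  then have "\<alpha> = a" "\<beta> = b" by (metis mat2_nth)+
  with ab show "(cmod \<alpha>)\<^sup>2 + (cmod \<beta>)\<^sup>2 = 1" by simp
next
  assume "(cmod \<alpha>)\<^sup>2 + (cmod \<beta>)\<^sup>2 = 1"
  then show "mat2 \<alpha> \<beta> (- cnj \<beta>) (cnj \<alpha>) \<in> SU2" unfolding SU2_iff by blast
qed

lemma SU2_mat2': "(cmod \<alpha>)\<^sup>2 + (cmod \<gamma>)\<^sup>2 = 1 \<Longrightarrow> mat2 \<alpha> (- cnj \<gamma>) \<gamma> (cnj \<alpha>) \<in> SU2"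
  using SU2_mat2[of \<alpha> "- cnj \<gamma>"] by simp

lemma SU2_subset_SL2C: "k \<in> SU2 \<Longrightarrow> k \<in> SL2C"
  by (simp add: SU2_def SL2C_def)

lemma norm_act_SU2: "k \<in> SU2 \<Longrightarrow> norm (act k x) = norm x"
proof -
  assume "k \<in> SU2"
  then obtain a b where k: "k = mat2 a b (- cnj b) (cnj a)" and ab: "(cmod a)\<^sup>2 + (cmod b)\<^sup>2 = 1"
    unfolding SU2_iff by blast
  define u v where uv: "u = fst x" "v = snd x"
  have "complex_of_real ((norm (act k x))\<^sup>2) = (a * u + b * v) * cnj (a * u + b * v) + (- cnj b * u + cnj a * v) * cnj (- cnj b * u + cnj a * v)"
    by (simp only: norm_pair_sq k act_mat2 uv of_real_add complex_norm_square fst_conv snd_conv)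
  also have "\<dots> = (a * cnj a + b * cnj b) * (u * cnj u + v * cnj v)"
    by (simp add: algebra_simps)
  also have "\<dots> = complex_of_real (((cmod a)\<^sup>2 + (cmod b)\<^sup>2) * (norm x)\<^sup>2)"
    by (simp only: norm_pair_sq uv of_real_add of_real_mult complex_norm_square)
  finally have "(norm (act k x))\<^sup>2 = (norm x)\<^sup>2" using ab by (simp only: of_real_eq_iff mult_1)
  then show ?thesis by simp
qed

text \<open>\<open>right_rot x y\<close> is \<open>\<parallel>x\<parallel>\<close> times the image of \<open>y\<close> under the element of \<open>SU(2)\<close> with first column \<open>x / \<parallel>x\<parallel>\<close>;
  in the real coordinates \<open>(fst x, cnj (snd x))\<close> it is, as a function of \<open>x\<close>, a matrix of \<open>SU(2)\<close>.\<close>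

definition right_rot :: "complex \<times> complex \<Rightarrow> complex \<times> complex \<Rightarrow> complex \<times> complex" where
  "right_rot x y = (fst x * fst y - cnj (snd x) * snd y, snd x * fst y + cnj (fst x) * snd y)"

lemma right_rot_act:
  assumes "x \<noteq> 0"
  shows "\<exists>k\<in>SU2. \<forall>y. right_rot x y /\<^sub>R norm x = act k y"
proof -
  define \<alpha> \<gamma> where ag: "\<alpha> = fst x /\<^sub>R norm x" "\<gamma> = snd x /\<^sub>R norm x"
  have "(cmod \<alpha>)\<^sup>2 + (cmod \<gamma>)\<^sup>2 = ((cmod (fst x))\<^sup>2 + (cmod (snd x))\<^sup>2) / (norm x)\<^sup>2"
    by (simp add: ag power_mult_distrib divide_inverse distrib_left power_inverse mult.commute)
  then have "(cmod \<alpha>)\<^sup>2 + (cmod \<gamma>)\<^sup>2 = 1" using assms by (simp flip: norm_pair_sq)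
  moreover have "right_rot x y /\<^sub>R norm x = act (mat2 \<alpha> (- cnj \<gamma>) \<gamma> (cnj \<alpha>)) y" for y
    by (simp add: right_rot_def act_mat2 ag prod_eq_iff algebra_simps)
  ultimately show ?thesis using SU2_mat2' by blast
qed

lemma norm_right_rot: "norm (right_rot x y) = norm x * norm y"
proof (cases "x = 0")
  case False
  then obtain k where "k \<in> SU2" "right_rot x y /\<^sub>R norm x = act k y" using right_rot_act by blast
  then have "norm (right_rot x y /\<^sub>R norm x) = norm y" by (simp add: norm_act_SU2)
  then show ?thesis using False by (simp add: field_simps)
qed (simp add: right_rot_def zero_prod_def)

lemma nn_integral_lborel_right_rot:
  fixes f :: "complex \<times> complex \<Rightarrow> ennreal"
  assumes y: "norm y = 1" and [measurable]: "f \<in> borel_measurable borel"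
  shows "(\<integral>\<^sup>+x. f (right_rot x y) \<partial>lborel) = (\<integral>\<^sup>+x. f x \<partial>lborel)"
proof -
  define k where "k = mat2 (fst y) (- snd y) (cnj (snd y)) (cnj (fst y))"
  have "(cmod (fst y))\<^sup>2 + (cmod (snd y))\<^sup>2 = 1" using y by (simp flip: norm_pair_sq)
  then have k: "k \<in> SL2C" 
    using SU2_subset_SL2C[of k] SU2_mat2'[of "fst y" "cnj (snd y)"] by (simp add: k_def)
  have m: "(\<lambda>x. right_rot x y) \<in> borel_measurable borel" 
    unfolding right_rot_def by (intro borel_measurable_Pair) measurable
  have m2: "(\<lambda>x. (fst x, cnj (snd x))) \<in> borel_measurable (borel :: (complex \<times> complex) measure)"
    by (intro borel_measurable_Pair) measurable
  have "(\<integral>\<^sup>+x. f (right_rot x y) \<partial>lborel) = (\<integral>\<^sup>+x. f (right_rot (fst x, cnj (snd x)) y) \<partial>lborel)"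
    by (rule nn_integral_lborel_cnj_snd[symmetric]) (rule measurable_compose[OF m], measurable)
  also have "\<dots> = (\<integral>\<^sup>+x. (\<lambda>x. f (fst x, cnj (snd x))) (act k x) \<partial>lborel)"
    by (simp add: right_rot_def act_mat2 k_def mult.commute add.commute)
  also have "\<dots> = (\<integral>\<^sup>+x. f (fst x, cnj (snd x)) \<partial>lborel)"
    by (rule nn_integral_lborel_SL2C[OF k]) (rule measurable_compose[OF m2], measurable)
  finally show ?thesis by (simp add: nn_integral_lborel_cnj_snd)
qed

text \<open>Ratio between an integral over a shell and the integral against the probability measure
  on the sphere. The proofs cancel it, which takes that it is neither zero nor infinite.\<close>

definition shell_mass :: ennreal where
  "shell_mass = (\<integral>\<^sup>+x\<in>shell norm. ennreal (1 / norm x ^ 4) \<partial>lborel)"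

lemma shell_mass_less_top: "shell_mass < \<infinity>"
proof -
  have "shell_mass \<le> (\<integral>\<^sup>+x. indicator (ball 0 2) x \<partial>(lborel :: (complex \<times> complex) measure))"
    unfolding shell_mass_def
    by (intro nn_integral_mono) (auto simp: shell_def indicator_def divide_le_eq)
  also have "\<dots> < \<infinity>" using emeasure_lborel_ball_finite[of "0 :: complex \<times> complex" 2] by simp
  finally show ?thesis .
qed

lemma shell_mass_nonzero: "shell_mass \<noteq> 0"
proof -
  have "norm x \<in> {1..<2}" if "x \<in> ball (3/2, 0) (1/4)" for x :: "complex \<times> complex"
  proof -
    have "norm (x - (3/2, 0)) < 1/4" using that by (simp add: dist_norm norm_minus_commute)
    moreover have "norm (3/2 :: complex, 0 :: complex) = 3/2" by (simp add: norm_prod_def)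
    ultimately show ?thesis
      using norm_triangle_ineq2[of x "(3/2, 0)"] norm_triangle_ineq2[of "(3/2, 0)" x] 
      by (simp add: norm_minus_commute[of x])
  qed
  then have sub: "(\<integral>\<^sup>+x. ennreal (1/16) * indicator (ball (3/2, 0) (1/4)) x \<partial>(lborel :: (complex \<times> complex) measure)) \<le> shell_mass"
    unfolding shell_mass_def
  proof (intro nn_integral_mono)
    fix x :: "complex \<times> complex"
    have "1/16 \<le> 1 / norm x ^ 4" if "x \<in> shell norm"
      using power_mono[of "norm x" 2 4] that by (auto simp: shell_def divide_simps)
    moreover have "x \<in> shell norm" if "x \<in> ball (3/2, 0) (1/4)"
      using \<open>\<And>x. x \<in> ball (3/2, 0) (1/4) \<Longrightarrow> norm x \<in> {1..<2}\<close>[OF that] by (simp add: shell_def)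
    ultimately show "ennreal (1/16) * indicator (ball (3/2, 0) (1/4)) x \<le> ennreal (1 / norm x ^ 4) * indicator (shell norm) x"
      by (auto simp: indicator_def intro!: ennreal_leI)
  qed
  have "emeasure lborel (ball (3/2, 0) (1/4) :: (complex \<times> complex) set) \<noteq> 0"
    using content_ball_pos[of "1/4" "(3/2, 0) :: complex \<times> complex"] by (auto simp: measure_def)
  moreover have "(\<integral>\<^sup>+x. ennreal (1/16) * indicator (ball (3/2, 0) (1/4)) x \<partial>(lborel :: (complex \<times> complex) measure)) =
      ennreal (1/16) * emeasure lborel (ball (3/2, 0) (1/4) :: (complex \<times> complex) set)"
    by (rule nn_integral_cmult_indicator) simp
  ultimately show ?thesis using sub by auto
qed

text \<open>What the estimates take from Haar measure: an invariant probability measure carried by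
  the unit sphere. Keeping \<open>\<sigma>\<close> on all Borel sets of the plane spares restricting
  every function to the sphere; the price is statements almost everywhere.\<close>

locale sphere_measure = prob_space \<sigma> for \<sigma> :: "(complex \<times> complex) measure" +
  assumes sets_sigma [measurable_cong]: "sets \<sigma> = sets borel"
    and sphere: "AE x in \<sigma>. norm x = 1"
    and distr_SU2: "k \<in> SU2 \<Longrightarrow> distr \<sigma> borel (act k) = \<sigma>"
begin

lemma nn_integral_SU2:
  assumes "k \<in> SU2" and [measurable]: "f \<in> borel_measurable borel"
  shows "(\<integral>\<^sup>+x. f (act k x) \<partial>\<sigma>) = (\<integral>\<^sup>+x. f x \<partial>\<sigma>)"
proof -
  have "(\<integral>\<^sup>+x. f (act k x) \<partial>\<sigma>) = (\<integral>\<^sup>+x. f x \<partial>distr \<sigma> borel (act k))"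
    by (simp add: nn_integral_distr)
  then show ?thesis by (simp add: distr_SU2[OF assms(1)])
qed

text \<open>Uniqueness of the invariant measure: integrate \<open>f (k\<^sub>x y)\<close> over \<open>x\<close> and \<open>y\<close> in both orders.\<close>

lemma nn_integral_polar:
  assumes [measurable]: "f \<in> borel_measurable borel"
  shows "shell_mass * (\<integral>\<^sup>+y. f y \<partial>\<sigma>) = (\<integral>\<^sup>+x\<in>shell norm. ennreal (1 / norm x ^ 4) * f (x /\<^sub>R norm x) \<partial>lborel)"
proof -
  interpret pair_sigma_finite "lborel :: (complex \<times> complex) measure" \<sigma> ..
  define w :: "complex \<times> complex \<Rightarrow> ennreal" where "w x = ennreal (1 / norm x ^ 4) * indicator (shell norm) x" for x
  have [measurable]: "shell norm \<in> sets borel" unfolding shell_def by measurable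
  have [measurable]: "w \<in> borel_measurable borel" unfolding w_def by measurable
  have [measurable]: "(\<lambda>p. right_rot (fst p) (snd p)) \<in> borel_measurable (borel \<Otimes>\<^sub>M borel)"
    unfolding right_rot_def by (intro borel_measurable_Pair) measurable
  have "shell_mass * (\<integral>\<^sup>+y. f y \<partial>\<sigma>) = (\<integral>\<^sup>+x. w x * (\<integral>\<^sup>+y. f y \<partial>\<sigma>) \<partial>lborel)"
    by (simp add: nn_integral_multc shell_mass_def w_def)
  also have "\<dots> = (\<integral>\<^sup>+x. (\<integral>\<^sup>+y. w x * f (right_rot x y /\<^sub>R norm x) \<partial>\<sigma>) \<partial>lborel)"
  proof (intro nn_integral_cong)
    fix x :: "complex \<times> complex"
    show "w x * (\<integral>\<^sup>+y. f y \<partial>\<sigma>) = (\<integral>\<^sup>+y. w x * f (right_rot x y /\<^sub>R norm x) \<partial>\<sigma>)"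
    proof (cases "x = 0")
      case False
      then obtain k where k: "k \<in> SU2" "\<And>y. right_rot x y /\<^sub>R norm x = act k y" using right_rot_act by blast
      show ?thesis unfolding k(2) by (simp add: nn_integral_cmult nn_integral_SU2[OF k(1)])
    qed (simp add: w_def shell_def)
  qed
  also have "\<dots> = (\<integral>\<^sup>+y. (\<integral>\<^sup>+x. w x * f (right_rot x y /\<^sub>R norm x) \<partial>lborel) \<partial>\<sigma>)"
    by (rule Fubini'[symmetric]) measurable
  also have "\<dots> = (\<integral>\<^sup>+y. (\<integral>\<^sup>+x. w x * f (x /\<^sub>R norm x) \<partial>lborel) \<partial>\<sigma>)"
  proof (rule nn_integral_cong_AE, use sphere in eventually_elim)
    fix y :: "complex \<times> complex" assume y: "norm y = 1"
    have "w x = w (right_rot x y)" for x by (simp add: w_def shell_def indicator_def norm_right_rot y)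
    then have "(\<integral>\<^sup>+x. w x * f (right_rot x y /\<^sub>R norm x) \<partial>lborel) = 
      (\<integral>\<^sup>+x. w (right_rot x y) * f (right_rot x y /\<^sub>R norm (right_rot x y)) \<partial>lborel)"
      by (simp add: norm_right_rot y)
    also have "\<dots> = (\<integral>\<^sup>+x. w x * f (x /\<^sub>R norm x) \<partial>lborel)"
      by (rule nn_integral_lborel_right_rot[OF y]) measurable
    finally show "(\<integral>\<^sup>+x. w x * f (right_rot x y /\<^sub>R norm x) \<partial>lborel) = (\<integral>\<^sup>+x. w x * f (x /\<^sub>R norm x) \<partial>lborel)" .
  qed
  also have "\<dots> = (\<integral>\<^sup>+x. w x * f (x /\<^sub>R norm x) \<partial>lborel)"
    by (simp add: emeasure_space_1)
  finally show ?thesis by (simp add: w_def mult_ac)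
qed

end

lemma AE_lborel_snd_nonzero: "AE x in lborel. snd (x :: complex \<times> complex) \<noteq> 0"
proof (rule AE_I')
  have ind: "indicator {x. snd x = 0} (u, v) = (indicator {0} v :: ennreal)" for u v :: complex
    by (simp add: indicator_def)
  have "(\<integral>\<^sup>+x. indicator {x. snd x = 0} x \<partial>(lborel :: (complex \<times> complex) measure)) = 
    (\<integral>\<^sup>+u. \<integral>\<^sup>+v. indicator {0::complex} v \<partial>lborel \<partial>(lborel :: complex measure))"
    by (subst nn_integral_lborel_pair(1), measurable) (simp only: ind)
  also have "\<dots> = 0" by simp
  finally have e: "(\<integral>\<^sup>+x. indicator {x. snd x = 0} x \<partial>(lborel :: (complex \<times> complex) measure)) = 0" .
  have m: "{x :: complex \<times> complex. snd x = 0} \<in> sets borel" by measurable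
  then show "{x. snd x = 0} \<in> null_sets (lborel :: (complex \<times> complex) measure)"
    using e by (simp add: null_sets_def)
qed auto

lemma act_scaleR: "act g (t *\<^sub>R x) = t *\<^sub>R act g x"
  by (simp add: act_def prod_eq_iff algebra_simps)

lemma act_eq_0_iff:
  assumes "g \<in> SL2C"
  shows "act g x = 0 \<longleftrightarrow> x = 0"
proof
  define h where "h = mat2 (g$2$2) (- g$1$2) (- g$2$1) (g$1$1)"
  have "h ** g = mat 1"
    using assms unfolding h_def by (subst (5) mat2_eta[of g]) (simp add: mat2_mult vec_eq_iff forall_2 mat_def SL2C_def det_2 algebra_simps)
  then have "act h (act g x) = x"
    by (simp flip: act_mult) (simp add: act_def mat_def)
  moreover assume "act g x = 0"
  ultimately show "x = 0" by (auto simp: act_def zero_prod_def)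
qed (simp add: act_def zero_prod_def)

text \<open>A linear substitution turns the shell of \<open>norm\<close> into the shell of this
  function, so the substituted integral can be brought back to the sphere.\<close>

lemma radius_fun_norm_act: "g \<in> SL2C \<Longrightarrow> radius_fun (\<lambda>x. norm (act g x))"
proof -
  assume g: "g \<in> SL2C"
  have "AE x in lborel. norm (act g x) > 0"
    using AE_lborel_snd_nonzero by eventually_elim (auto simp: act_eq_0_iff[OF g])
  then show ?thesis
    unfolding radius_fun_def by (auto simp: act_scaleR simp del: scaleR_Pair)
qed

lemma mat_1_SL2C: "mat 1 \<in> SL2C"
  using mat_1_in_diag_mono(1) by (simp add: diag_SL2C_def)

lemma act_mat_1 [simp]: "act (mat 1) x = x"
  by (simp add: act_def mat_def)

lemma radius_fun_norm: "radius_fun norm"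
  using radius_fun_norm_act[OF mat_1_SL2C] by simp

lemma radius_fun_snd: "radius_fun (\<lambda>x. cmod (snd x))"
  using AE_lborel_snd_nonzero unfolding radius_fun_def by auto

context sphere_measure begin

text \<open>Polar coordinates with a free choice of the shell: the region of integration can be
  adapted to the integrand.\<close>

lemma nn_integral_homogeneous:
  assumes F: "homogeneous F" and r: "radius_fun \<rho>"
  shows "shell_mass * (\<integral>\<^sup>+y. F y \<partial>\<sigma>) = (\<integral>\<^sup>+x\<in>shell \<rho>. F x \<partial>lborel)"
proof -
  have "shell_mass * (\<integral>\<^sup>+y. F y \<partial>\<sigma>) = (\<integral>\<^sup>+x\<in>shell norm. ennreal (1 / norm x ^ 4) * F (x /\<^sub>R norm x) \<partial>lborel)"
    by (rule nn_integral_polar[OF homogeneous_measurable[OF F]])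
  also have "\<dots> = (\<integral>\<^sup>+x\<in>shell norm. F x \<partial>lborel)"
  proof (intro nn_integral_cong)
    fix x :: "complex \<times> complex"
    have "ennreal (1 / norm x ^ 4) * F (x /\<^sub>R norm x) = F x" if "x \<in> shell norm"
    proof -
      have "inverse (norm x) > 0" using that by (auto simp: shell_def)
      then have "ennreal (inverse (norm x) ^ 4) * F (inverse (norm x) *\<^sub>R x) = F x"
        using F unfolding homogeneous_def by blast
      then show ?thesis by (simp add: divide_inverse power_inverse)
    qed
    then show "ennreal (1 / norm x ^ 4) * F (x /\<^sub>R norm x) * indicator (shell norm) x = F x * indicator (shell norm) x"
      by (auto simp: indicator_def)
  qed
  also have "\<dots> = (\<integral>\<^sup>+x\<in>shell \<rho>. F x \<partial>lborel)"
    by (rule shell_integral_indep[OF F radius_fun_norm r])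
  finally show ?thesis .
qed

text \<open>Complex conjugation is not in \<open>SU2\<close>, so the defining invariance of
  \<open>\<sigma>\<close> does not cover it. It is inherited from Lebesgue measure through the polar
  formula, hence ultimately from uniqueness.\<close>

lemma nn_integral_cnj:
  assumes [measurable]: "f \<in> borel_measurable borel"
  shows "(\<integral>\<^sup>+x. f (cnj (fst x), cnj (snd x)) \<partial>\<sigma>) = (\<integral>\<^sup>+x. f x \<partial>\<sigma>)"
proof -
  have [measurable]: "shell norm \<in> sets borel" unfolding shell_def by measurable
  define G where "G x = ennreal (1 / norm x ^ 4) * f (x /\<^sub>R norm x) * indicator (shell norm) x" for x
  have [measurable]: "G \<in> borel_measurable borel" unfolding G_def by measurable
  have m: "(\<lambda>x. (cnj (fst x), snd x)) \<in> borel_measurable (borel :: (complex \<times> complex) measure)"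
    by (intro borel_measurable_Pair) measurable
  have m2: "(\<lambda>x. f (cnj (fst x), cnj (snd x))) \<in> borel_measurable borel"
    by (rule measurable_compose[OF borel_measurable_Pair assms]) measurable
  have n: "norm (cnj (fst x), cnj (snd x)) = norm x" for x by (simp add: norm_prod_def)
  have "shell_mass * (\<integral>\<^sup>+x. f (cnj (fst x), cnj (snd x)) \<partial>\<sigma>) = (\<integral>\<^sup>+x. G (cnj (fst x), cnj (snd x)) \<partial>lborel)"
    by (subst nn_integral_polar[OF m2]) (simp add: G_def n shell_def indicator_def)
  also have "\<dots> = (\<integral>\<^sup>+x. (\<lambda>y. G (cnj (fst y), snd y)) (fst x, cnj (snd x)) \<partial>lborel)" by simp
  also have "\<dots> = (\<integral>\<^sup>+y. G (cnj (fst y), snd y) \<partial>lborel)"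
    by (rule nn_integral_lborel_cnj_snd) (rule measurable_compose[OF m], measurable)
  also have "\<dots> = (\<integral>\<^sup>+y. G y \<partial>lborel)"
    by (rule nn_integral_lborel_cnj_fst) measurable
  also have "\<dots> = shell_mass * (\<integral>\<^sup>+x. f x \<partial>\<sigma>)"
    by (simp add: nn_integral_polar G_def)
  finally show ?thesis
    using shell_mass_nonzero shell_mass_less_top by (auto simp: ennreal_mult_cancel_left)
qed

lemma distr_cnj: "distr \<sigma> borel (\<lambda>x. (cnj (fst x), cnj (snd x))) = \<sigma>"
proof (rule measure_eqI)
  fix A assume "A \<in> sets (distr \<sigma> borel (\<lambda>x. (cnj (fst x), cnj (snd x))))"
  then have A [measurable]: "A \<in> sets borel" by simp
  have m: "(\<lambda>x. (cnj (fst x), cnj (snd x))) \<in> borel_measurable \<sigma>"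
    by (intro borel_measurable_Pair) measurable
  have "emeasure (distr \<sigma> borel (\<lambda>x. (cnj (fst x), cnj (snd x)))) A = (\<integral>\<^sup>+x. indicator A x \<partial>distr \<sigma> borel (\<lambda>x. (cnj (fst x), cnj (snd x))))"
    by simp
  also have "\<dots> = (\<integral>\<^sup>+x. indicator A (cnj (fst x), cnj (snd x)) \<partial>\<sigma>)"
    by (rule nn_integral_distr[OF m]) simp
  also have "\<dots> = (\<integral>\<^sup>+x. indicator A x \<partial>\<sigma>)"
    by (rule nn_integral_cnj) measurable
  finally show "emeasure (distr \<sigma> borel (\<lambda>x. (cnj (fst x), cnj (snd x)))) A = emeasure \<sigma> A"
    by (simp add: sets_sigma)
qed (simp add: sets_sigma)

end

section \<open>The law of the first column under Haar measure\<close>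

definition first_column :: "complex^2^2 \<Rightarrow> complex \<times> complex" where
  "first_column k = (k$1$1, k$2$1)"

lemma first_column_mult: "first_column (h ** k) = act h (first_column k)"
  by (simp add: first_column_def act_def matrix_matrix_mult_def sum_2)

lemma first_column_measurable:
  assumes "haar_prob_SU2 \<mu>"
  shows "first_column \<in> borel_measurable \<mu>"
proof -
  have "first_column \<in> borel_measurable borel"
    unfolding first_column_def by (intro borel_measurable_continuous_onI continuous_intros)
  then have "first_column \<in> borel_measurable (restrict_space borel SU2)"
    by (rule measurable_restrict_space1)
  then show ?thesis using assms by (simp add: haar_prob_SU2_def cong: measurable_cong_sets)
qed

lemma space_haar: "haar_prob_SU2 \<mu> \<Longrightarrow> space \<mu> = SU2"
  using sets_eq_imp_space_eq[of \<mu> "restrict_space borel SU2"] by (simp add: haar_prob_SU2_def space_restrict_space)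

lemma sphere_measure_haar:
  assumes haar: "haar_prob_SU2 \<mu>"
  shows "sphere_measure (distr \<mu> borel first_column)"
proof -
  interpret prob_space \<mu> using haar by (simp add: haar_prob_SU2_def)
  note m [measurable] = first_column_measurable[OF haar]
  show ?thesis
  proof (intro sphere_measure.intro sphere_measure_axioms.intro prob_space_distr[OF m])
    have "AE k in \<mu>. norm (first_column k) = 1"
    proof (rule AE_I2)
      fix k assume "k \<in> space \<mu>"
      then obtain a b where "k = mat2 a b (- cnj b) (cnj a)" "(cmod a)\<^sup>2 + (cmod b)\<^sup>2 = 1"
        by (auto simp: space_haar[OF haar] SU2_iff)
      then show "norm (first_column k) = 1"
        by (simp add: first_column_def norm_prod_def)
    qed
    then show "AE x in distr \<mu> borel first_column. norm x = 1"
      by (subst AE_distr_iff) auto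
    fix h assume h: "h \<in> SU2"
    have mh: "(\<lambda>k. h ** k) \<in> measurable \<mu> \<mu>"
    proof -
      have "(\<lambda>k. h ** k) \<in> borel_measurable borel"
        by (intro borel_measurable_continuous_onI)
           (auto simp: matrix_matrix_mult_def intro!: continuous_intros)
      then have "(\<lambda>k. h ** k) \<in> measurable (restrict_space borel SU2) (restrict_space borel SU2)"
        by (intro measurable_restrict_space3) (use SU2_mult h in auto)
      then show ?thesis using haar by (simp add: haar_prob_SU2_def cong: measurable_cong_sets)
    qed
    have "distr (distr \<mu> borel first_column) borel (act h) = distr \<mu> borel (act h \<circ> first_column)"
      by (rule distr_distr) auto
    also have "act h \<circ> first_column = first_column \<circ> (\<lambda>k. h ** k)"
      by (simp add: fun_eq_iff first_column_mult)
    also have "distr \<mu> borel (first_column \<circ> (\<lambda>k. h ** k)) = distr (distr \<mu> \<mu> (\<lambda>k. h ** k)) borel first_column"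
      by (rule distr_distr[symmetric]) (use mh in auto)
    also have "distr \<mu> \<mu> (\<lambda>k. h ** k) = \<mu>" using haar h by (simp add: haar_prob_SU2_def)
    finally show "distr (distr \<mu> borel first_column) borel (act h) = distr \<mu> borel first_column" .
  qed simp
qed

section \<open>Size estimates on the sphere\<close>

lemma norm_mat_sq: "(norm g)\<^sup>2 = (cmod (g$1$1))\<^sup>2 + (cmod (g$1$2))\<^sup>2 + (cmod (g$2$1))\<^sup>2 + (cmod (g$2$2))\<^sup>2"
  for g :: "complex^2^2"
  by (simp add: norm_vec_def L2_set_def sum_2)

lemma norm_fst_snd_le: "cmod (fst x) \<le> norm x" "cmod (snd x) \<le> norm x"
  using norm_fst_le[of "fst x" "snd x"] norm_snd_le[of "snd x" "fst x"] by simp_all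

lemma row_Cauchy_Schwarz:
  "(cmod (a * fst x + b * snd x))\<^sup>2 \<le> ((cmod a)\<^sup>2 + (cmod b)\<^sup>2) * (norm x)\<^sup>2"
proof -
  have "(cmod (a * fst x + b * snd x))\<^sup>2 \<le> (cmod a * cmod (fst x) + cmod b * cmod (snd x))\<^sup>2"
    by (intro power_mono) (metis norm_triangle_ineq norm_mult, simp)
  also have "\<dots> \<le> ((cmod a)\<^sup>2 + (cmod b)\<^sup>2) * ((cmod (fst x))\<^sup>2 + (cmod (snd x))\<^sup>2)"
    using sum_squares_ge_zero[of "cmod a * cmod (snd x) - cmod b * cmod (fst x)" 0]
    by (simp add: power2_eq_square algebra_simps)
  finally show ?thesis by (simp only: norm_pair_sq)
qed

lemma norm_act_le: "norm (act g x) \<le> norm g * norm x"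
proof -
  have "(norm (act g x))\<^sup>2 = (cmod (g$1$1 * fst x + g$1$2 * snd x))\<^sup>2 + (cmod (g$2$1 * fst x + g$2$2 * snd x))\<^sup>2"
    unfolding norm_pair_sq by (simp add: act_def)
  also have "\<dots> \<le> (norm g * norm x)\<^sup>2"
    using row_Cauchy_Schwarz[of "g$1$1" x "g$1$2"] row_Cauchy_Schwarz[of "g$2$1" x "g$2$2"]
    by (simp only: norm_mat_sq[of g] power_mult_distrib distrib_right)
  finally have "(norm (act g x))\<^sup>2 \<le> (norm g * norm x)\<^sup>2" .
  then show ?thesis by (rule power2_le_imp_le) simp
qed

text \<open>The adjugate, hence the inverse on \<open>SL2C\<close>, with explicit entries and the
  same norm.\<close>

definition adj2 :: "complex^2^2 \<Rightarrow> complex^2^2" where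
  "adj2 g = mat2 (g$2$2) (- g$1$2) (- g$2$1) (g$1$1)"

lemma norm_adj2 [simp]: "norm (adj2 g) = norm g"
proof -
  have "(norm (adj2 g))\<^sup>2 = (norm g)\<^sup>2" by (simp add: norm_mat_sq adj2_def)
  then show ?thesis by simp
qed

lemma adj2_SL2C: "g \<in> SL2C \<Longrightarrow> adj2 g \<in> SL2C"
  by (simp add: adj2_def SL2C_def det_2 algebra_simps)

lemma act_adj2: 
  assumes "g \<in> SL2C" 
  shows "act (adj2 g) (act g x) = x" "act g (act (adj2 g) x) = x"
proof -
  have det: "g$1$1 * g$2$2 - g$1$2 * g$2$1 = 1" using assms by (simp add: SL2C_def det_2)
  have 1: "d * (a * u + b * v) - b * (c * u + d * v) = (a * d - b * c) * u"
    "a * (c * u + d * v) - c * (a * u + b * v) = (a * d - b * c) * v"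
    "a * (d * u - b * v) + b * (a * v - c * u) = (a * d - b * c) * u"
    "c * (d * u - b * v) + d * (a * v - c * u) = (a * d - b * c) * v" for a b c d u v :: complex
    by (simp_all add: algebra_simps)
  show "act (adj2 g) (act g x) = x" "act g (act (adj2 g) x) = x"
    using 1[of "g$2$2" "g$1$1" _ "g$1$2" _ "g$2$1"] det
    by (simp_all add: act_def adj2_def prod_eq_iff 1)
qed

lemma norm_act_ge: "g \<in> SL2C \<Longrightarrow> norm x \<le> norm g * norm (act g x)"
  using norm_act_le[of "adj2 g" "act g x"] by (simp add: act_adj2)

lemma norm_SL2C_ge:
  assumes "g \<in> SL2C"
  shows "(norm g)\<^sup>2 \<ge> 2" "norm g \<ge> 1"
proof -
  have "1 = cmod (g$1$1 * g$2$2 - g$1$2 * g$2$1)" using assms by (simp add: SL2C_def det_2)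
  also have "\<dots> \<le> cmod (g$1$1) * cmod (g$2$2) + cmod (g$1$2) * cmod (g$2$1)"
    using norm_triangle_ineq4[of "g$1$1 * g$2$2" "g$1$2 * g$2$1"] by (simp add: norm_mult)
  finally have "2 \<le> 2 * (cmod (g$1$1) * cmod (g$2$2) + cmod (g$1$2) * cmod (g$2$1))" by simp
  also have "\<dots> \<le> (norm g)\<^sup>2"
    using sum_squares_ge_zero[of "cmod (g$1$1) - cmod (g$2$2)" "cmod (g$1$2) - cmod (g$2$1)"]
    unfolding norm_mat_sq by (simp add: power2_eq_square algebra_simps)
  finally show "(norm g)\<^sup>2 \<ge> 2" by simp
  then have "1\<^sup>2 \<le> (norm g)\<^sup>2" by simp
  then show "norm g \<ge> 1" by (rule power2_le_imp_le) simp
qed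

lemma dyadic_bracket:
  fixes t :: real
  assumes "0 < t" "t \<le> 1"
  obtains k :: nat where "2 powr (- real k - 1) < t" "t \<le> 2 powr (- real k)"
proof -
  define k where "k = nat \<lfloor>- log 2 t\<rfloor>"
  have "log 2 t \<le> 0" using assms by simp
  then have "real k \<le> - log 2 t" "- log 2 t < real k + 1"
    unfolding k_def by linarith+
  then have "2 powr (- real k - 1) < 2 powr (log 2 t)" "2 powr (log 2 t) \<le> 2 powr (- real k)"
    by simp_all
  then show ?thesis using that assms by simp
qed

lemma nonneg_le_suminf: "f k \<le> (\<Sum>i. f i)" for f :: "nat \<Rightarrow> ennreal"
  using sum_le_suminf[of f "{k}"] by simp

section \<open>Caps, moments and the Harish-Chandra function\<close>

context sphere_measure begin

text \<open>In the projective line these points form a disc of radius about \<open>r\<close>. The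
  indicator of the cone over it, weighted by \<open>1 / norm x ^ 4\<close>, is homogeneous and may
  be integrated over the shell of \<open>cmod (snd x)\<close>; for \<open>r \<le> 1/2\<close> the
  part of the cone in that shell lies in a product of two discs.\<close>

lemma cap_measure_fst:
  "\<exists>K>0. \<forall>r\<ge>0. emeasure \<sigma> {x. cmod (fst x) \<le> r} \<le> ennreal (K * r\<^sup>2)"
proof -
  define m where "m = enn2real shell_mass"
  have m: "shell_mass = ennreal m" "m > 0"
    using shell_mass_nonzero shell_mass_less_top 
    by (auto simp: m_def enn2real_positive_iff zero_less_iff_neq_zero)
  define \<omega> where "\<omega> = unit_ball_vol 2"
  \<comment> \<open>The 4 makes the bound trivial for \<open>r > 1/2\<close>;
    \<open>64 * \<omega>\<^sup>2 * r\<^sup>2\<close> is the product of the areas of discs of radii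
    \<open>4 * r\<close> and 2.\<close>
  define K where "K = max 4 (64 * \<omega>\<^sup>2 / m)"
  have "emeasure \<sigma> {x. cmod (fst x) \<le> r} \<le> ennreal (K * r\<^sup>2)" if r: "r \<ge> 0" for r
  proof (cases "r \<le> 1/2")
    case False
    then have "(1/2)\<^sup>2 \<le> r\<^sup>2" by (intro power_mono) auto
    then have "1 \<le> 4 * r\<^sup>2" by (simp add: power2_eq_square)
    also have "\<dots> \<le> K * r\<^sup>2" by (intro mult_right_mono) (auto simp: K_def)
    finally show ?thesis using emeasure_le_1 by (metis ennreal_1 ennreal_leI order_trans)
  next
    case True
    define F where "F x = ennreal (1 / norm x ^ 4) * indicator {x. cmod (fst x) \<le> r * norm x} x" for x :: "complex \<times> complex"
    have [measurable]: "F \<in> borel_measurable borel" unfolding F_def by measurable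
    have "ennreal (t ^ 4) * F (t *\<^sub>R x) = F x" if t: "t > 0" for t x
    proof -
      have "cmod (fst (t *\<^sub>R x)) \<le> r * norm (t *\<^sub>R x) \<longleftrightarrow> t * cmod (fst x) \<le> t * (r * norm x)"
        using t by (simp add: ac_simps del: scaleR_Pair)
      also have "\<dots> \<longleftrightarrow> cmod (fst x) \<le> r * norm x" using t by simp
      finally have "indicator {x. cmod (fst x) \<le> r * norm x} (t *\<^sub>R x) = (indicator {x. cmod (fst x) \<le> r * norm x} x :: ennreal)"
        by (simp add: indicator_def)
      moreover have "ennreal (t ^ 4) * ennreal (1 / norm (t *\<^sub>R x) ^ 4) = ennreal (1 / norm x ^ 4)"
        using t by (simp add: power_mult_distrib flip: ennreal_mult)
      ultimately show ?thesis unfolding F_def by (simp flip: mult.assoc)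
    qed
    then have F: "homogeneous F" by (simp add: homogeneous_def)
    have "emeasure \<sigma> {x. cmod (fst x) \<le> r} = (\<integral>\<^sup>+x. indicator {x. cmod (fst x) \<le> r} x \<partial>\<sigma>)"
      by (subst nn_integral_indicator) (auto simp: sets_sigma)
    also have "\<dots> = (\<integral>\<^sup>+x. F x \<partial>\<sigma>)"
      by (rule nn_integral_cong_AE) (use sphere in eventually_elim, auto simp: F_def indicator_def)
    finally have e: "emeasure \<sigma> {x. cmod (fst x) \<le> r} = (\<integral>\<^sup>+x. F x \<partial>\<sigma>)" .
    have "shell_mass * (\<integral>\<^sup>+x. F x \<partial>\<sigma>) = (\<integral>\<^sup>+x\<in>shell (\<lambda>x. cmod (snd x)). F x \<partial>lborel)"
      by (rule nn_integral_homogeneous[OF F radius_fun_snd])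
    also have "\<dots> \<le> (\<integral>\<^sup>+x. indicator (cball 0 (4 * r) \<times> cball 0 2) x \<partial>(lborel :: (complex \<times> complex) measure))"
    proof (rule nn_integral_mono)
      fix x :: "complex \<times> complex"
      have "F x \<le> 1 \<and> x \<in> cball 0 (4 * r) \<times> cball 0 2" if "1 \<le> cmod (snd x)" "cmod (snd x) < 2" "cmod (fst x) \<le> r * norm x"
      proof -
        have n1: "norm x \<ge> 1" using that(1) norm_fst_snd_le(2)[of x] by linarith
        then have "1 / norm x ^ 4 \<le> 1" by (simp add: divide_le_eq)
        then have "F x \<le> 1" by (auto simp: F_def indicator_def)
        have "norm x \<le> cmod (fst x) + cmod (snd x)" 
          using sqrt_sum_squares_le_sum by (simp add: norm_prod_def)
        then have "cmod (fst x) \<le> r * (cmod (fst x) + cmod (snd x))"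
          using that(3) r mult_left_mono by (metis order_trans)
        also have "\<dots> \<le> 1/2 * cmod (fst x) + r * 2"
          unfolding distrib_left using True that r by (intro add_mono mult_mono) auto
        finally have "cmod (fst x) \<le> 4 * r" by simp
        then show ?thesis using \<open>F x \<le> 1\<close> that by (auto simp: mem_Times_iff)
      qed
      then show "F x * indicator (shell (\<lambda>x. cmod (snd x))) x \<le> indicator (cball 0 (4 * r) \<times> cball 0 2) x"
        by (auto simp: indicator_def shell_def F_def)
    qed
    also have "\<dots> = emeasure (lborel \<Otimes>\<^sub>M lborel) (cball (0::complex) (4 * r) \<times> cball (0::complex) 2)"
      by (subst nn_integral_indicator) (simp_all add: lborel_prod borel_Times)
    also have "\<dots> = emeasure lborel (cball (0::complex) (4 * r)) * emeasure lborel (cball (0::complex) 2)"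
      by (rule lborel.emeasure_pair_measure_Times) auto
    also have "\<dots> = ennreal (64 * \<omega>\<^sup>2 * r\<^sup>2)"
      using r by (simp add: emeasure_cball \<omega>_def power2_eq_square flip: ennreal_mult)
    also have "\<dots> = ennreal m * ennreal (64 * \<omega>\<^sup>2 / m * r\<^sup>2)"
      using m(2) by (simp flip: ennreal_mult)
    finally have "ennreal m * (\<integral>\<^sup>+x. F x \<partial>\<sigma>) \<le> ennreal m * ennreal (64 * \<omega>\<^sup>2 / m * r\<^sup>2)"
      unfolding m(1) .
    then have "(\<integral>\<^sup>+x. F x \<partial>\<sigma>) \<le> ennreal (64 * \<omega>\<^sup>2 / m * r\<^sup>2)"
      using m(2) by (subst (asm) ennreal_mult_le_mult_iff) auto
    also have "\<dots> \<le> ennreal (K * r\<^sup>2)"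
      by (intro ennreal_leI mult_right_mono) (auto simp: K_def)
    finally show ?thesis using e by simp
  qed
  then show ?thesis by (intro exI[of _ K]) (auto simp: K_def)
qed

lemma cap_measure:
  obtains K where "K > 0"
    "\<And>p q r. (cmod p)\<^sup>2 + (cmod q)\<^sup>2 = 1 \<Longrightarrow> r \<ge> 0 \<Longrightarrow>
       emeasure \<sigma> {x. cmod (p * fst x + q * snd x) \<le> r} \<le> ennreal (K * r\<^sup>2)"
proof -
  obtain K where K: "K > 0" "\<And>r. r \<ge> 0 \<Longrightarrow> emeasure \<sigma> {x. cmod (fst x) \<le> r} \<le> ennreal (K * r\<^sup>2)"
    using cap_measure_fst by auto
  have "emeasure \<sigma> {x. cmod (p * fst x + q * snd x) \<le> r} = emeasure \<sigma> {x. cmod (fst x) \<le> r}"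
    if "(cmod p)\<^sup>2 + (cmod q)\<^sup>2 = 1" for p q r
  proof -
    define k where "k = mat2 p q (- cnj q) (cnj p)"
    have k: "k \<in> SU2" using that by (simp add: k_def SU2_mat2)
    have "emeasure \<sigma> {x. cmod (fst x) \<le> r} = emeasure (distr \<sigma> borel (act k)) {x. cmod (fst x) \<le> r}"
      by (simp add: distr_SU2[OF k])
    also have "\<dots> = emeasure \<sigma> (act k -` {x. cmod (fst x) \<le> r} \<inter> space \<sigma>)"
      by (rule emeasure_distr) measurable
    also have "act k -` {x. cmod (fst x) \<le> r} \<inter> space \<sigma> = {x. cmod (p * fst x + q * snd x) \<le> r}"
      using sets_eq_imp_space_eq[OF sets_sigma] by (auto simp: k_def act_mat2)
    finally show ?thesis by simp
  qed
  with K show ?thesis by (intro that[of K]) auto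
qed

text \<open>A discrete layer-cake estimate. Each point has to lie in only one suitable cap, and the
  caps may overlap, because the sum over all layers dominates the integrand.\<close>

lemma layered_bound:
  obtains K where "K > 0"
    "\<And>p q f a r. (cmod p)\<^sup>2 + (cmod q)\<^sup>2 = 1 \<Longrightarrow> (\<And>k. a k \<ge> 0) \<Longrightarrow> (\<And>k. r k \<ge> 0) \<Longrightarrow>
       summable (\<lambda>k. a k * (r k)\<^sup>2) \<Longrightarrow>
       (\<And>x. norm x = 1 \<Longrightarrow> \<exists>k::nat. f x \<le> ennreal (a k) \<and> cmod (p * fst x + q * snd x) \<le> r k) \<Longrightarrow>
       (\<integral>\<^sup>+x. f x \<partial>\<sigma>) \<le> ennreal (K * (\<Sum>k. a k * (r k)\<^sup>2))"
proof -
  obtain K where K: "K > 0" "\<And>p q r. (cmod p)\<^sup>2 + (cmod q)\<^sup>2 = 1 \<Longrightarrow> r \<ge> 0 \<Longrightarrow>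
       emeasure \<sigma> {x. cmod (p * fst x + q * snd x) \<le> r} \<le> ennreal (K * r\<^sup>2)"
    by (rule cap_measure) blast
  have "(\<integral>\<^sup>+x. f x \<partial>\<sigma>) \<le> ennreal (K * (\<Sum>k. a k * (r k)\<^sup>2))"
    if pq: "(cmod p)\<^sup>2 + (cmod q)\<^sup>2 = 1" and a: "\<And>k. a k \<ge> 0" and r: "\<And>k. r k \<ge> 0"
      and s: "summable (\<lambda>k. a k * (r k)\<^sup>2)"
      and f: "\<And>x. norm x = 1 \<Longrightarrow> \<exists>k::nat. f x \<le> ennreal (a k) \<and> cmod (p * fst x + q * snd x) \<le> r k"
    for p q f a r
  proof -
    define A where "A k = {x :: complex \<times> complex. cmod (p * fst x + q * snd x) \<le> r k}" for k
    have [measurable]: "A k \<in> sets borel" for k unfolding A_def by measurable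
    have "(\<integral>\<^sup>+x. f x \<partial>\<sigma>) \<le> (\<integral>\<^sup>+x. (\<Sum>k. ennreal (a k) * indicator (A k) x) \<partial>\<sigma>)"
    proof (rule nn_integral_mono_AE, use sphere in eventually_elim)
      fix x :: "complex \<times> complex" assume "norm x = 1"
      then obtain k where k: "f x \<le> ennreal (a k)" "x \<in> A k" using f[of x] unfolding A_def by blast
      then have "f x \<le> ennreal (a k) * indicator (A k) x" by simp
      also have "\<dots> \<le> (\<Sum>k. ennreal (a k) * indicator (A k) x)"
        by (rule nonneg_le_suminf[of "\<lambda>k. ennreal (a k) * indicator (A k) x"])
      finally show "f x \<le> (\<Sum>k. ennreal (a k) * indicator (A k) x)" .
    qed
    also have "\<dots> = (\<Sum>k. (\<integral>\<^sup>+x. ennreal (a k) * indicator (A k) x \<partial>\<sigma>))"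
      by (rule nn_integral_suminf) measurable
    also have "\<dots> = (\<Sum>k. ennreal (a k) * emeasure \<sigma> (A k))"
      by (subst nn_integral_cmult_indicator) (auto simp: sets_sigma)
    also have "\<dots> \<le> (\<Sum>k. ennreal (K * (a k * (r k)\<^sup>2)))"
    proof (intro suminf_le summableI)
      fix k
      have "ennreal (a k) * emeasure \<sigma> (A k) \<le> ennreal (a k) * ennreal (K * (r k)\<^sup>2)"
        unfolding A_def by (intro mult_left_mono K(2)[OF pq] r) simp
      also have "\<dots> = ennreal (K * (a k * (r k)\<^sup>2))"
        using a K(1) by (simp add: mult_ac flip: ennreal_mult)
      finally show "ennreal (a k) * emeasure \<sigma> (A k) \<le> ennreal (K * (a k * (r k)\<^sup>2))" .
    qed
    also have "\<dots> = ennreal (\<Sum>k. K * (a k * (r k)\<^sup>2))"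
      using a K(1) s by (intro suminf_ennreal2 summable_mult) auto
    also have "\<dots> = ennreal (K * (\<Sum>k. a k * (r k)\<^sup>2))"
      using s by (simp add: suminf_mult)
    finally show ?thesis .
  qed
  with K(1) show ?thesis by (rule that)
qed

text \<open>On the sphere the integrand is at most \<open>exp (- l * |x2|^2)\<close> with
  \<open>x2 = snd x\<close>, so it lives on a cap of measure about \<open>1 / l\<close>. The layers
  are indexed by the integer part of \<open>l * |x2|^2\<close>.\<close>

lemma moment_bound:
  obtains C where "C > 0"
    "\<And>l::nat. l \<ge> 1 \<Longrightarrow> (\<integral>\<^sup>+x. ennreal (cmod (fst x) ^ (2 * l)) \<partial>\<sigma>) \<le> ennreal (C / l)"
proof -
  obtain K where K: "K > 0" and layer: 
    "\<And>p q f a r. (cmod p)\<^sup>2 + (cmod q)\<^sup>2 = 1 \<Longrightarrow> (\<And>k. a k \<ge> 0) \<Longrightarrow> (\<And>k. r k \<ge> 0) \<Longrightarrow>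
       summable (\<lambda>k. a k * (r k)\<^sup>2) \<Longrightarrow>
       (\<And>x. norm x = 1 \<Longrightarrow> \<exists>k::nat. f x \<le> ennreal (a k) \<and> cmod (p * fst x + q * snd x) \<le> r k) \<Longrightarrow>
       (\<integral>\<^sup>+x. f x \<partial>\<sigma>) \<le> ennreal (K * (\<Sum>k. a k * (r k)\<^sup>2))"
    by (rule layered_bound) blast
  define S where "S = (\<Sum>k::nat. exp (- 1) ^ k * (real k + 1))"
  \<comment> \<open>With \<open>k + 1 \<le> 2 ^ k\<close> this compares the series of
    \<open>(k + 1) * exp (- k)\<close> with a geometric one.\<close>
  have e: "2 * exp (- 1 :: real) < 1"
  proof -
    have "2 < (1 + 1/2 :: real)\<^sup>2" by (simp add: power2_eq_square)
    also have "\<dots> \<le> (exp (1/2))\<^sup>2" by (intro power_mono exp_ge_add_one_self) simp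
    also have "\<dots> = exp 1" by (simp flip: exp_of_nat_mult)
    finally show ?thesis by (simp add: exp_minus field_simps)
  qed
  have sum: "summable (\<lambda>k::nat. exp (- 1 :: real) ^ k * (real k + 1))"
  proof (rule summable_comparison_test')
    show "summable (\<lambda>k. (2 * exp (- 1 :: real)) ^ k)" using e by (intro summable_geometric) simp
    fix k :: nat assume "k \<ge> 0"
    have "real k + 1 \<le> 2 ^ k" by (induction k) auto
    then show "norm (exp (- 1 :: real) ^ k * (real k + 1)) \<le> (2 * exp (- 1)) ^ k"
      by (simp add: power_mult_distrib mult.commute)
  qed
  have S: "S > 0" unfolding S_def by (rule suminf_pos[OF sum]) simp
  have "(\<integral>\<^sup>+x. ennreal (cmod (fst x) ^ (2 * l)) \<partial>\<sigma>) \<le> ennreal (K * S / l)" if l: "l \<ge> 1" for l :: nat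
  proof -
    define a where "a k = exp (- 1 :: real) ^ k" for k :: nat
    define r where "r k = sqrt ((real k + 1) / l)" for k :: nat
    have ar: "a k * (r k)\<^sup>2 = exp (- 1) ^ k * (real k + 1) / l" for k
      using l by (simp add: a_def r_def)
    have "(\<integral>\<^sup>+x. ennreal (cmod (fst x) ^ (2 * l)) \<partial>\<sigma>) \<le> ennreal (K * (\<Sum>k. a k * (r k)\<^sup>2))"
    proof (rule layer[of 0 1])
      show "summable (\<lambda>k. a k * (r k)\<^sup>2)" unfolding ar by (intro summable_divide sum)
      fix x :: "complex \<times> complex" assume x: "norm x = 1"
      define k where "k = nat \<lfloor>l * (cmod (snd x))\<^sup>2\<rfloor>"
      have k: "real k \<le> l * (cmod (snd x))\<^sup>2" "l * (cmod (snd x))\<^sup>2 \<le> real k + 1"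
        unfolding k_def by (simp_all add: of_nat_nat)
      have "1 - (cmod (snd x))\<^sup>2 = (cmod (fst x))\<^sup>2"
        using norm_pair_sq[of x] x by simp
      then have "cmod (fst x) ^ (2 * l) = (1 - (cmod (snd x))\<^sup>2) ^ l"
        by (simp only: power_mult)
      also have "\<dots> \<le> exp (- (cmod (snd x))\<^sup>2) ^ l"
        using norm_fst_snd_le(2)[of x] exp_ge_add_one_self[of "- (cmod (snd x))\<^sup>2"] 
        by (intro power_mono) (auto simp: x power_le_one)
      also have "\<dots> = exp (- (l * (cmod (snd x))\<^sup>2))" by (simp flip: exp_of_nat_mult)
      also have "\<dots> \<le> exp (- real k)" using k by simp
      also have "\<dots> = a k" by (simp add: a_def flip: exp_of_nat_mult)
      finally have "cmod (fst x) ^ (2 * l) \<le> a k" .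
      moreover have "(cmod (snd x))\<^sup>2 \<le> (real k + 1) / l" using k l by (simp add: field_simps)
      then have "cmod (snd x) \<le> r k" unfolding r_def by (rule real_le_rsqrt)
      ultimately show "\<exists>k. ennreal (cmod (fst x) ^ (2 * l)) \<le> ennreal (a k) \<and> cmod (0 * fst x + 1 * snd x) \<le> r k"
        by (intro exI[of _ k]) (auto intro: ennreal_leI)
    qed (auto simp: a_def r_def)
    also have "(\<Sum>k. a k * (r k)\<^sup>2) = S / l"
      unfolding ar S_def by (rule suminf_divide[OF sum])
    finally show ?thesis by simp
  qed
  with K S show ?thesis by (intro that[of "K * S"]) auto
qed

text \<open>The integral is the Harish-Chandra \<open>\<Xi>\<close>-function.\<close>

lemma Xi_bound:
  assumes \<eta>: "0 < \<eta>" "\<eta> \<le> 1"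
  obtains C where "C > 0"
    "\<And>g. g \<in> SL2C \<Longrightarrow> (\<integral>\<^sup>+x. ennreal (1 / (norm (act g x))\<^sup>2) \<partial>\<sigma>) \<le> ennreal (C * norm g powr (- 2 + \<eta>))"
proof -
  obtain K where K: "K > 0" and layer: 
    "\<And>p q f a r. (cmod p)\<^sup>2 + (cmod q)\<^sup>2 = 1 \<Longrightarrow> (\<And>k. a k \<ge> 0) \<Longrightarrow> (\<And>k. r k \<ge> 0) \<Longrightarrow>
       summable (\<lambda>k. a k * (r k)\<^sup>2) \<Longrightarrow>
       (\<And>x. norm x = 1 \<Longrightarrow> \<exists>k::nat. f x \<le> ennreal (a k) \<and> cmod (p * fst x + q * snd x) \<le> r k) \<Longrightarrow>
       (\<integral>\<^sup>+x. f x \<partial>\<sigma>) \<le> ennreal (K * (\<Sum>k. a k * (r k)\<^sup>2))"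
    by (rule layered_bound) blast
  \<comment> \<open>\<open>t powr (- 2)\<close> is split as
    \<open>t powr (- s) * t powr (- \<eta> / 2)\<close>. Against caps of measure about
    \<open>2 powr (- 2 * k)\<close> the exponent \<open>s < 2\<close> leaves a convergent geometric
    series; the second factor costs only \<open>n powr \<eta>\<close> because \<open>t\<close> is at
    least \<open>1 / n\<^sup>2\<close>.\<close>
  define s where "s = 2 - \<eta> / 2"
  define S where "S = (\<Sum>k::nat. 2 powr s * (2 powr (- \<eta> / 2)) ^ k)"
  have lt1: "2 powr (- \<eta> / 2) < 1" using powr_less_mono[of "-\<eta>/2" 0 2] \<eta> by simp
  have sum: "summable (\<lambda>k::nat. 2 powr s * (2 powr (- \<eta> / 2)) ^ k)"
    using lt1 by (intro summable_mult summable_geometric) simp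
  have S: "S > 0" unfolding S_def by (rule suminf_pos[OF sum]) simp
  have "(\<integral>\<^sup>+x. ennreal (1 / (norm (act g x))\<^sup>2) \<partial>\<sigma>) \<le> ennreal (2 * K * S * norm g powr (- 2 + \<eta>))"
    if g: "g \<in> SL2C" for g
  proof -
    define n where "n = norm g"
    have n: "n \<ge> 1" using norm_SL2C_ge(2)[OF g] by (simp add: n_def)
    \<comment> \<open>The longer row of \<open>g\<close> carries at least half of the squared
      norm.\<close>
    obtain p0 q0 where pq0: "n\<^sup>2 / 2 \<le> (cmod p0)\<^sup>2 + (cmod q0)\<^sup>2" 
      "\<And>x. (cmod (p0 * fst x + q0 * snd x)) \<le> norm (act g x)"
    proof (cases "n\<^sup>2 / 2 \<le> (cmod (g$1$1))\<^sup>2 + (cmod (g$1$2))\<^sup>2")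
      case True
      then show ?thesis by (rule that) (use norm_fst_snd_le(1)[of "act g _"] in \<open>simp add: act_def\<close>)
    next
      case False
      then have "n\<^sup>2 / 2 \<le> (cmod (g$2$1))\<^sup>2 + (cmod (g$2$2))\<^sup>2"
        by (simp add: n_def norm_mat_sq)
      then show ?thesis by (rule that) (use norm_fst_snd_le(2)[of "act g _"] in \<open>simp add: act_def\<close>)
    qed
    define \<rho> where "\<rho> = sqrt ((cmod p0)\<^sup>2 + (cmod q0)\<^sup>2)"
    have \<rho>2: "\<rho>\<^sup>2 = (cmod p0)\<^sup>2 + (cmod q0)\<^sup>2" by (simp add: \<rho>_def)
    have "0 < n\<^sup>2 / 2" using n by simp
    then have \<rho>: "\<rho> > 0" using pq0(1) unfolding \<rho>_def by (intro real_sqrt_gt_zero) linarith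
    define p q where "p = p0 / \<rho>" and "q = q0 / \<rho>"
    have pq: "(cmod p)\<^sup>2 + (cmod q)\<^sup>2 = 1"
      using \<rho> unfolding p_def q_def norm_divide power_divide add_divide_distrib[symmetric]
      by (simp flip: \<rho>2)
    have \<rho>pq: "\<rho> * cmod (p * fst x + q * snd x) \<le> norm (act g x)" for x
    proof -
      have "\<rho> * cmod (p * fst x + q * snd x) = cmod (\<rho> * (p * fst x + q * snd x))" using \<rho> by (simp add: norm_mult)
      also have "\<rho> * (p * fst x + q * snd x) = p0 * fst x + q0 * snd x"
        using \<rho> by (simp add: p_def q_def field_simps)
      finally show ?thesis using pq0(2) by simp
    qed
    define a where "a k = 2 * n powr (- 2 + \<eta>) * 2 powr ((real k + 1) * s)" for k :: nat
    define r where "r k = 2 powr (- real k)" for k :: nat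
    have ar: "a k * (r k)\<^sup>2 = (2 * n powr (- 2 + \<eta>)) * (2 powr s * (2 powr (- \<eta> / 2)) ^ k)" for k
    proof -
      have "2 powr ((real k + 1) * s) * (r k)\<^sup>2 = 2 powr ((real k + 1) * s - 2 * real k)"
        by (simp add: r_def power2_eq_square flip: powr_add)
      also have "(real k + 1) * s - 2 * real k = s + real k * (- \<eta> / 2)"
        by (simp add: s_def algebra_simps)
      also have "2 powr \<dots> = 2 powr s * (2 powr (- \<eta> / 2)) ^ k"
        by (simp only: powr_add powr_powr[symmetric] mult.commute[of "real k"]) (simp add: powr_realpow)
      finally show ?thesis by (simp add: a_def mult_ac)
    qed
    have "(\<integral>\<^sup>+x. ennreal (1 / (norm (act g x))\<^sup>2) \<partial>\<sigma>) \<le> ennreal (K * (\<Sum>k. a k * (r k)\<^sup>2))"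
    proof (rule layer[OF pq])
      show "summable (\<lambda>k. a k * (r k)\<^sup>2)" unfolding ar by (intro summable_mult sum)
      fix x :: "complex \<times> complex" assume x: "norm x = 1"
      \<comment> \<open>The linear form can vanish at \<open>x\<close>, but
        \<open>norm (act g x)\<close> is never below \<open>1 / n\<close>. The form is scaled by
        \<open>\<rho>\<close>, of order \<open>n\<close>, so \<open>1 / n\<^sup>2\<close> is the
        right cutoff.\<close>
      define t where "t = max (cmod (p * fst x + q * snd x)) (1 / n\<^sup>2)"
      have "(cmod (p * fst x + q * snd x))\<^sup>2 \<le> 1\<^sup>2"
        using row_Cauchy_Schwarz[of p x q] pq x by simp
      then have "cmod (p * fst x + q * snd x) \<le> 1" by (rule power2_le_imp_le) simp
      then have t: "0 < t" "t \<le> 1" using n by (auto simp: t_def less_max_iff_disj)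
      then obtain k where k: "2 powr (- real k - 1) < t" "t \<le> 2 powr (- real k)" by (rule dyadic_bracket)
      have g1: "1 \<le> n * norm (act g x)" using norm_act_ge[OF g, of x] x by (simp add: n_def)
      have "\<rho>\<^sup>2 * t\<^sup>2 \<le> (norm (act g x))\<^sup>2 \<or> t = 1 / n\<^sup>2"
        using power_mono[OF \<rho>pq[of x], of 2] \<rho> by (auto simp: t_def max_def power_mult_distrib)
      moreover have "\<rho>\<^sup>2 \<ge> n\<^sup>2 / 2" using pq0(1) \<rho>2 by simp
      ultimately have "n\<^sup>2 / 2 * t\<^sup>2 \<le> (norm (act g x))\<^sup>2"
      proof (elim disjE)
        assume "\<rho>\<^sup>2 * t\<^sup>2 \<le> (norm (act g x))\<^sup>2" "n\<^sup>2 / 2 \<le> \<rho>\<^sup>2"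
        then show ?thesis by (meson mult_right_mono order_trans zero_le_power2)
      next
        assume t: "t = 1 / n\<^sup>2"
        have "n\<^sup>2 / 2 * t\<^sup>2 \<le> n\<^sup>2 * t\<^sup>2" by simp
        also have "\<dots> = (1 / n)\<^sup>2" using n by (simp add: t power2_eq_square)
        also have "\<dots> \<le> (norm (act g x))\<^sup>2"
          using g1 n by (intro power_mono) (auto simp: field_simps)
        finally show ?thesis .
      qed
      moreover have "0 < n\<^sup>2 / 2 * t\<^sup>2" using n t by simp
      ultimately have "1 / (norm (act g x))\<^sup>2 \<le> 1 / (n\<^sup>2 / 2 * t\<^sup>2)" by (intro frac_le) auto
      also have "\<dots> = 2 * n powr (-2) * t powr (-2)"
        using n t by (simp add: powr_neg_numeral)
      also have "t powr (-2) = t powr (- s) * t powr (- \<eta> / 2)"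
        by (subst powr_add[symmetric]) (simp add: s_def)
      also have "2 * n powr (-2) * (t powr (- s) * t powr (- \<eta> / 2)) \<le> 2 * n powr (-2) * (2 powr ((real k + 1) * s) * n powr \<eta>)"
      proof (intro mult_left_mono mult_mono)
        have "t powr (- s) \<le> (2 powr (- real k - 1)) powr (- s)"
          using k \<eta> by (intro powr_mono2') (auto simp: s_def)
        then show "t powr (- s) \<le> 2 powr ((real k + 1) * s)" by (simp add: powr_powr algebra_simps)
        have "t powr (- \<eta> / 2) \<le> (1 / n\<^sup>2) powr (- \<eta> / 2)"
          using n \<eta> by (intro powr_mono2') (auto simp: t_def)
        also have "1 / n\<^sup>2 = n powr (-2)" using n by (simp add: powr_neg_numeral)
        finally show "t powr (- \<eta> / 2) \<le> n powr \<eta>" by (simp add: powr_powr)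
      qed auto
      also have "\<dots> = a k" unfolding a_def by (simp only: powr_add[of n "- 2"] mult_ac)
      finally have "1 / (norm (act g x))\<^sup>2 \<le> a k" .
      moreover have "cmod (p * fst x + q * snd x) \<le> r k" using k by (simp add: r_def t_def)
      ultimately show "\<exists>k. ennreal (1 / (norm (act g x))\<^sup>2) \<le> ennreal (a k) \<and> cmod (p * fst x + q * snd x) \<le> r k"
        by (intro exI[of _ k]) (auto intro: ennreal_leI)
    qed (auto simp: a_def r_def)
    also have "(\<Sum>k. a k * (r k)\<^sup>2) = 2 * n powr (- 2 + \<eta>) * S"
      unfolding ar S_def by (rule suminf_mult[OF sum])
    finally show ?thesis by (simp add: n_def mult_ac)
  qed
  with K S show ?thesis by (intro that[of "2 * K * S"]) auto
qed

end

section \<open>The functional equation and Fourier coefficients along the torus\<close>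

definition herm :: "complex \<times> complex \<Rightarrow> complex \<times> complex \<Rightarrow> complex" where
  "herm x y = fst x * cnj (fst y) + snd x * cnj (snd y)"

lemma herm_act: "herm (act g x) y = herm x (act (ctranspose g) y)"
  by (simp add: herm_def act_def ctranspose_def transpose_def algebra_simps)

lemma herm_SU2:
  assumes "k \<in> SU2"
  shows "herm (act k x) (act k y) = herm x y"
proof -
  obtain a b where k: "k = mat2 a b (- cnj b) (cnj a)" and ab: "(cmod a)\<^sup>2 + (cmod b)\<^sup>2 = 1"
    using assms unfolding SU2_iff by blast
  have "complex_of_real ((cmod a)\<^sup>2 + (cmod b)\<^sup>2) = 1" using ab by simp
  then have 1: "a * cnj a + b * cnj b = 1" by (simp only: of_real_add complex_norm_square)
  have "herm (act k x) (act k y) = (a * cnj a + b * cnj b) * herm x y"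
    by (simp add: k act_mat2 herm_def algebra_simps)
  then show ?thesis using 1 by simp
qed

lemma ctranspose_SL2C: "g \<in> SL2C \<Longrightarrow> ctranspose g \<in> SL2C"
proof -
  assume "g \<in> SL2C"
  then have "cnj (g$1$1 * g$2$2 - g$1$2 * g$2$1) = cnj 1" by (simp add: SL2C_def det_2)
  then show ?thesis by (simp add: SL2C_def det_2 ctranspose_def transpose_def mult.commute)
qed

lemma norm_ctranspose [simp]: "norm (ctranspose g) = norm g"
proof -
  have "(norm (ctranspose g))\<^sup>2 = (norm g)\<^sup>2" 
    by (simp add: norm_mat_sq ctranspose_def transpose_def)
  then show ?thesis by simp
qed

lemma ctranspose_ctranspose [simp]: "ctranspose (ctranspose g) = g"
  by (simp add: ctranspose_def transpose_def vec_eq_iff)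

lemma ctranspose_mult: "ctranspose (g ** h) = ctranspose h ** ctranspose g"
  by (simp add: ctranspose_def vec_eq_iff matrix_matrix_mult_def transpose_def mult.commute)

lemma SU2_ctranspose: "k \<in> SU2 \<Longrightarrow> ctranspose k \<in> SU2"
proof -
  assume "k \<in> SU2"
  then obtain a b where k: "k = mat2 a b (- cnj b) (cnj a)" and ab: "(cmod a)\<^sup>2 + (cmod b)\<^sup>2 = 1"
    unfolding SU2_iff by blast
  have "ctranspose k = mat2 (cnj a) (- b) (cnj b) a"
    by (simp add: k ctranspose_def transpose_def vec_eq_iff forall_2)
  then show ?thesis using ab SU2_mat2[of "cnj a" "- b"] by simp
qed

lemma SU2_cancel: 
  assumes "k \<in> SU2" 
  shows "ctranspose k ** k = mat 1" "k ** ctranspose k = mat 1"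
  using SU2_ctranspose[OF assms] assms by (simp_all add: SU2_def)

section \<open>Unitary equivalence with the transpose\<close>

lemma orthogonal_to_pair:
  fixes P Q :: "real^3"
  obtains n where "norm n = 1" "n \<bullet> P = 0" "n \<bullet> Q = 0"
proof -
  have "dim {P, Q} \<le> card {P, Q}" by (rule dim_le_card') simp
  also have "\<dots> \<le> 2" by (cases "P = Q") auto
  finally have "dim {P, Q} < DIM(real^3)" by simp
  then obtain x where x: "x \<noteq> 0" "\<forall>y\<in>span {P, Q}. orthogonal x y"
    using orthogonal_to_subspace_exists[of "{P, Q}"] by metis
  then have "x \<bullet> P = 0" "x \<bullet> Q = 0" by (simp_all add: orthogonal_def span_base)
  with x(1) that[of "x /\<^sub>R norm x"] show ?thesis by simp
qed

text \<open>A complex matrix of size 2 is unitarily equivalent to its transpose: on \<open>\<complex>\<^sup>3 = sl\<^sub>2\<close>, transposition is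
  a reflection, and so is the orthogonal reflection of \<open>\<real>\<^sup>3\<close> in the plane of the real and imaginary parts
  of the traceless part of the matrix, which fixes this traceless part.\<close>

lemma unitarily_equivalent_transpose:
  obtains U where "U \<in> SU2" "g ** U = U ** transpose g"
proof -
  define a b c d where abcd: "a = g$1$1" "b = g$1$2" "c = g$2$1" "d = g$2$2"
  define P :: "real^3" where "P = vector [Re (\<i> * (a - d)), Re (b - c), Re (- \<i> * (b + c))]"
  define Q :: "real^3" where "Q = vector [Im (\<i> * (a - d)), Im (b - c), Im (- \<i> * (b + c))]"
  obtain n :: "real^3" where n: "norm n = 1" "n \<bullet> P = 0" "n \<bullet> Q = 0" by (rule orthogonal_to_pair)
  \<comment> \<open>Taking \<open>\<beta>\<close> imaginary makes the unitary matrix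
    \<open>U\<close> symmetric. The claim then says that \<open>g U\<close> is symmetric, which is
    one complex equation for its off-diagonal entries: real linear in \<open>n\<close>, and exactly
    orthogonality to \<open>P\<close> and \<open>Q\<close>.\<close>
  define \<alpha> \<beta> where "\<alpha> = Complex (n$2) (n$3)" and "\<beta> = Complex 0 (n$1)"
  have "(norm n)\<^sup>2 = (n$1)\<^sup>2 + (n$2)\<^sup>2 + (n$3)\<^sup>2"
    by (simp add: norm_vec_def L2_set_def sum_3)
  then have "(cmod \<alpha>)\<^sup>2 + (cmod \<beta>)\<^sup>2 = 1" using n(1) by (simp add: \<alpha>_def \<beta>_def cmod_power2)
  then have U: "mat2 \<alpha> \<beta> (- cnj \<beta>) (cnj \<alpha>) \<in> SU2" by (simp add: SU2_mat2)
  have b': "- cnj \<beta> = \<beta>" by (simp add: \<beta>_def complex_eq_iff)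
  have "(a - d) * \<beta> + b * cnj \<alpha> - c * \<alpha> = 0"
    using n(2,3) by (simp add: complex_eq_iff \<alpha>_def \<beta>_def P_def Q_def inner_vec_def sum_3 algebra_simps)
  then have e: "a * \<beta> + b * cnj \<alpha> = c * \<alpha> + d * \<beta>" by (simp add: algebra_simps)
  have g: "g = mat2 a b c d" "transpose g = mat2 a c b d"
    by (simp_all add: abcd transpose_def vec_eq_iff forall_2)
  have "g ** mat2 \<alpha> \<beta> (- cnj \<beta>) (cnj \<alpha>) = mat2 \<alpha> \<beta> (- cnj \<beta>) (cnj \<alpha>) ** transpose g"
    unfolding b' g(2) by (subst g(1)) (use e in \<open>simp add: mat2_mult mult.commute add.commute\<close>)
  with U show ?thesis by (rule that)
qed

section \<open>Fourier coefficients along the diagonal torus\<close>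

lemma has_integral_cis:
  "((\<lambda>r. cis (real_of_int n * r)) has_integral (if n = 0 then of_real (2 * pi) else 0)) {0..2 * pi}"
proof (cases "n = 0")
  case True
  then show ?thesis using has_integral_const_real[of "1::complex" 0 "2 * pi"] by (simp add: scaleR_conv_of_real)
next
  case False
  have "((\<lambda>r. cis (real_of_int n * r)) has_integral
      (cis (real_of_int n * (2 * pi)) / (\<i> * of_int n) - cis (real_of_int n * 0) / (\<i> * of_int n))) {0..2 * pi}"
  proof (rule fundamental_theorem_of_calculus)
    fix x assume "x \<in> {0..2 * pi}"
    have "((\<lambda>r. exp (\<i> * of_int n * of_real r) / (\<i> * of_int n)) has_vector_derivative
        (exp (\<i> * of_int n * of_real x))) (at x within {0..2 * pi})"
      using False by (auto intro!: derivative_eq_intros has_vector_derivative_real_field simp: field_simps)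
    then show "((\<lambda>r. cis (real_of_int n * r) / (\<i> * of_int n)) has_vector_derivative cis (real_of_int n * x)) (at x within {0..2 * pi})"
      by (simp add: cis_conv_exp mult_ac)
  qed simp
  moreover have "cis (real_of_int n * (2 * pi)) = 1"
    using cis_multiple_2pi[of "real_of_int n"] by (simp add: mult_ac)
  ultimately show ?thesis using False by simp
qed

text \<open>Weight \<open>q\<close> picks the index \<open>j = l + q\<close>; the weights
  \<open>- l\<close>, 0 and \<open>l\<close> thus become the indices 0, \<open>l\<close> and
  \<open>2 * l\<close> of the coefficients below.\<close>

lemma integral_trig_polynomial:
  fixes a :: "nat \<Rightarrow> complex"
  assumes q: "\<bar>q\<bar> \<le> int l"
    and f: "\<And>r. f r = (\<Sum>j\<le>2 * l. a j * cis (real_of_int (2 * int j - 2 * int l) * r))"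
  shows "integral {0..2 * pi} (\<lambda>r. f r * exp (- 2 * of_int q * \<i> * of_real r)) = 2 * pi * a (nat (int l + q))"
proof -
  define j0 where "j0 = nat (int l + q)"
  have j0: "int j0 = int l + q" "j0 \<le> 2 * l" using q by (auto simp: j0_def)
  have e: "f r * exp (- 2 * of_int q * \<i> * of_real r) = (\<Sum>j\<le>2 * l. a j * cis (real_of_int (2 * int j - 2 * int j0) * r))" for r
  proof -
    have "exp (- 2 * of_int q * \<i> * of_real r) = cis (real_of_int (- 2 * q) * r)"
      by (simp add: cis_conv_exp mult_ac)
    then show ?thesis
      by (simp add: f sum_distrib_right mult.assoc cis_mult j0(1)) (simp add: algebra_simps)
  qed
  have "((\<lambda>r. \<Sum>j\<le>2 * l. a j * cis (real_of_int (2 * int j - 2 * int j0) * r)) has_integral 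
      (\<Sum>j\<le>2 * l. a j * (if 2 * int j - 2 * int j0 = 0 then of_real (2 * pi) else 0))) {0..2 * pi}"
    by (intro has_integral_sum has_integral_mult_right has_integral_cis) simp
  also have "(\<Sum>j\<le>2 * l. a j * (if 2 * int j - 2 * int j0 = 0 then of_real (2 * pi) else 0)) = 2 * pi * a j0"
    using j0(2) by (simp add: if_distrib cong: if_cong)
  finally show ?thesis unfolding e j0_def[symmetric] by (simp add: integral_unique)
qed

context sphere_measure begin

lemma integral_SU2:
  fixes f :: "complex \<times> complex \<Rightarrow> complex"
  assumes "k \<in> SU2" and [measurable]: "f \<in> borel_measurable borel"
  shows "(LINT x|\<sigma>. f (act k x)) = (LINT x|\<sigma>. f x)"
proof -
  have "(LINT x|\<sigma>. f (act k x)) = (LINT x|distr \<sigma> borel (act k). f x)"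
    by (simp add: integral_distr)
  then show ?thesis by (simp add: distr_SU2[OF assms(1)])
qed

lemma integral_cnj:
  fixes f :: "complex \<times> complex \<Rightarrow> complex"
  assumes [measurable]: "f \<in> borel_measurable borel"
  shows "(LINT x|\<sigma>. f (cnj (fst x), cnj (snd x))) = (LINT x|\<sigma>. f x)"
proof -
  have m: "(\<lambda>x. (cnj (fst x), cnj (snd x))) \<in> borel_measurable \<sigma>"
    by (intro borel_measurable_Pair) measurable
  have "(LINT x|\<sigma>. f (cnj (fst x), cnj (snd x))) = (LINT x|distr \<sigma> borel (\<lambda>x. (cnj (fst x), cnj (snd x))). f x)"
    using m by (simp add: integral_distr)
  then show ?thesis by (simp add: distr_cnj)
qed

end

lemma herm_measurable [measurable]:
  "f \<in> borel_measurable M \<Longrightarrow> g \<in> borel_measurable M \<Longrightarrow> (\<lambda>x. herm (f x) (g x)) \<in> borel_measurable M"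
proof -
  assume f: "f \<in> borel_measurable M" and g: "g \<in> borel_measurable M"
  note [measurable] = measurable_compose[OF f borel_measurable_fst_snd(1)] measurable_compose[OF f borel_measurable_fst_snd(2)]
    measurable_compose[OF g borel_measurable_fst_snd(1)] measurable_compose[OF g borel_measurable_fst_snd(2)]
  show ?thesis unfolding herm_def by measurable
qed

text \<open>The function \<open>X\<close> absorbs the spectral parameter: only its absolute value matters.\<close>

locale spherical = sphere_measure +
  fixes l :: nat and X :: "real \<Rightarrow> complex"
  assumes X_measurable [measurable]: "X \<in> borel_measurable borel"
    and norm_X: "r > 0 \<Longrightarrow> norm (X r) = 1 / r ^ (2 * l + 2)"
begin

lemma integrable_X:
  assumes g: "g \<in> SL2C" and [measurable]: "P \<in> borel_measurable borel"
    and P: "\<And>x. norm x = 1 \<Longrightarrow> norm (P x) \<le> norm (act g x) ^ (2 * l)"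
  shows "integrable \<sigma> (\<lambda>x. P x * X (norm (act g x)))"
proof (rule integrable_const_bound[where B = "(norm g)\<^sup>2"])
  show "AE x in \<sigma>. norm (P x * X (norm (act g x))) \<le> (norm g)\<^sup>2"
    using sphere
  proof eventually_elim
    fix x :: "complex \<times> complex" assume x: "norm x = 1"
    have 1: "1 \<le> norm g * norm (act g x)" using norm_act_ge[OF g, of x] x by simp
    then have pos: "norm (act g x) > 0" by (smt (verit) mult_nonneg_nonpos norm_ge_zero)
    have "norm (P x * X (norm (act g x))) \<le> norm (act g x) ^ (2 * l) * (1 / norm (act g x) ^ (2 * l + 2))"
      unfolding norm_mult norm_X[OF pos] by (intro mult_right_mono P x) simp
    also have "\<dots> = 1 / (norm (act g x))\<^sup>2" using pos by (simp add: power_add power2_eq_square)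
    also have "\<dots> \<le> (norm g)\<^sup>2"
      using power_mono[OF 1, of 2] pos by (simp add: power_mult_distrib divide_le_eq mult.commute)
    finally show "norm (P x * X (norm (act g x))) \<le> (norm g)\<^sup>2" .
  qed
qed measurable

text \<open>The spherical trace function without its factor \<open>2 * l + 1\<close>, once
  \<open>X\<close> is chosen suitably.\<close>

definition Phi :: "complex^2^2 \<Rightarrow> complex" where
  "Phi g = (LINT x|\<sigma>. cnj (herm (act g x) x) ^ (2 * l) * X (norm (act g x)))"

text \<open>This is the functional equation \<open>\<nu> \<mapsto> - \<nu>\<close>: substitute \<open>x \<mapsto> U cnj x\<close>, where \<open>U\<close> conjugates \<open>g\<close> to its transpose.\<close>

lemma Phi_ctranspose:
  "Phi g = (LINT x|\<sigma>. cnj (herm (act g x) x) ^ (2 * l) * X (norm (act (ctranspose g) x)))"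
proof -
  obtain U where U: "U \<in> SU2" "g ** U = U ** transpose g" by (rule unitarily_equivalent_transpose)
  define F where "F x = cnj (herm (act g x) x) ^ (2 * l) * X (norm (act g x))" for x
  have [measurable]: "F \<in> borel_measurable borel" unfolding F_def by measurable
  have "Phi g = (LINT x|\<sigma>. F (act U x))" unfolding Phi_def F_def[symmetric] by (simp add: integral_SU2[OF U(1)])
  also have "\<dots> = (LINT x|\<sigma>. F (act U (cnj (fst x), cnj (snd x))))"
    by (rule integral_cnj[symmetric]) measurable
  also have "(\<lambda>x. F (act U (cnj (fst x), cnj (snd x)))) = 
    (\<lambda>x. cnj (herm (act g x) x) ^ (2 * l) * X (norm (act (ctranspose g) x)))"
  proof
    fix x :: "complex \<times> complex"
    define y where "y = (cnj (fst x), cnj (snd x))"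
    have gU: "act g (act U y) = act U (act (transpose g) y)" using U(2) by (simp flip: act_mult)
    have "herm (act g (act U y)) (act U y) = herm (act (transpose g) y) y"
      by (simp add: gU herm_SU2[OF U(1)])
    also have "\<dots> = herm (act g x) x"
      by (simp add: herm_def act_def transpose_def y_def algebra_simps)
    finally have 1: "herm (act g (act U y)) (act U y) = herm (act g x) x" .
    have "act (transpose g) y = (cnj (fst (act (ctranspose g) x)), cnj (snd (act (ctranspose g) x)))"
      by (simp add: act_def y_def transpose_def ctranspose_def)
    then have "norm (act (transpose g) y) = norm (act (ctranspose g) x)"
      by (simp add: norm_prod_def)
    then have "norm (act g (act U y)) = norm (act (ctranspose g) x)"
      by (simp only: gU norm_act_SU2[OF U(1)])
    then show "F (act U (cnj (fst x), cnj (snd x))) = cnj (herm (act g x) x) ^ (2 * l) * X (norm (act (ctranspose g) x))"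
      unfolding F_def y_def[symmetric] by (simp add: 1)
  qed
  finally show ?thesis .
qed

text \<open>The Fourier coefficient of index \<open>j\<close> along the torus, without its binomial
  factor.\<close>

definition coef :: "nat \<Rightarrow> complex^2^2 \<Rightarrow> complex" where
  "coef j g = (LINT x|\<sigma>. (cnj (fst (act g x)) * fst x) ^ (2 * l - j) * (cnj (snd (act g x)) * snd x) ^ j * X (norm (act g x)))"

text \<open>The same Fourier coefficient read off from the functional equation: \<open>g\<close> is
  moved to the other side of \<open>herm\<close>, so that everything is expressed by
  \<open>ctranspose g\<close>.\<close>

definition coef' :: "nat \<Rightarrow> complex^2^2 \<Rightarrow> complex" where
  "coef' j g = (LINT x|\<sigma>. (fst (act (ctranspose g) x) * cnj (fst x)) ^ (2 * l - j) * 
      (snd (act (ctranspose g) x) * cnj (snd x)) ^ j * X (norm (act (ctranspose g) x)))"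

lemma monomial_bound:
  assumes "norm x = 1" "j \<le> 2 * l"
    and "cmod a \<le> norm z * cmod (fst x)" "cmod b \<le> norm z * cmod (snd x)"
  shows "norm (a ^ (2 * l - j) * b ^ j) \<le> norm z ^ (2 * l)"
proof -
  have "cmod a \<le> norm z * 1" "cmod b \<le> norm z * 1"
    using assms(1) by (auto intro!: order_trans[OF assms(3)] order_trans[OF assms(4)] mult_left_mono
        order_trans[OF norm_fst_snd_le(1)] order_trans[OF norm_fst_snd_le(2)] simp del: mult_1_right)
  then have "norm (a ^ (2 * l - j) * b ^ j) \<le> norm z ^ (2 * l - j) * norm z ^ j"
    unfolding norm_mult norm_power by (intro mult_mono power_mono) auto
  also have "\<dots> = norm z ^ (2 * l)" using assms by (simp flip: power_add)
  finally show ?thesis .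
qed

lemma diag_SU2: "mat2 (cis r) 0 0 (cis (- r)) \<in> SU2"
  using SU2_mat2[of "cis r" 0] by (simp add: cis_cnj)

lemma cis_powers: "j \<le> 2 * l \<Longrightarrow> cis (- r) ^ (2 * l - j) * cis r ^ j = cis (real_of_int (2 * int j - 2 * int l) * r)"
  unfolding Complex.DeMoivre cis_mult by (rule arg_cong[where f = cis]) (simp add: of_nat_diff algebra_simps)

lemma binomial_cis:
  "(a * cis (- r) + b * cis r) ^ (2 * l) = 
     (\<Sum>j\<le>2 * l. of_nat (2 * l choose j) * (a ^ (2 * l - j) * b ^ j) * cis (real_of_int (2 * int j - 2 * int l) * r))"
proof -
  have "(a * cis (- r) + b * cis r) ^ (2 * l) = (b * cis r + a * cis (- r)) ^ (2 * l)" by (simp add: add.commute)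
  also have "\<dots> = (\<Sum>j\<le>2 * l. of_nat (2 * l choose j) * (b * cis r) ^ j * (a * cis (- r)) ^ (2 * l - j))"
    by (rule binomial_ring)
  also have "\<dots> = (\<Sum>j\<le>2 * l. of_nat (2 * l choose j) * (a ^ (2 * l - j) * b ^ j) * cis (real_of_int (2 * int j - 2 * int l) * r))"
  proof (intro sum.cong refl)
    fix j assume "j \<in> {..2 * l}"
    then have "cis (real_of_int (2 * int j - 2 * int l) * r) = cis (- r) ^ (2 * l - j) * cis r ^ j"
      by (simp only: cis_powers atMost_iff)
    then show "of_nat (2 * l choose j) * (b * cis r) ^ j * (a * cis (- r)) ^ (2 * l - j) =
        of_nat (2 * l choose j) * (a ^ (2 * l - j) * b ^ j) * cis (real_of_int (2 * int j - 2 * int l) * r)"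
      by (simp only: power_mult_distrib mult_ac)
  qed
  finally show ?thesis .
qed

lemma integral_binomial_cis:
  assumes g: "g \<in> SL2C" and [measurable]: "a \<in> borel_measurable borel" "b \<in> borel_measurable borel"
    and ab: "\<And>x. cmod (a x) \<le> norm (act g x) * cmod (fst x)" "\<And>x. cmod (b x) \<le> norm (act g x) * cmod (snd x)"
  shows "(LINT x|\<sigma>. (a x * cis (- r) + b x * cis r) ^ (2 * l) * X (norm (act g x))) =
    (\<Sum>j\<le>2 * l. of_nat (2 * l choose j) * (LINT x|\<sigma>. a x ^ (2 * l - j) * b x ^ j * X (norm (act g x))) * 
      cis (real_of_int (2 * int j - 2 * int l) * r))"
proof -
  have "(LINT x|\<sigma>. (a x * cis (- r) + b x * cis r) ^ (2 * l) * X (norm (act g x))) = 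
    (LINT x|\<sigma>. (\<Sum>j\<le>2 * l. of_nat (2 * l choose j) * cis (real_of_int (2 * int j - 2 * int l) * r) *
      (a x ^ (2 * l - j) * b x ^ j * X (norm (act g x)))))"
    unfolding binomial_cis sum_distrib_right
    by (intro Bochner_Integration.integral_cong refl sum.cong) (simp only: mult_ac)
  also have "\<dots> = (\<Sum>j\<le>2 * l. of_nat (2 * l choose j) * cis (real_of_int (2 * int j - 2 * int l) * r) * 
      (LINT x|\<sigma>. a x ^ (2 * l - j) * b x ^ j * X (norm (act g x))))"
  proof (subst Bochner_Integration.integral_sum)
    fix j assume j: "j \<in> {..2 * l}"
    have "norm (a x ^ (2 * l - j) * b x ^ j) \<le> norm (act g x) ^ (2 * l)" if "norm x = 1" for x
      by (rule monomial_bound[OF that _ ab]) (use j in simp)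
    then show "integrable \<sigma> (\<lambda>x. of_nat (2 * l choose j) * cis (real_of_int (2 * int j - 2 * int l) * r) *
      (a x ^ (2 * l - j) * b x ^ j * X (norm (act g x))))"
      by (intro integrable_mult_right integrable_X[OF g]) measurable
  qed (auto intro!: sum.cong)
  finally show ?thesis by (simp add: mult_ac)
qed

text \<open>The torus element must leave the argument of \<open>X\<close> before the power can be
  expanded. Replacing \<open>x\<close> by its image under the inverse torus element moves it to the
  second argument of \<open>herm\<close>.\<close>

lemma Phi_diag:
  assumes g: "g \<in> SL2C"
  shows "Phi (g ** mat2 (cis r) 0 0 (cis (- r))) = 
    (\<Sum>j\<le>2 * l. of_nat (2 * l choose j) * coef j g * cis (real_of_int (2 * int j - 2 * int l) * r))"
proof -
  define D where "D = mat2 (cis r) 0 0 (cis (- r))"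
  define D' where "D' = mat2 (cis (- r)) 0 0 (cis r)"
  have D': "D' \<in> SU2" using diag_SU2[of "- r"] by (simp add: D'_def)
  have DD: "D ** D' = mat 1" by (simp add: D_def D'_def mat2_mult cis_mult vec_eq_iff forall_2 mat_def)
  have 1: "act (g ** D) (act D' x) = act g x" for x
    by (simp add: DD flip: act_mult matrix_mul_assoc)
  have 2: "cnj (herm (act g x) (act D' x)) = cnj (fst (act g x)) * fst x * cis (- r) + cnj (snd (act g x)) * snd x * cis r" for x
    by (simp add: herm_def D'_def act_mat2 cis_cnj mult_ac)
  have "Phi (g ** D) = (LINT x|\<sigma>. cnj (herm (act (g ** D) (act D' x)) (act D' x)) ^ (2 * l) * X (norm (act (g ** D) (act D' x))))"
    unfolding Phi_def by (rule integral_SU2[OF D', symmetric]) measurable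
  also have "\<dots> = (\<Sum>j\<le>2 * l. of_nat (2 * l choose j) * coef j g * cis (real_of_int (2 * int j - 2 * int l) * r))"
    unfolding 1 2 coef_def by (rule integral_binomial_cis[OF g]) (auto simp: norm_mult intro!: mult_right_mono norm_fst_snd_le)
  finally show ?thesis by (simp only: D_def)
qed

text \<open>In this form the torus element acts unitarily after \<open>ctranspose g\<close>, so the
  argument of \<open>X\<close> is free of it from the start.\<close>

lemma Phi_diag':
  assumes g: "g \<in> SL2C"
  shows "Phi (g ** mat2 (cis r) 0 0 (cis (- r))) = 
    (\<Sum>j\<le>2 * l. of_nat (2 * l choose j) * coef' j g * cis (real_of_int (2 * int j - 2 * int l) * r))"
proof -
  define D where "D = mat2 (cis r) 0 0 (cis (- r))"
  have D: "D \<in> SU2" using diag_SU2[of r] by (simp add: D_def)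
  have 1: "norm (act (ctranspose (g ** D)) x) = norm (act (ctranspose g) x)" for x
    by (simp add: ctranspose_mult act_mult norm_act_SU2 SU2_ctranspose D)
  have 2: "cnj (herm (act (g ** D) x) x) = fst (act (ctranspose g) x) * cnj (fst x) * cis (- r) + snd (act (ctranspose g) x) * cnj (snd x) * cis r" for x
    unfolding act_mult herm_act[of g] by (simp add: herm_def D_def act_mat2 cis_cnj mult_ac)
  have "Phi (g ** D) = (\<Sum>j\<le>2 * l. of_nat (2 * l choose j) * coef' j g * cis (real_of_int (2 * int j - 2 * int l) * r))"
    unfolding Phi_ctranspose 1 2 coef'_def
    by (rule integral_binomial_cis[OF ctranspose_SL2C[OF g]]) (auto simp: norm_mult intro!: mult_right_mono norm_fst_snd_le)
  then show ?thesis by (simp only: D_def)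
qed

lemma integral_Phi_diag:
  assumes g: "g \<in> SL2C" and q: "\<bar>q\<bar> \<le> int l"
  shows "integral {0..2 * pi} (\<lambda>r. Phi (g ** mat2 (cis r) 0 0 (cis (- r))) * exp (- 2 * of_int q * \<i> * of_real r)) =
    2 * pi * (of_nat (2 * l choose nat (int l + q)) * coef (nat (int l + q)) g)"
  by (rule integral_trig_polynomial[OF q Phi_diag[OF g]])

text \<open>The functional equation is known for \<open>Phi\<close>; comparing Fourier coefficients
  transfers it to every single weight, as no binomial coefficient vanishes.\<close>

lemma coef_eq_coef':
  assumes g: "g \<in> SL2C" and j: "j \<le> 2 * l"
  shows "coef j g = coef' j g"
proof -
  define q where "q = int j - int l"
  have q: "\<bar>q\<bar> \<le> int l" "nat (int l + q) = j" using j by (auto simp: q_def)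
  have "2 * pi * (of_nat (2 * l choose j) * coef j g) = 2 * pi * (of_nat (2 * l choose j) * coef' j g)"
    using integral_trig_polynomial[OF q(1) Phi_diag[OF g]] integral_trig_polynomial[OF q(1) Phi_diag'[OF g]]
    by (simp only: q(2))
  then show ?thesis using j by (simp add: binomial_eq_0_iff)
qed

end

section \<open>Extreme weights\<close>

lemma norm_entry_le: "cmod (g$i$j) \<le> norm g" for g :: "complex^2^2"
  using Finite_Cartesian_Product.norm_nth_le[of "g$i" j] Finite_Cartesian_Product.norm_nth_le[of g i] by linarith

context sphere_measure begin

text \<open>\<open>trivial_bound l g\<close> is the bound for the coefficient of extreme weight by absolute values. It sees that
  \<open>g\<close> nearly fixes the first coordinate axis (the lower left entry is small), but not that the upper right entry is small.\<close>

definition trivial_bound :: "nat \<Rightarrow> complex^2^2 \<Rightarrow> ennreal" where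
  "trivial_bound l g = (\<integral>\<^sup>+x. ennreal ((cmod (fst x) * cmod (fst (act g x))) ^ (2 * l) / norm (act g x) ^ (2 * l + 2)) \<partial>\<sigma>)"

lemma integrand_split:
  "(p * q) ^ (2 * l) / n ^ (2 * l + 2) = (p\<^sup>2) ^ l * ((q / n)\<^sup>2) ^ l * (1 / n\<^sup>2)" for p q n :: real
  by (simp add: power_mult_distrib power_divide power_add power_mult power2_eq_square mult_ac)

text \<open>Let \<open>v\<close> and \<open>t\<close> be the relative sizes of the second
  coordinates of \<open>x\<close> and \<open>z = act g x\<close>. Since
  \<open>c * fst x = snd z - d * snd x\<close>, they cannot both be small unless \<open>c\<close>
  is; quantitatively \<open>|c|^2 \<le> 3 * n^2 * (t^2 + v^2)\<close>. The integrand is at most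
  \<open>exp (- l * (t^2 + v^2)) / norm z ^ 2\<close>.\<close>

lemma trivial_bound_decay:
  assumes g: "g \<in> SL2C"
  shows "trivial_bound l g \<le> ennreal (exp (- (l * (cmod (g$2$1))\<^sup>2 / (3 * (norm g)\<^sup>2)))) *
    (\<integral>\<^sup>+x. ennreal (1 / (norm (act g x))\<^sup>2) \<partial>\<sigma>)"
proof -
  define E where "E = exp (- (l * (cmod (g$2$1))\<^sup>2 / (3 * (norm g)\<^sup>2)))"
  define n where "n = norm g"
  have n: "n \<ge> 1" using norm_SL2C_ge(2)[OF g] by (simp add: n_def)
  have "trivial_bound l g \<le> (\<integral>\<^sup>+x. ennreal E * ennreal (1 / (norm (act g x))\<^sup>2) \<partial>\<sigma>)"
    unfolding trivial_bound_def
  proof (rule nn_integral_mono_AE, use sphere in eventually_elim)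
    fix x :: "complex \<times> complex" assume x: "norm x = 1"
    define z where "z = act g x"
    have "norm z \<noteq> 0" using norm_act_ge[OF g, of x] x by (auto simp: z_def)
    then have z: "norm z > 0" by simp
    have zn: "norm z \<le> n" using norm_act_le[of g x] x by (simp add: z_def n_def)
    define t v where "t = cmod (snd z) / norm z" and "v = cmod (snd x)"
    have "(cmod (fst z))\<^sup>2 = (norm z)\<^sup>2 - (cmod (snd z))\<^sup>2" using norm_pair_sq[of z] by simp
    then have t: "(cmod (fst z) / norm z)\<^sup>2 = 1 - t\<^sup>2" "0 \<le> t"
      using z by (simp_all add: t_def power_divide diff_divide_distrib)
    have v: "(cmod (fst x))\<^sup>2 = 1 - v\<^sup>2" "0 \<le> v"
      using x norm_pair_sq[of x] by (simp_all add: v_def)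
    define c d where "c = g$2$1" and "d = g$2$2"
    have cd: "cmod d \<le> n" "cmod c \<le> n"
      unfolding n_def c_def d_def by (rule norm_entry_le)+
    have "c * fst x = snd z - d * snd x" by (simp add: c_def d_def z_def act_def)
    then have "cmod c * cmod (fst x) \<le> cmod (snd z) + cmod d * v"
      by (metis norm_mult norm_triangle_ineq4 v_def)
    also have "\<dots> \<le> n * t + n * v"
      using z zn v(2) cd t(2) mult_right_mono[OF zn t(2)] by (intro add_mono mult_right_mono) (auto simp: t_def)
    finally have "(cmod c * cmod (fst x))\<^sup>2 \<le> (n * t + n * v)\<^sup>2" by (intro power_mono) auto
    also have "\<dots> \<le> 2 * n\<^sup>2 * (t\<^sup>2 + v\<^sup>2)"
      using zero_le_power2[of "n * t - n * v"] by (simp add: power2_eq_square algebra_simps)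
    finally have "(cmod c)\<^sup>2 * (1 - v\<^sup>2) \<le> 2 * n\<^sup>2 * (t\<^sup>2 + v\<^sup>2)" by (simp add: power_mult_distrib v)
    moreover have "(cmod c)\<^sup>2 * v\<^sup>2 \<le> n\<^sup>2 * v\<^sup>2" using cd by (intro mult_right_mono power_mono) auto
    moreover have "0 \<le> n\<^sup>2 * t\<^sup>2" by simp
    ultimately have "(cmod c)\<^sup>2 \<le> 3 * n\<^sup>2 * (t\<^sup>2 + v\<^sup>2)"
      unfolding distrib_left right_diff_distrib by linarith
    then have key: "(cmod c)\<^sup>2 / (3 * n\<^sup>2) \<le> t\<^sup>2 + v\<^sup>2" using n by (simp add: divide_le_eq mult_ac)
    have "(cmod (fst x) * cmod (fst z)) ^ (2 * l) / norm z ^ (2 * l + 2) = (1 - v\<^sup>2) ^ l * (1 - t\<^sup>2) ^ l * (1 / (norm z)\<^sup>2)"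
      unfolding integrand_split t(1) v(1) ..
    also have "\<dots> \<le> exp (- v\<^sup>2) ^ l * exp (- t\<^sup>2) ^ l * (1 / (norm z)\<^sup>2)"
    proof (intro mult_mono mult_right_mono power_mono)
      show "1 - v\<^sup>2 \<le> exp (- v\<^sup>2)" "1 - t\<^sup>2 \<le> exp (- t\<^sup>2)"
        using exp_ge_add_one_self[of "- v\<^sup>2"] exp_ge_add_one_self[of "- t\<^sup>2"] by auto
      show "0 \<le> 1 - v\<^sup>2" "0 \<le> 1 - t\<^sup>2" by (simp_all flip: v(1) t(1))
    qed (use v(2) in \<open>simp_all flip: t(1)\<close>)
    also have "exp (- v\<^sup>2) ^ l * exp (- t\<^sup>2) ^ l = exp (- (l * (t\<^sup>2 + v\<^sup>2)))"
      by (simp add: algebra_simps flip: exp_of_nat_mult exp_add)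
    also have "\<dots> * (1 / (norm z)\<^sup>2) \<le> E * (1 / (norm z)\<^sup>2)"
      using mult_left_mono[OF key, of "real l"] 
      by (intro mult_right_mono) (auto simp: E_def c_def n_def)
    finally show "ennreal ((cmod (fst x) * cmod (fst (act g x))) ^ (2 * l) / norm (act g x) ^ (2 * l + 2)) \<le> 
      ennreal E * ennreal (1 / (norm (act g x))\<^sup>2)"
      unfolding z_def by (subst ennreal_mult[symmetric]) (auto simp: E_def intro!: ennreal_leI)
  qed
  also have "\<dots> = ennreal E * (\<integral>\<^sup>+x. ennreal (1 / (norm (act g x))\<^sup>2) \<partial>\<sigma>)"
    by (rule nn_integral_cmult) measurable
  finally show ?thesis by (simp add: E_def)
qed

text \<open>Substituting \<open>x \<mapsto> g\<^sup>-\<^sup>1 x\<close> in the integral over a shell.\<close>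

lemma trivial_bound_adj2:
  assumes g: "g \<in> SL2C"
  shows "trivial_bound l g = trivial_bound l (adj2 g)"
proof -
  \<comment> \<open>Extended homogeneously, the integrand is symmetric in \<open>x\<close> and
    \<open>act g x\<close>. The substitution therefore produces the integrand of the inverse, and
    only the shell changes.\<close>
  define F where "F g x = ennreal ((cmod (fst x) * cmod (fst (act g x))) ^ (2 * l) / (norm x ^ (2 * l + 2) * norm (act g x) ^ (2 * l + 2)))"
    for g :: "complex^2^2" and x
  have [measurable]: "F g \<in> borel_measurable borel" for g unfolding F_def by measurable
  have "ennreal (t ^ 4) * F g (t *\<^sub>R x) = F g x" if t: "t > 0" for t x g
  proof -
    have "t ^ 4 * ((cmod (fst (t *\<^sub>R x)) * cmod (fst (act g (t *\<^sub>R x)))) ^ (2 * l) / (norm (t *\<^sub>R x) ^ (2 * l + 2) * norm (act g (t *\<^sub>R x)) ^ (2 * l + 2))) =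
      (t ^ 4 * (t * t) ^ (2 * l) / (t ^ (2 * l + 2) * t ^ (2 * l + 2))) *
      ((cmod (fst x) * cmod (fst (act g x))) ^ (2 * l) / (norm x ^ (2 * l + 2) * norm (act g x) ^ (2 * l + 2)))"
      using t by (simp add: act_scaleR power_mult_distrib mult_ac del: scaleR_Pair)
    also have "t ^ 4 * (t * t) ^ (2 * l) = t ^ (4 + 2 * (2 * l))"
      by (simp only: power2_eq_square[symmetric] power_mult[symmetric] power_add[symmetric])
    also have "4 + 2 * (2 * l) = (2 * l + 2) + (2 * l + 2)" by simp
    also have "t ^ \<dots> = t ^ (2 * l + 2) * t ^ (2 * l + 2)" by (rule power_add)
    finally have "t ^ 4 * ((cmod (fst (t *\<^sub>R x)) * cmod (fst (act g (t *\<^sub>R x)))) ^ (2 * l) / (norm (t *\<^sub>R x) ^ (2 * l + 2) * norm (act g (t *\<^sub>R x)) ^ (2 * l + 2))) =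
      ((cmod (fst x) * cmod (fst (act g x))) ^ (2 * l) / (norm x ^ (2 * l + 2) * norm (act g x) ^ (2 * l + 2)))"
      using t by simp
    then show ?thesis unfolding F_def using t by (simp flip: ennreal_mult)
  qed
  then have F: "homogeneous (F g)" for g by (simp add: homogeneous_def)
  have J: "trivial_bound l g = (\<integral>\<^sup>+x. F g x \<partial>\<sigma>)" for g
    unfolding trivial_bound_def F_def
    by (rule nn_integral_cong_AE) (use sphere in eventually_elim, simp)
  have [measurable]: "shell norm \<in> sets borel" by (rule shell_sets[OF radius_fun_norm])
  have "shell_mass * trivial_bound l g = (\<integral>\<^sup>+x. F g x * indicator (shell norm) x \<partial>lborel)"
    unfolding J by (rule nn_integral_homogeneous[OF F radius_fun_norm])
  also have "\<dots> = (\<integral>\<^sup>+x. F g (act (adj2 g) x) * indicator (shell norm) (act (adj2 g) x) \<partial>lborel)"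
    by (rule nn_integral_lborel_SL2C[OF adj2_SL2C[OF g], symmetric]) measurable
  also have "\<dots> = (\<integral>\<^sup>+x. F (adj2 g) x * indicator (shell (\<lambda>x. norm (act (adj2 g) x))) x \<partial>lborel)"
    by (simp add: F_def act_adj2[OF g] shell_def indicator_def mult_ac)
  also have "\<dots> = shell_mass * trivial_bound l (adj2 g)"
    unfolding J by (rule nn_integral_homogeneous[OF F radius_fun_norm_act[OF adj2_SL2C[OF g]], symmetric])
  finally show ?thesis
    using shell_mass_nonzero shell_mass_less_top by (auto simp: ennreal_mult_cancel_left)
qed

text \<open>Here the upper left entry is at least \<open>n / 2\<close>. Where
  \<open>|fst x| \<ge> 1/2\<close> this gives \<open>norm (act g x) \<ge> n / 4 - n / 8\<close>,
  hence the full decay in \<open>n\<close> times a moment; elsewhere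
  \<open>|fst x| ^ (2 * l)\<close> is exponentially small.\<close>

lemma trivial_bound_near_diagonal:
  assumes g: "g \<in> SL2C" and b: "cmod (g$1$2) \<le> norm g / 8" and c: "cmod (g$2$1) \<le> norm g / 8"
    and ad: "cmod (g$2$2) \<le> cmod (g$1$1)"
  shows "trivial_bound l g \<le> ennreal (64 / (norm g)\<^sup>2) * (\<integral>\<^sup>+x. ennreal (cmod (fst x) ^ (2 * l)) \<partial>\<sigma>) +
    ennreal ((1/4) ^ l) * (\<integral>\<^sup>+x. ennreal (1 / (norm (act g x))\<^sup>2) \<partial>\<sigma>)"
proof -
  define n where "n = norm g"
  have n: "n \<ge> 1" using norm_SL2C_ge(2)[OF g] by (simp add: n_def)
  have "(cmod (g$1$2))\<^sup>2 \<le> (n / 8)\<^sup>2" "(cmod (g$2$1))\<^sup>2 \<le> (n / 8)\<^sup>2" "(cmod (g$2$2))\<^sup>2 \<le> (cmod (g$1$1))\<^sup>2"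
    using b c ad by (intro power_mono; simp add: n_def)+
  moreover have "n\<^sup>2 = (cmod (g$1$1))\<^sup>2 + (cmod (g$1$2))\<^sup>2 + (cmod (g$2$1))\<^sup>2 + (cmod (g$2$2))\<^sup>2"
    unfolding n_def by (rule norm_mat_sq)
  moreover have e: "(n / 8)\<^sup>2 = n\<^sup>2 / 64" "(n / 2)\<^sup>2 = n\<^sup>2 / 4"
    by (simp_all add: power_divide)
  ultimately have "(n / 2)\<^sup>2 \<le> (cmod (g$1$1))\<^sup>2" 
    using zero_le_power2[of n] unfolding e by linarith
  then have a: "n / 2 \<le> cmod (g$1$1)" by (rule power2_le_imp_le) simp
  have "trivial_bound l g \<le> (\<integral>\<^sup>+x. ennreal (64 / n\<^sup>2) * ennreal (cmod (fst x) ^ (2 * l)) +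
     ennreal ((1/4) ^ l) * ennreal (1 / (norm (act g x))\<^sup>2) \<partial>\<sigma>)"
    unfolding trivial_bound_def
  proof (rule nn_integral_mono_AE, use sphere in eventually_elim)
    fix x :: "complex \<times> complex" assume x: "norm x = 1"
    define z where "z = act g x"
    have "norm z \<noteq> 0" using norm_act_ge[OF g, of x] x by (auto simp: z_def)
    then have z: "norm z > 0" by simp
    have "(cmod (fst z) / norm z)\<^sup>2 \<le> 1" using z norm_fst_snd_le[of z] by (simp add: power_le_one)
    then have q1: "((cmod (fst z) / norm z)\<^sup>2) ^ l \<le> 1" by (simp add: power_le_one)
    have "(cmod (fst x) * cmod (fst z)) ^ (2 * l) / norm z ^ (2 * l + 2) \<le> 64 / n\<^sup>2 * cmod (fst x) ^ (2 * l) + (1/4) ^ l * (1 / (norm z)\<^sup>2)"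
    proof (cases "cmod (fst x) \<ge> 1/2")
      case True
      have "cmod (g$1$2) * cmod (snd x) \<le> n / 8 * 1"
        using b norm_fst_snd_le[of x] x by (intro mult_mono) (auto simp: n_def)
      moreover have "n / 2 * (1/2) \<le> cmod (g$1$1) * cmod (fst x)" using a True n by (intro mult_mono) auto
      moreover have "cmod (fst z) \<ge> cmod (g$1$1) * cmod (fst x) - cmod (g$1$2) * cmod (snd x)"
        using norm_diff_ineq[of "g$1$1 * fst x" "g$1$2 * snd x"] by (simp add: z_def act_def norm_mult)
      ultimately have "n / 8 \<le> norm z" using norm_fst_snd_le(1)[of z] by linarith
      then have "1 / (norm z)\<^sup>2 \<le> 1 / (n / 8)\<^sup>2" using n by (intro frac_le power_mono) auto
      also have "\<dots> = 64 / n\<^sup>2" by (simp add: power_divide)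
      finally have "(cmod (fst x))\<^sup>2 ^ l * ((cmod (fst z) / norm z)\<^sup>2) ^ l * (1 / (norm z)\<^sup>2) \<le> (cmod (fst x))\<^sup>2 ^ l * 1 * (64 / n\<^sup>2)"
        using q1 by (intro mult_mono mult_left_mono) auto
      then show ?thesis unfolding integrand_split by (simp add: mult_ac add_increasing2 flip: power_mult)
    next
      case False
      then have "(cmod (fst x))\<^sup>2 \<le> (1/2)\<^sup>2" by (intro power_mono) auto
      then have "((cmod (fst x))\<^sup>2) ^ l \<le> (1/4) ^ l" by (intro power_mono) (auto simp: power_divide)
      then have "(cmod (fst x))\<^sup>2 ^ l * ((cmod (fst z) / norm z)\<^sup>2) ^ l * (1 / (norm z)\<^sup>2) \<le> (1/4) ^ l * 1 * (1 / (norm z)\<^sup>2)"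
        using q1 by (intro mult_mono mult_right_mono) auto
      then show ?thesis unfolding integrand_split by (simp add: add_increasing)
    qed
    then have "ennreal ((cmod (fst x) * cmod (fst z)) ^ (2 * l) / norm z ^ (2 * l + 2)) \<le> ennreal (64 / n\<^sup>2 * cmod (fst x) ^ (2 * l) + (1/4) ^ l * (1 / (norm z)\<^sup>2))"
      by (rule ennreal_leI)
    also have "\<dots> = ennreal (64 / n\<^sup>2) * ennreal (cmod (fst x) ^ (2 * l)) + ennreal ((1/4) ^ l) * ennreal (1 / (norm z)\<^sup>2)"
      by (simp flip: ennreal_plus ennreal_mult)
    finally show "ennreal ((cmod (fst x) * cmod (fst (act g x))) ^ (2 * l) / norm (act g x) ^ (2 * l + 2)) \<le>
      ennreal (64 / n\<^sup>2) * ennreal (cmod (fst x) ^ (2 * l)) + ennreal ((1/4) ^ l) * ennreal (1 / (norm (act g x))\<^sup>2)"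
      by (simp add: z_def)
  qed
  also have "\<dots> = ennreal (64 / n\<^sup>2) * (\<integral>\<^sup>+x. ennreal (cmod (fst x) ^ (2 * l)) \<partial>\<sigma>) +
    ennreal ((1/4) ^ l) * (\<integral>\<^sup>+x. ennreal (1 / (norm (act g x))\<^sup>2) \<partial>\<sigma>)"
    by (subst nn_integral_add) (simp_all add: nn_integral_cmult)
  finally show ?thesis by (simp add: n_def)
qed

text \<open>If an off-diagonal entry is comparable to the norm, exponential decay holds for
  \<open>g\<close> or for its adjoint; either suffices for the coefficient. Otherwise one diagonal
  entry dominates, and if it is the lower one, passing to the inverse exchanges the diagonal entries
  without changing \<open>trivial_bound\<close>.\<close>

lemma trivial_bound_ctranspose_le:
  assumes \<eta>: "0 < \<eta>" "\<eta> \<le> 1"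
  obtains C where "C > 0" 
    "\<And>l g. l \<ge> 1 \<Longrightarrow> g \<in> SL2C \<Longrightarrow> trivial_bound l g \<le> ennreal (C / l * norm g powr (- 2 + \<eta>)) \<or> 
       trivial_bound l (ctranspose g) \<le> ennreal (C / l * norm g powr (- 2 + \<eta>))"
proof -
  obtain A where A: "A > 0"
    "\<And>g. g \<in> SL2C \<Longrightarrow> (\<integral>\<^sup>+x. ennreal (1 / (norm (act g x))\<^sup>2) \<partial>\<sigma>) \<le> ennreal (A * norm g powr (- 2 + \<eta>))"
    by (rule Xi_bound[OF \<eta>]) blast
  obtain B where B: "B > 0"
    "\<And>l::nat. l \<ge> 1 \<Longrightarrow> (\<integral>\<^sup>+x. ennreal (cmod (fst x) ^ (2 * l)) \<partial>\<sigma>) \<le> ennreal (B / l)"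
    by (rule moment_bound) blast
  \<comment> \<open>\<open>192 = 3 * 8^2\<close> is the constant in the exponent when an
    off-diagonal entry exceeds \<open>norm g / 8\<close>; there \<open>exp (- y) \<le> 1 / y\<close>
    with \<open>y = l / 192\<close> is used. The near-diagonal case needs
    \<open>64 * B + A\<close>.\<close>
  define C where "C = 192 * A + 64 * B"
  have far: "trivial_bound l g \<le> ennreal (C / l * norm g powr (- 2 + \<eta>))"
    if l: "l \<ge> 1" and g: "g \<in> SL2C" and c: "cmod (g$2$1) > norm g / 8" for l :: nat and g
  proof -
    have n: "norm g \<ge> 1" using norm_SL2C_ge(2)[OF g] .
    have "(norm g / 8)\<^sup>2 \<le> (cmod (g$2$1))\<^sup>2" using c n by (intro power_mono) auto
    moreover have "0 < 3 * (norm g)\<^sup>2" using n by (auto simp: SL2C_def)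
    ultimately have "1 / 192 \<le> (cmod (g$2$1))\<^sup>2 / (3 * (norm g)\<^sup>2)" 
      by (intro mult_imp_le_div_pos) (auto simp: power_divide)
    then have m: "real l * (1 / 192) \<le> l * ((cmod (g$2$1))\<^sup>2 / (3 * (norm g)\<^sup>2))" by (intro mult_left_mono) auto
    have "real l * (1 / 192) \<le> exp (real l * (1 / 192))" using exp_ge_add_one_self[of "real l * (1 / 192)"] by linarith
    then have "exp (- (real l * (1 / 192))) \<le> 192 / l" using l by (simp add: exp_minus field_simps)
    then have e: "exp (- (l * (cmod (g$2$1))\<^sup>2 / (3 * (norm g)\<^sup>2))) \<le> 192 / l"
      using m by (auto intro: order_trans[rotated])
    have "trivial_bound l g \<le> ennreal (192 / l) * ennreal (A * norm g powr (- 2 + \<eta>))"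
      by (intro order_trans[OF trivial_bound_decay[OF g]] mult_mono A(2)[OF g] ennreal_leI e) auto
    also have "\<dots> = ennreal (192 * A / l * norm g powr (- 2 + \<eta>))" using A(1) by (simp flip: ennreal_mult)
    also have "\<dots> \<le> ennreal (C / l * norm g powr (- 2 + \<eta>))"
      using B(1) by (intro ennreal_leI mult_right_mono divide_right_mono) (auto simp: C_def)
    finally show ?thesis .
  qed
  have near: "trivial_bound l g \<le> ennreal (C / l * norm g powr (- 2 + \<eta>))"
    if l: "l \<ge> 1" and g: "g \<in> SL2C" and h: "cmod (g$1$2) \<le> norm g / 8" "cmod (g$2$1) \<le> norm g / 8"
    and ad: "cmod (g$2$2) \<le> cmod (g$1$1)" for l :: nat and g
  proof -
    have n: "norm g \<ge> 1" using norm_SL2C_ge(2)[OF g] .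
    have "real l \<le> 4 ^ l"
    proof (induction l)
      case (Suc l)
      then show ?case using one_le_power[of "4::real" l] unfolding power_Suc of_nat_Suc by linarith
    qed simp
    then have l4: "(1/4) ^ l \<le> 1 / real l" using l by (simp add: power_divide field_simps)
    have n2: "64 / (norm g)\<^sup>2 \<le> 64 * norm g powr (- 2 + \<eta>)"
    proof -
      have "norm g > 0" using n by linarith
      then have "1 / (norm g)\<^sup>2 = norm g powr (- 2)" by (simp add: powr_neg_numeral)
      also have "\<dots> \<le> norm g powr (- 2 + \<eta>)" using n \<eta> by (intro powr_mono) auto
      finally show ?thesis by simp
    qed
    have "trivial_bound l g \<le> ennreal (64 * norm g powr (- 2 + \<eta>)) * ennreal (B / l) + ennreal (1 / l) * ennreal (A * norm g powr (- 2 + \<eta>))"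
      by (intro order_trans[OF trivial_bound_near_diagonal[OF g h ad]] add_mono mult_mono A(2)[OF g] B(2)[OF l] ennreal_leI n2 l4) auto
    also have "\<dots> = ennreal ((64 * B + A) / l * norm g powr (- 2 + \<eta>))"
      using A(1) B(1) by (simp add: algebra_simps add_divide_distrib flip: ennreal_mult ennreal_plus)
    also have "\<dots> \<le> ennreal (C / l * norm g powr (- 2 + \<eta>))"
      using A(1) by (intro ennreal_leI mult_right_mono divide_right_mono) (auto simp: C_def)
    finally show ?thesis .
  qed
  have "trivial_bound l g \<le> ennreal (C / l * norm g powr (- 2 + \<eta>)) \<or> trivial_bound l (ctranspose g) \<le> ennreal (C / l * norm g powr (- 2 + \<eta>))"
    if l: "l \<ge> 1" and g: "g \<in> SL2C" for l :: nat and g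
  proof (cases "cmod (g$2$1) > norm g / 8 \<or> cmod (g$1$2) > norm g / 8")
    case True
    moreover have "(ctranspose g)$2$1 = cnj (g$1$2)" by (simp add: ctranspose_def transpose_def)
    ultimately show ?thesis
      using far[OF l g] far[OF l ctranspose_SL2C[OF g]] by auto
  next
    case False
    show ?thesis
    proof (cases "cmod (g$2$2) \<le> cmod (g$1$1)")
      case True
      then show ?thesis using near[OF l g] False by auto
    next
      case ad: False
      have "trivial_bound l (adj2 g) \<le> ennreal (C / l * norm (adj2 g) powr (- 2 + \<eta>))"
      proof (rule near[OF l adj2_SL2C[OF g]])
        have e: "(adj2 g)$1$1 = g$2$2" "(adj2 g)$1$2 = - g$1$2" "(adj2 g)$2$1 = - g$2$1" "(adj2 g)$2$2 = g$1$1"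
          by (simp_all add: adj2_def)
        show "cmod ((adj2 g)$1$2) \<le> norm (adj2 g) / 8" "cmod ((adj2 g)$2$1) \<le> norm (adj2 g) / 8"
          "cmod ((adj2 g)$2$2) \<le> cmod ((adj2 g)$1$1)"
          using False ad unfolding e by auto
      qed
      then show ?thesis using trivial_bound_adj2[OF g] by simp
    qed
  qed
  with A(1) B(1) show ?thesis by (intro that[of C]) (auto simp: C_def)
qed

end

section \<open>Weight zero\<close>

text \<open>For unimodular \<open>\<zeta>\<close>, a unitary matrix taking the coordinate axis
  \<open>(1, 0)\<close> to the equatorial point \<open>(1, \<zeta>) / sqrt 2\<close>.\<close>

definition equator_rot :: "complex \<Rightarrow> complex^2^2" where
  "equator_rot \<zeta> = mat2 (1 / sqrt 2) (- cnj \<zeta> / sqrt 2) (\<zeta> / sqrt 2) (1 / sqrt 2)"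

lemma equator_rot_SU2:
  assumes "cmod \<zeta> = 1"
  shows "equator_rot \<zeta> \<in> SU2"
proof -
  have "(cmod (1 / complex_of_real (sqrt 2)))\<^sup>2 + (cmod (\<zeta> / complex_of_real (sqrt 2)))\<^sup>2 = 1"
    using assms by (simp add: norm_divide power_divide)
  from SU2_mat2'[OF this] show ?thesis by (simp add: equator_rot_def)
qed

lemma norm_mult_SU2:
  fixes g :: "complex^2^2"
  assumes "k \<in> SU2"
  shows "norm (k ** g) = norm g" "norm (g ** k) = norm g"
proof -
  have *: "norm (k ** g) = norm g" if "k \<in> SU2" for k g :: "complex^2^2"
  proof -
    have col: "(norm g)\<^sup>2 = (norm (g$1$1, g$2$1))\<^sup>2 + (norm (g$1$2, g$2$2))\<^sup>2" for g :: "complex^2^2"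
      by (simp add: norm_mat_sq norm_pair_sq)
    have e: "((k ** g)$1$j, (k ** g)$2$j) = act k (g$1$j, g$2$j)" for j
      by (simp add: act_def matrix_matrix_mult_def sum_2)
    have "(norm (k ** g))\<^sup>2 = (norm g)\<^sup>2"
      unfolding col[of "k ** g"] col[of g] e norm_act_SU2[OF that] ..
    then show ?thesis by simp
  qed
  show "norm (k ** g) = norm g" using *[OF assms] .
  have "norm (g ** k) = norm (ctranspose k ** ctranspose g)" by (simp flip: ctranspose_mult)
  then show "norm (g ** k) = norm g" by (simp add: * SU2_ctranspose[OF assms])
qed

lemma SL2C_mult: "g \<in> SL2C \<Longrightarrow> h \<in> SL2C \<Longrightarrow> g ** h \<in> SL2C"
  by (simp add: SL2C_def det_mul)

text \<open>Up to a unimodular factor, the two differences are the sum and the difference of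
  \<open>h$1$2\<close> and \<open>\<zeta> * cnj \<xi> * h$2$1\<close>. Thus a nearly diagonal
  \<open>h\<close> makes both of them small.\<close>

lemma equator_conj_entries:
  fixes g :: "complex^2^2"
  assumes \<zeta>: "cmod \<zeta> = 1" and \<xi>: "cmod \<xi> = 1"
  defines "h \<equiv> ctranspose (equator_rot \<xi>) ** g ** equator_rot (cnj \<zeta>)"
  shows "cmod (g$1$1 - cnj \<xi> * cnj \<zeta> * g$2$2) \<le> cmod (h$1$2) + cmod (h$2$1)"
    "cmod (g$1$2 - \<zeta> * cnj \<xi> * g$2$1) \<le> cmod (h$1$2) + cmod (h$2$1)"
proof -
  define a b c d where abcd: "a = g$1$1" "b = g$1$2" "c = g$2$1" "d = g$2$2"
  have s2: "complex_of_real (sqrt 2) * complex_of_real (sqrt 2) = 2"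
    by (simp flip: of_real_mult)
  have z1: "\<zeta> * cnj \<zeta> = 1" "\<xi> * cnj \<xi> = 1" using \<zeta> \<xi> by (simp_all add: complex_norm_square[symmetric] power2_eq_square)
  define r :: complex where "r = 1 / sqrt 2"
  have r2: "r * r = 1 / 2" using s2 by (simp add: r_def)
  have "ctranspose (equator_rot \<xi>) = mat2 r (cnj \<xi> * r) (- \<xi> * r) r"
    by (simp add: equator_rot_def ctranspose_def transpose_def vec_eq_iff forall_2 r_def)
  moreover have "equator_rot (cnj \<zeta>) = mat2 r (- \<zeta> * r) (cnj \<zeta> * r) r"
    by (simp add: equator_rot_def r_def)
  moreover have "g = mat2 a b c d" unfolding abcd by (rule mat2_eta)
  ultimately have h': "h = mat2 r (cnj \<xi> * r) (- \<xi> * r) r ** mat2 a b c d ** mat2 r (- \<zeta> * r) (cnj \<zeta> * r) r"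
    unfolding h_def by simp
  have "h$1$2 = (r * r) * ((b + cnj \<xi> * d) - \<zeta> * (a + cnj \<xi> * c))"
    "h$2$1 = (r * r) * ((c - \<xi> * a) + cnj \<zeta> * (d - \<xi> * b))"
    unfolding h' mat2_mult mat2_nth by (simp_all add: algebra_simps)
  then have h: "2 * h$1$2 = (b + cnj \<xi> * d) - \<zeta> * (a + cnj \<xi> * c)"
    "2 * h$2$1 = (c - \<xi> * a) + cnj \<zeta> * (d - \<xi> * b)"
    by (simp_all add: r2 mult.commute[of _ 2])
  have 1: "a - cnj \<xi> * cnj \<zeta> * d = - (cnj \<zeta> * (h$1$2) + cnj \<xi> * (h$2$1))"
  proof -
    have "2 * (cnj \<zeta> * (h$1$2) + cnj \<xi> * (h$2$1)) = cnj \<zeta> * (2 * h$1$2) + cnj \<xi> * (2 * h$2$1)"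
      by (simp add: algebra_simps)
    also have "\<dots> =
      cnj \<zeta> * b + cnj \<zeta> * cnj \<xi> * d - (\<zeta> * cnj \<zeta>) * a - (\<zeta> * cnj \<zeta>) * cnj \<xi> * c
      + cnj \<xi> * c - (\<xi> * cnj \<xi>) * a + cnj \<xi> * cnj \<zeta> * d - (\<xi> * cnj \<xi>) * cnj \<zeta> * b"
      unfolding h by (simp add: algebra_simps)
    also have "\<dots> = 2 * (cnj \<xi> * cnj \<zeta> * d - a)" unfolding z1 by (simp add: algebra_simps)
    finally have "cnj \<zeta> * (h$1$2) + cnj \<xi> * (h$2$1) = cnj \<xi> * cnj \<zeta> * d - a"
      unfolding mult_cancel_left by simp
    then show ?thesis by simp
  qed
  have 2: "b - \<zeta> * cnj \<xi> * c = h$1$2 - \<zeta> * cnj \<xi> * (h$2$1)"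
  proof -
    have "2 * (h$1$2 - \<zeta> * cnj \<xi> * (h$2$1)) = 2 * h$1$2 - \<zeta> * cnj \<xi> * (2 * h$2$1)"
      by (simp add: algebra_simps)
    also have "\<dots> =
      b + cnj \<xi> * d - \<zeta> * a - \<zeta> * cnj \<xi> * c - \<zeta> * cnj \<xi> * c + (\<xi> * cnj \<xi>) * \<zeta> * a - (\<zeta> * cnj \<zeta>) * cnj \<xi> * d + (\<zeta> * cnj \<zeta>) * (\<xi> * cnj \<xi>) * b"
      unfolding h by (simp add: algebra_simps)
    also have "\<dots> = 2 * (b - \<zeta> * cnj \<xi> * c)" unfolding z1 by (simp add: algebra_simps)
    finally show ?thesis unfolding mult_cancel_left by simp
  qed
  have "cmod (a - cnj \<xi> * cnj \<zeta> * d) \<le> cmod (cnj \<zeta> * (h$1$2)) + cmod (cnj \<xi> * (h$2$1))"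
    unfolding 1 norm_minus_cancel by (rule norm_triangle_ineq)
  then show "cmod (g$1$1 - cnj \<xi> * cnj \<zeta> * g$2$2) \<le> cmod (h$1$2) + cmod (h$2$1)"
    by (simp add: norm_mult \<zeta> \<xi> abcd)
  have "cmod (b - \<zeta> * cnj \<xi> * c) \<le> cmod (h$1$2) + cmod (\<zeta> * cnj \<xi> * (h$2$1))"
    unfolding 2 by (rule norm_triangle_ineq4)
  then show "cmod (g$1$2 - \<zeta> * cnj \<xi> * g$2$1) \<le> cmod (h$1$2) + cmod (h$2$1)"
    by (simp add: norm_mult \<zeta> \<xi> abcd)
qed

context spherical begin

text \<open>The second bound is where the functional equation enters. Together the two bounds see
  both off-diagonal entries.\<close>

lemma norm_coef_le:
  assumes g: "g \<in> SL2C"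
  shows "ennreal (norm (coef 0 g)) \<le> trivial_bound l g"
    "ennreal (norm (coef 0 g)) \<le> trivial_bound l (ctranspose g)"
proof -
  have le: "ennreal (norm (LINT x|\<sigma>. P x ^ (2 * l) * X (norm (act g x)))) \<le> trivial_bound l g"
    if g: "g \<in> SL2C" and P [measurable]: "P \<in> borel_measurable borel" and n: "\<And>x. norm (P x) = cmod (fst x) * cmod (fst (act g x))"
    for g and P :: "complex \<times> complex \<Rightarrow> complex"
  proof -
    have "integrable \<sigma> (\<lambda>x. P x ^ (2 * l) * X (norm (act g x)))"
    proof (rule integrable_X[OF g])
      fix x :: "complex \<times> complex" assume "norm x = 1"
      then have "norm (P x) \<le> 1 * norm (act g x)"
        unfolding n using norm_fst_snd_le(1)[of x] norm_fst_snd_le(1)[of "act g x"] by (intro mult_mono) auto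
      then show "norm (P x ^ (2 * l)) \<le> norm (act g x) ^ (2 * l)" by (simp add: norm_power power_mono)
    qed measurable
    then have "ennreal (norm (LINT x|\<sigma>. P x ^ (2 * l) * X (norm (act g x)))) \<le> (\<integral>\<^sup>+x. ennreal (norm (P x ^ (2 * l) * X (norm (act g x)))) \<partial>\<sigma>)"
      by (rule integral_norm_bound_ennreal)
    also have "\<dots> = trivial_bound l g"
      unfolding trivial_bound_def
    proof (rule nn_integral_cong_AE, use sphere in eventually_elim)
      fix x :: "complex \<times> complex" assume x: "norm x = 1"
      have "norm (act g x) \<noteq> 0" using norm_act_ge[OF g, of x] x by auto
      then have "norm (act g x) > 0" by simp
      then show "ennreal (norm (P x ^ (2 * l) * X (norm (act g x)))) =
          ennreal ((cmod (fst x) * cmod (fst (act g x))) ^ (2 * l) / norm (act g x) ^ (2 * l + 2))"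
        by (simp add: norm_mult norm_power n norm_X)
    qed
    finally show ?thesis .
  qed
  show "ennreal (norm (coef 0 g)) \<le> trivial_bound l g"
    using le[OF g, of "\<lambda>x. cnj (fst (act g x)) * fst x"] by (simp add: coef_def norm_mult mult.commute)
  show "ennreal (norm (coef 0 g)) \<le> trivial_bound l (ctranspose g)"
    unfolding coef_eq_coef'[OF g le0]
    using le[OF ctranspose_SL2C[OF g], of "\<lambda>x. fst (act (ctranspose g) x) * cnj (fst x)"] by (simp add: coef'_def norm_mult mult.commute)
qed

text \<open>Unitary factors on either side change only the two linear forms raised to the power
  \<open>2 * l\<close>, not the argument of \<open>X\<close>. Expanding these forms then relates
  extreme coefficients of rotated matrices to all weights of \<open>g\<close>.\<close>

lemma coef_0_conj:
  assumes k: "k \<in> SU2" and k': "k' \<in> SU2"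
  shows "coef 0 (ctranspose k' ** g ** k) = 
    (LINT x|\<sigma>. (cnj (fst (act (ctranspose k') (act g x))) * fst (act (ctranspose k) x)) ^ (2 * l) * X (norm (act g x)))"
proof -
  define F where "F x = (cnj (fst (act (ctranspose k') (act g x))) * fst (act (ctranspose k) x)) ^ (2 * l) * X (norm (act g x))" for x
  have [measurable]: "F \<in> borel_measurable borel" unfolding F_def by measurable
  have "act (ctranspose k) (act k x) = x" for x
    by (simp add: SU2_cancel[OF k] flip: act_mult)
  then have "coef 0 (ctranspose k' ** g ** k) = (LINT x|\<sigma>. F (act k x))"
    by (simp add: coef_def F_def act_mult norm_act_SU2 SU2_ctranspose[OF k'])
  also have "\<dots> = (LINT x|\<sigma>. F x)" by (rule integral_SU2[OF k]) measurable
  finally show ?thesis by (simp add: F_def)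
qed

lemma coef_top:
  assumes g: "g \<in> SL2C"
  shows "coef (2 * l) g = coef 0 (mat2 (g$2$2) (- g$2$1) (- g$1$2) (g$1$1))"
proof -
  define w where "w = mat2 0 (-1) 1 0"
  have w: "w \<in> SU2" using SU2_mat2[of 0 "-1"] by (simp add: w_def)
  have cw: "ctranspose w = mat2 0 1 (-1) 0" by (simp add: w_def ctranspose_def transpose_def vec_eq_iff forall_2)
  have "ctranspose w ** g ** w = mat2 (g$2$2) (- g$2$1) (- g$1$2) (g$1$1)"
    unfolding cw by (subst (1) mat2_eta[of g]) (simp add: w_def mat2_mult)
  then show ?thesis
    using coef_0_conj[OF w w, of g] by (simp add: coef_def cw act_mat2)
qed

text \<open>The factor \<open>4 ^ l\<close> clears the two denominators \<open>sqrt 2\<close>. The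
  conjugate of \<open>\<zeta>\<close> on the left makes the right side a polynomial in
  \<open>\<xi>\<close> and \<open>\<zeta>\<close> themselves, with a matrix coefficient between two
  weight vectors at each monomial.\<close>

lemma coef_0_equator:
  assumes g: "g \<in> SL2C" and \<zeta>: "cmod \<zeta> = 1" and \<xi>: "cmod \<xi> = 1"
  shows "4 ^ l * coef 0 (ctranspose (equator_rot \<xi>) ** g ** equator_rot (cnj \<zeta>)) =
    (\<Sum>i\<le>2 * l. \<Sum>j\<le>2 * l. of_nat (2 * l choose i) * of_nat (2 * l choose j) * (\<xi> ^ i * \<zeta> ^ j) *
      (LINT x|\<sigma>. cnj (fst (act g x)) ^ (2 * l - i) * cnj (snd (act g x)) ^ i * (fst x ^ (2 * l - j) * snd x ^ j) * X (norm (act g x))))"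
proof -
  define Q where "Q i j x = cnj (fst (act g x)) ^ (2 * l - i) * cnj (snd (act g x)) ^ i * (fst x ^ (2 * l - j) * snd x ^ j)" for i j x
  have int: "integrable \<sigma> (\<lambda>x. Q i j x * X (norm (act g x)))" if "i \<le> 2 * l" "j \<le> 2 * l" for i j
  proof (rule integrable_X[OF g])
    show "Q i j \<in> borel_measurable borel" unfolding Q_def by measurable
    fix x :: "complex \<times> complex" assume x: "norm x = 1"
    have "norm (Q i j x) \<le> (norm (act g x) ^ (2 * l - i) * norm (act g x) ^ i) * (norm x ^ (2 * l - j) * norm x ^ j)"
      unfolding Q_def norm_mult norm_power complex_mod_cnj
      by (intro mult_mono power_mono norm_fst_snd_le) auto
    also have "\<dots> = norm (act g x) ^ (2 * l)" using that x by (simp flip: power_add)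
    finally show "norm (Q i j x) \<le> norm (act g x) ^ (2 * l)" .
  qed
  have k: "equator_rot (cnj \<zeta>) \<in> SU2" "equator_rot \<xi> \<in> SU2" using \<zeta> \<xi> by (auto intro: equator_rot_SU2)
  have ck: "fst (act (ctranspose (equator_rot \<xi>)) y) = (fst y + cnj \<xi> * snd y) / sqrt 2" for \<xi> y
    by (simp add: equator_rot_def ctranspose_def transpose_def act_def add_divide_distrib)
  have s2: "complex_of_real (sqrt 2) * complex_of_real (sqrt 2) = 2" by (simp flip: of_real_mult)
  have half: "(p / sqrt 2) * (q / sqrt 2) = (p * q) / 2" for p q :: complex
    by (simp add: s2)
  have four: "4 ^ l * (p / 2) ^ (2 * l) = p ^ (2 * l)" for p :: complex
    by (simp add: power_divide power_mult)
  have expand: "(p + \<xi> * q) ^ (2 * l) = (\<Sum>i\<le>2 * l. of_nat (2 * l choose i) * \<xi> ^ i * (p ^ (2 * l - i) * q ^ i))" for p q \<xi> :: complex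
    using binomial_ring[of "\<xi> * q" p "2 * l"] by (simp add: add.commute power_mult_distrib mult_ac)
  have "4 ^ l * coef 0 (ctranspose (equator_rot \<xi>) ** g ** equator_rot (cnj \<zeta>)) = 
    (LINT x|\<sigma>. 4 ^ l * ((cnj ((fst (act g x) + cnj \<xi> * snd (act g x)) / sqrt 2) * ((fst x + \<zeta> * snd x) / sqrt 2)) ^ (2 * l) * X (norm (act g x))))"
    unfolding coef_0_conj[OF k] by (simp add: ck)
  also have "\<dots> = (LINT x|\<sigma>. (\<Sum>i\<le>2 * l. \<Sum>j\<le>2 * l. of_nat (2 * l choose i) * of_nat (2 * l choose j) * (\<xi> ^ i * \<zeta> ^ j) * (Q i j x * X (norm (act g x)))))"
  proof (intro Bochner_Integration.integral_cong refl)
    fix x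
    define z where "z = act g x"
    have "4 ^ l * (cnj ((fst z + cnj \<xi> * snd z) / sqrt 2) * ((fst x + \<zeta> * snd x) / sqrt 2)) ^ (2 * l) =
        ((cnj (fst z) + \<xi> * cnj (snd z)) * (fst x + \<zeta> * snd x)) ^ (2 * l)"
      unfolding complex_cnj_divide complex_cnj_complex_of_real half four by simp
    also have "\<dots> = (\<Sum>i\<le>2 * l. \<Sum>j\<le>2 * l. of_nat (2 * l choose i) * of_nat (2 * l choose j) * (\<xi> ^ i * \<zeta> ^ j) * Q i j x)"
      unfolding power_mult_distrib expand sum_product z_def Q_def by (intro sum.cong refl) (simp only: mult_ac)
    finally show "4 ^ l * ((cnj ((fst (act g x) + cnj \<xi> * snd (act g x)) / sqrt 2) * ((fst x + \<zeta> * snd x) / sqrt 2)) ^ (2 * l) * X (norm (act g x))) =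
        (\<Sum>i\<le>2 * l. \<Sum>j\<le>2 * l. of_nat (2 * l choose i) * of_nat (2 * l choose j) * (\<xi> ^ i * \<zeta> ^ j) * (Q i j x * X (norm (act g x))))"
      unfolding z_def by (simp add: sum_distrib_right mult.assoc[symmetric])
  qed
  also have "\<dots> = (\<Sum>i\<le>2 * l. \<Sum>j\<le>2 * l. of_nat (2 * l choose i) * of_nat (2 * l choose j) * (\<xi> ^ i * \<zeta> ^ j) *
      (LINT x|\<sigma>. Q i j x * X (norm (act g x))))"
    using int by (subst Bochner_Integration.integral_sum; (subst Bochner_Integration.integral_sum)?) 
       (auto intro!: sum.cong Bochner_Integration.integrable_sum)
  finally show ?thesis by (simp add: Q_def)
qed

end

section \<open>Measure of arcs and the central binomial coefficient\<close>

text \<open>A weak form of Jordan's inequality: \<open>|sin y - y| \<le> |y|^3 / 6\<close>, and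
  \<open>|y| \<le> 2\<close> here.\<close>

lemma abs_sin_ge:
  assumes "\<bar>y\<bar> \<le> pi / 2"
  shows "\<bar>y\<bar> / 3 \<le> \<bar>sin y\<bar>"
proof -
  have "\<bar>sin y - (\<Sum>m<3. sin_coeff m * y ^ m)\<bar> \<le> inverse (fact 3) * \<bar>y\<bar> ^ 3"
    by (rule Maclaurin_sin_bound)
  moreover have "(\<Sum>m<3. sin_coeff m * y ^ m) = y"
    by (simp add: sin_coeff_def lessThan_Suc eval_nat_numeral)
  moreover have "\<bar>y\<bar> ^ 3 \<le> 4 * \<bar>y\<bar>"
  proof -
    have "\<bar>y\<bar> \<le> 2" using assms pi_less_4 by linarith
    then have "\<bar>y\<bar> * \<bar>y\<bar> \<le> 2 * 2" by (intro mult_mono) auto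
    then have "\<bar>y\<bar> * \<bar>y\<bar> * \<bar>y\<bar> \<le> 4 * \<bar>y\<bar>" by (intro mult_right_mono) auto
    then show ?thesis by (simp add: power3_eq_cube)
  qed
  ultimately have "\<bar>sin y - y\<bar> \<le> inverse (fact 3) * (4 * \<bar>y\<bar>)"
    by (metis (no_types, lifting) inverse_nonnegative_iff_nonnegative fact_ge_zero mult_left_mono order_trans)
  then have "\<bar>sin y - y\<bar> \<le> 2/3 * \<bar>y\<bar>" by (simp add: fact_numeral)
  then show ?thesis by linarith
qed

lemma norm_cis_diff: "cmod (cis x - cis y) = 2 * \<bar>sin ((x - y) / 2)\<bar>"
proof -
  have "(cmod (cis x - cis y))\<^sup>2 = ((cos x)\<^sup>2 + (sin x)\<^sup>2) + ((cos y)\<^sup>2 + (sin y)\<^sup>2) - 2 * (cos x * cos y + sin x * sin y)"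
    unfolding cmod_power2 by (simp add: power2_eq_square algebra_simps)
  also have "\<dots> = 2 - 2 * cos (x - y)" by (simp add: cos_diff)
  also have "cos (x - y) = 1 - 2 * (sin ((x - y) / 2))\<^sup>2"
  proof -
    have "2 * ((x - y) / 2) = x - y" by simp
    then show ?thesis using cos_double_sin[of "(x - y) / 2"] by (simp only:)
  qed
  finally have "(cmod (cis x - cis y))\<^sup>2 = (2 * \<bar>sin ((x - y) / 2)\<bar>)\<^sup>2" by (simp add: power_mult_distrib)
  then show ?thesis by (rule power2_eq_imp_eq) auto
qed

definition period :: "real measure" where
  "period = restrict_space lborel {0..2 * pi}"

lemma sets_period [measurable_cong]: "sets period = sets (restrict_space borel {0..2 * pi})"
  by (simp add: period_def sets_restrict_space)

lemma space_period: "space period = {0..2 * pi}"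
  by (simp add: period_def space_restrict_space)

lemma emeasure_period_space: "emeasure period {0..2 * pi} = ennreal (2 * pi)"
  by (simp add: period_def emeasure_restrict_space)

lemma emeasure_period_le: "emeasure period A \<le> ennreal (2 * pi)"
  using emeasure_space[of period A] by (simp add: space_period emeasure_period_space)

lemma finite_measure_period: "finite_measure period"
  by (rule finite_measureI) (simp add: space_period emeasure_period_space)

lemma measurable_period [simp]: "f \<in> borel_measurable borel \<Longrightarrow> f \<in> borel_measurable period"
  by (simp add: measurable_restrict_space1 cong: measurable_cong_sets[OF sets_period refl])

lemma integral_period_cis: "(LINT r|period. cis (real_of_int n * r)) = (if n = 0 then of_real (2 * pi) else 0)"
proof -
  have "continuous_on {0..2 * pi} (\<lambda>r. cis (real_of_int n * r))"
    by (intro continuous_intros)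
  then have "set_integrable lborel {0..2 * pi} (\<lambda>r. cis (real_of_int n * r))"
    by (intro borel_integrable_atLeastAtMost') auto
  then have "(LINT r:{0..2 * pi}|lborel. cis (real_of_int n * r)) = integral {0..2 * pi} (\<lambda>r. cis (real_of_int n * r))"
    by (rule set_borel_integral_eq_integral)
  also have "\<dots> = (if n = 0 then of_real (2 * pi) else 0)"
    by (rule integral_unique[OF has_integral_cis])
  finally show ?thesis
    unfolding period_def by (subst integral_restrict_space) (auto simp: set_lebesgue_integral_def)
qed

lemma integrable_period_cis: "integrable period (\<lambda>r. cis (real_of_int n * r))"
proof -
  interpret finite_measure period by (rule finite_measure_period)
  have "(\<lambda>r. cis (real_of_int n * r)) \<in> borel_measurable borel"
    by (intro borel_measurable_continuous_onI continuous_intros)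
  then show ?thesis by (intro integrable_const_bound[where B = 1]) auto
qed

text \<open>Relative to one solution \<open>r0\<close>, every solution satisfies
  \<open>|sin (r - r0)| \<le> \<kappa>\<close> with \<open>\<kappa> = \<eta> / |d|\<close>, hence
  lies within \<open>3 * \<kappa>\<close> of \<open>r0 + j * pi\<close> for an integer
  \<open>j\<close>. At most the five values from -2 to 2 matter, whence \<open>30 = 5 * 6\<close>.
  The sign \<open>s\<close> serves both angles.\<close>

lemma arc_measure:
  assumes d: "d \<noteq> 0" and s: "\<bar>s\<bar> = 1" and \<eta>: "\<eta> \<ge> 0"
  shows "emeasure period {r \<in> {0..2 * pi}. cmod (a - cis (2 * s * r) * d) \<le> \<eta>} \<le> ennreal (30 * (\<eta> / cmod d))"
proof (cases "{r \<in> {0..2 * pi}. cmod (a - cis (2 * s * r) * d) \<le> \<eta>} = {}")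
  case True
  show ?thesis unfolding True by simp
next
  case False
  then obtain r0 where r0: "r0 \<in> {0..2 * pi}" "cmod (a - cis (2 * s * r0) * d) \<le> \<eta>" by auto
  define \<kappa> where "\<kappa> = \<eta> / cmod d"
  have \<kappa>: "\<kappa> \<ge> 0" using \<eta> by (simp add: \<kappa>_def)
  define I where "I j = {r0 + real_of_int j * pi - 3 * \<kappa> .. r0 + real_of_int j * pi + 3 * \<kappa>}" for j
  have sub: "{r \<in> {0..2 * pi}. cmod (a - cis (2 * s * r) * d) \<le> \<eta>} \<subseteq> (\<Union>j\<in>{-2..2}. I j \<inter> {0..2 * pi})"
  proof
    fix r assume r: "r \<in> {r \<in> {0..2 * pi}. cmod (a - cis (2 * s * r) * d) \<le> \<eta>}"
    have "cmod (cis (2 * s * r) - cis (2 * s * r0)) * cmod d = cmod ((a - cis (2 * s * r0) * d) - (a - cis (2 * s * r) * d))"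
      by (simp add: algebra_simps flip: norm_mult)
    also have "\<dots> \<le> \<eta> + \<eta>"
      using norm_triangle_ineq4[of "a - cis (2 * s * r0) * d" "a - cis (2 * s * r) * d"] r r0 by auto
    finally have "cmod (cis (2 * s * r) - cis (2 * s * r0)) \<le> 2 * \<kappa>"
      using d by (simp add: \<kappa>_def field_simps)
    moreover have "\<bar>sin (s * (r - r0))\<bar> = \<bar>sin (r - r0)\<bar>"
    proof -
      consider "s = 1" | "s = -1" using s by linarith
      then show ?thesis using sin_minus[of "r - r0"] by cases auto
    qed
    moreover have "(2 * s * r - 2 * s * r0) / 2 = s * (r - r0)" by (simp add: field_simps)
    ultimately have sin: "\<bar>sin (r - r0)\<bar> \<le> \<kappa>" unfolding norm_cis_diff by simp
    define j where "j = round ((r - r0) / pi)"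
    have j: "\<bar>real_of_int j - (r - r0) / pi\<bar> \<le> 1/2" unfolding j_def by (rule of_int_round_abs_le)
    have "\<bar>(r - r0) / pi\<bar> \<le> 2" using r r0 by (auto simp: abs_le_iff field_simps)
    with j have "real_of_int j < 3" "- 3 < real_of_int j" by linarith+
    then have j2: "j \<in> {-2..2}" by simp
    define y where "y = r - r0 - real_of_int j * pi"
    have "\<bar>real_of_int j - (r - r0) / pi\<bar> * pi \<le> 1/2 * pi" using j by (intro mult_right_mono) auto
    also have "\<bar>real_of_int j - (r - r0) / pi\<bar> * pi = \<bar>(real_of_int j - (r - r0) / pi) * pi\<bar>" by (simp add: abs_mult)
    also have "(real_of_int j - (r - r0) / pi) * pi = - y" by (simp add: y_def field_simps)
    finally have "\<bar>y\<bar> \<le> pi / 2" by simp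
    then have "\<bar>y\<bar> / 3 \<le> \<bar>sin y\<bar>" by (rule abs_sin_ge)
    also have "\<bar>sin y\<bar> = \<bar>sin (r - r0)\<bar>"
    proof -
      have "sin (real_of_int j * pi) = 0" by (auto simp: sin_zero_iff_int2)
      moreover from this have "\<bar>cos (real_of_int j * pi)\<bar> = 1"
        using sin_cos_squared_add[of "real_of_int j * pi"] by (simp add: abs_square_eq_1)
      ultimately show ?thesis by (simp add: y_def sin_diff abs_mult)
    qed
    finally have "\<bar>y\<bar> \<le> 3 * \<kappa>" using sin by simp
    then have "r \<in> I j" by (auto simp: I_def y_def)
    with j2 r show "r \<in> (\<Union>j\<in>{-2..2}. I j \<inter> {0..2 * pi})" by auto
  qed
  have sI: "I j \<inter> {0..2 * pi} \<in> sets period" for j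
    unfolding sets_period by (auto simp: sets_restrict_space I_def)
  have "emeasure period {r \<in> {0..2 * pi}. cmod (a - cis (2 * s * r) * d) \<le> \<eta>} \<le> emeasure period (\<Union>j\<in>{-2..2}. I j \<inter> {0..2 * pi})"
    by (rule emeasure_mono[OF sub]) (intro sets.finite_UN sI; simp)
  also have "\<dots> \<le> (\<Sum>j\<in>{-2..2}. emeasure period (I j \<inter> {0..2 * pi}))"
    by (rule emeasure_subadditive_finite) (use sI in auto)
  also have "\<dots> \<le> (\<Sum>j\<in>{-2..2::int}. ennreal (6 * \<kappa>))"
  proof (rule sum_mono)
    fix j :: int
    have "emeasure period (I j \<inter> {0..2 * pi}) = emeasure lborel (I j \<inter> {0..2 * pi})"
      by (simp add: period_def emeasure_restrict_space)
    also have "\<dots> \<le> emeasure lborel (I j)" by (rule emeasure_mono) (auto simp: I_def)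
    also have "\<dots> = ennreal (6 * \<kappa>)" using \<kappa> by (simp add: I_def)
    finally show "emeasure period (I j \<inter> {0..2 * pi}) \<le> ennreal (6 * \<kappa>)" .
  qed
  also have "\<dots> = ennreal (\<Sum>j\<in>{-2..2::int}. 6 * \<kappa>)" by (rule sum_ennreal) (use \<kappa> in simp)
  also have "\<dots> = ennreal (30 * \<kappa>)" by simp
  finally show ?thesis by (simp add: \<kappa>_def)
qed

text \<open>The squared inequality can be proved by induction without roots: it is an equality at
  \<open>l = 1\<close>, and the step reduces to
  \<open>4 * l * (l + 1) \<le> (2 * l + 1)^2\<close>.\<close>

lemma central_binomial_sqrt_bound:
  assumes "l \<ge> 1"
  shows "4 ^ l \<le> 2 * sqrt (real l) * real (2 * l choose l)"
proof -
  have bound: "16 ^ l \<le> 4 * real l * (real (2 * l choose l))\<^sup>2"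
    using assms
  proof (induction l rule: dec_induct)
    case base
    then show ?case by (simp add: numeral_2_eq_2)
  next
    case (step l)
    define c where "c = real (2 * l choose l)"
    have c': "(real l + 1) * real (2 * Suc l choose Suc l) = 2 * (2 * real l + 1) * c"
    proof -
      have "Suc l * (2 * Suc l choose Suc l) = (2 * Suc l) * (Suc (2 * l) choose l)"
        using Suc_times_binomial[of l "Suc (2 * l)"] by (simp del: binomial_Suc_Suc)
      moreover have "Suc l * (Suc (2 * l) choose l) = Suc (2 * l) * (2 * l choose l)"
      proof -
        have "Suc (2 * l) choose l = Suc (2 * l) choose Suc l"
          using binomial_symmetric[of l "Suc (2 * l)"] by simp
        then show ?thesis using Suc_times_binomial[of l "2 * l"] by simp
      qed
      ultimately have "Suc l * (Suc l * (2 * Suc l choose Suc l)) = 2 * Suc l * (Suc (2 * l) * (2 * l choose l))"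
        by (metis mult.left_commute mult.assoc)
      then have "Suc l * (2 * Suc l choose Suc l) = 2 * (Suc (2 * l) * (2 * l choose l))"
        by (metis (no_types, lifting) mult.assoc mult.left_commute mult_cancel1 nat.distinct(1))
      then have "real (Suc l * (2 * Suc l choose Suc l)) = real (2 * (Suc (2 * l) * (2 * l choose l)))"
        by (rule arg_cong)
      then show ?thesis unfolding of_nat_mult c_def by (simp add: add.commute del: binomial_Suc_Suc mult_Suc_right)
    qed
    have "16 ^ Suc l * (real l + 1) \<le> 16 * (4 * real l * c\<^sup>2) * (real l + 1)"
      using step.IH by (simp add: c_def)
    also have "\<dots> \<le> 4 * (2 * (2 * real l + 1) * c)\<^sup>2"
      by (simp add: power2_eq_square algebra_simps)
    also have "\<dots> = 4 * (real l + 1) * (real (2 * Suc l choose Suc l))\<^sup>2 * (real l + 1)"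
      unfolding c'[symmetric] by (simp add: power2_eq_square algebra_simps)
    finally have "16 ^ Suc l \<le> 4 * (real l + 1) * (real (2 * Suc l choose Suc l))\<^sup>2"
      by (rule mult_right_le_imp_le) simp
    then show ?case by (simp only: of_nat_Suc add.commute)
  qed
  have "(4 ^ l :: real)\<^sup>2 = 16 ^ l" by (simp add: power2_eq_square flip: power_mult_distrib)
  with bound have "(4 ^ l)\<^sup>2 \<le> (2 * sqrt (real l) * real (2 * l choose l))\<^sup>2"
    by (simp add: power_mult_distrib)
  then show ?thesis by (rule power2_le_imp_le) simp
qed

context spherical begin

definition equator_conj :: "complex^2^2 \<Rightarrow> real \<Rightarrow> real \<Rightarrow> complex^2^2" where
  "equator_conj g \<alpha> \<beta> = ctranspose (equator_rot (cis (\<alpha> - \<beta>))) ** g ** equator_rot (cnj (cis (\<alpha> + \<beta>)))"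

text \<open>The zonal vector is an average of extreme weight vectors along the equator. With the
  parameters \<open>\<alpha> \<plusminus> \<beta>\<close> the conditions on \<open>\<alpha>\<close> and on \<open>\<beta>\<close> separate.\<close>

lemma coef_middle_le:
  assumes g: "g \<in> SL2C"
  shows "ennreal (4 * pi\<^sup>2 * ((real (2 * l choose l))\<^sup>2 * norm (coef l g))) \<le> 
    (\<integral>\<^sup>+\<alpha>. \<integral>\<^sup>+\<beta>. ennreal (4 ^ l * norm (coef 0 (equator_conj g \<alpha> \<beta>))) \<partial>period \<partial>period)"
proof -
  define m where "m i j = of_nat (2 * l choose i) * of_nat (2 * l choose j) * 
      (LINT x|\<sigma>. cnj (fst (act g x)) ^ (2 * l - i) * cnj (snd (act g x)) ^ i * (fst x ^ (2 * l - j) * snd x ^ j) * X (norm (act g x)))" for i j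
  have mll: "m l l = (of_nat (2 * l choose l))\<^sup>2 * coef l g"
    by (simp add: m_def coef_def power2_eq_square power_mult_distrib mult_ac)
  \<comment> \<open>Integration over \<open>\<beta>\<close> keeps the terms with
    \<open>i = j\<close>; the extra character in \<open>\<alpha>\<close> then keeps
    \<open>i + j = 2 * l\<close>. Only \<open>i = j = l\<close> survives both.\<close>
  define G where "G \<alpha> \<beta> = 4 ^ l * coef 0 (equator_conj g \<alpha> \<beta>) * cis (real_of_int (- 2 * int l) * \<alpha>)" for \<alpha> \<beta>
  have G: "G \<alpha> \<beta> = (\<Sum>i\<le>2 * l. \<Sum>j\<le>2 * l. (m i j * cis (real_of_int (int i + int j - 2 * int l) * \<alpha>)) * cis (real_of_int (int j - int i) * \<beta>))" for \<alpha> \<beta>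
  proof -
    have "4 ^ l * coef 0 (equator_conj g \<alpha> \<beta>) = (\<Sum>i\<le>2 * l. \<Sum>j\<le>2 * l. m i j * (cis (\<alpha> - \<beta>) ^ i * cis (\<alpha> + \<beta>) ^ j))"
      unfolding equator_conj_def m_def using coef_0_equator[OF g, of "cis (\<alpha> + \<beta>)" "cis (\<alpha> - \<beta>)"] by (simp add: mult_ac)
    moreover have "cis (\<alpha> - \<beta>) ^ i * cis (\<alpha> + \<beta>) ^ j * cis (real_of_int (- 2 * int l) * \<alpha>) =
      cis (real_of_int (int i + int j - 2 * int l) * \<alpha>) * cis (real_of_int (int j - int i) * \<beta>)" for i j
      unfolding Complex.DeMoivre cis_mult by (rule arg_cong[where f = cis]) (simp add: algebra_simps)
    ultimately show ?thesis unfolding G_def by (simp add: sum_distrib_right mult.assoc)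
  qed
  have int\<beta>: "integrable period (\<lambda>\<beta>. G \<alpha> \<beta>)" for \<alpha>
    unfolding G by (intro Bochner_Integration.integrable_sum integrable_mult_right integrable_period_cis)
  have I1: "(LINT \<beta>|period. G \<alpha> \<beta>) = (\<Sum>i\<le>2 * l. 2 * pi * m i i * cis (real_of_int (2 * int i - 2 * int l) * \<alpha>))" for \<alpha>
  proof -
    have "(LINT \<beta>|period. G \<alpha> \<beta>) = (\<Sum>i\<le>2 * l. \<Sum>j\<le>2 * l. (m i j * cis (real_of_int (int i + int j - 2 * int l) * \<alpha>)) * 
        (LINT \<beta>|period. cis (real_of_int (int j - int i) * \<beta>)))"
      unfolding G
    proof (subst Bochner_Integration.integral_sum, goal_cases)
      case 2
      show ?case
      proof (intro sum.cong refl, subst Bochner_Integration.integral_sum, goal_cases)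
        case 2
        show ?case by (intro sum.cong refl integral_mult_right_zero)
      qed (intro integrable_mult_right integrable_period_cis)
    qed (intro Bochner_Integration.integrable_sum integrable_mult_right integrable_period_cis)
    also have "\<dots> = (\<Sum>i\<le>2 * l. \<Sum>j\<le>2 * l. (if j = i then 2 * pi * m i i * cis (real_of_int (2 * int i - 2 * int l) * \<alpha>) else 0))"
      unfolding integral_period_cis by (intro sum.cong refl) auto
    also have "\<dots> = (\<Sum>i\<le>2 * l. 2 * pi * m i i * cis (real_of_int (2 * int i - 2 * int l) * \<alpha>))"
      by (intro sum.cong refl) simp
    finally show ?thesis .
  qed
  have int\<alpha>: "integrable period (\<lambda>\<alpha>. LINT \<beta>|period. G \<alpha> \<beta>)"
    unfolding I1 by (intro Bochner_Integration.integrable_sum integrable_mult_right integrable_period_cis)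
  have "(LINT \<alpha>|period. LINT \<beta>|period. G \<alpha> \<beta>) = (\<Sum>i\<le>2 * l. 2 * pi * m i i * (LINT \<alpha>|period. cis (real_of_int (2 * int i - 2 * int l) * \<alpha>)))"
    unfolding I1
  proof (subst Bochner_Integration.integral_sum, goal_cases)
    case 2
    show ?case by (intro sum.cong refl integral_mult_right_zero)
  qed (intro integrable_mult_right integrable_period_cis)
  also have "\<dots> = (\<Sum>i\<le>2 * l. (if i = l then 4 * pi\<^sup>2 * m l l else 0))"
    unfolding integral_period_cis by (intro sum.cong refl) (auto simp: power2_eq_square)
  also have "\<dots> = 4 * pi\<^sup>2 * m l l" by simp
  finally have I2: "(LINT \<alpha>|period. LINT \<beta>|period. G \<alpha> \<beta>) = 4 * pi\<^sup>2 * m l l" .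
  have "ennreal (4 * pi\<^sup>2 * ((real (2 * l choose l))\<^sup>2 * norm (coef l g))) = ennreal (norm (LINT \<alpha>|period. LINT \<beta>|period. G \<alpha> \<beta>))"
    unfolding I2 mll by (simp add: norm_mult norm_power)
  also have "\<dots> \<le> (\<integral>\<^sup>+\<alpha>. ennreal (norm (LINT \<beta>|period. G \<alpha> \<beta>)) \<partial>period)"
    by (rule integral_norm_bound_ennreal[OF int\<alpha>])
  also have "\<dots> \<le> (\<integral>\<^sup>+\<alpha>. (\<integral>\<^sup>+\<beta>. ennreal (norm (G \<alpha> \<beta>)) \<partial>period) \<partial>period)"
    by (intro nn_integral_mono integral_norm_bound_ennreal int\<beta>)
  also have "\<dots> = (\<integral>\<^sup>+\<alpha>. \<integral>\<^sup>+\<beta>. ennreal (4 ^ l * norm (coef 0 (equator_conj g \<alpha> \<beta>))) \<partial>period \<partial>period)"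
    by (simp add: G_def norm_mult norm_power)
  finally show ?thesis .
qed

end

section \<open>Distances to the diagonal and monomial matrices\<close>

text \<open>If a diagonal entry has modulus at least \<open>n / 4\<close>, keep it and replace the
  other one by its reciprocal; the error is \<open>b * c\<close> divided by the kept entry, at most
  \<open>4 * |c|\<close>. If neither has, the off-diagonal entries carry most of the norm and the
  identity matrix is close enough.\<close>

lemma infdist_diag_le:
  assumes g: "g \<in> SL2C"
  shows "infdist g diag_SL2C \<le> 5 * (cmod (g$1$2) + cmod (g$2$1))"
proof -
  define a b c d where abcd: "a = g$1$1" "b = g$1$2" "c = g$2$1" "d = g$2$2"
  define n where "n = norm g"
  have n: "n\<^sup>2 \<ge> 2" "n \<ge> 1" using norm_SL2C_ge[OF g] by (simp_all add: n_def)
  have n2: "n\<^sup>2 = (cmod a)\<^sup>2 + (cmod b)\<^sup>2 + (cmod c)\<^sup>2 + (cmod d)\<^sup>2" by (simp add: n_def norm_mat_sq abcd)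
  have det: "a * d = 1 + b * c" using g by (simp add: SL2C_def det_2 abcd algebra_simps)
  have le: "cmod b \<le> n" by (simp add: n_def abcd norm_entry_le)
  have dist: "infdist g diag_SL2C \<le> norm (g - mat2 z 0 0 w)" if "z * w = 1" for z w
  proof -
    have "mat2 z 0 0 w \<in> diag_SL2C" using that by (simp add: diag_SL2C_def SL2C_mat2)
    from infdist_le[OF this, of g] show ?thesis by (simp add: dist_norm)
  qed
  have norm_le: "norm (g - mat2 z 0 0 w) \<le> cmod (a - z) + cmod b + cmod c + cmod (d - w)" for z w
  proof -
    have "(norm (g - mat2 z 0 0 w))\<^sup>2 = (cmod (a - z))\<^sup>2 + (cmod b)\<^sup>2 + (cmod c)\<^sup>2 + (cmod (d - w))\<^sup>2"
      by (simp add: norm_mat_sq abcd)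
    also have "\<dots> \<le> (cmod (a - z) + cmod b + cmod c + cmod (d - w))\<^sup>2"
      by (simp add: power2_eq_square algebra_simps)
    finally show ?thesis by (rule power2_le_imp_le) simp
  qed
  have off: "cmod (b * c) / cmod p \<le> 4 * cmod c" if "cmod p \<ge> n / 4" for p
  proof -
    have "cmod p > 0" using that n by linarith
    moreover have "cmod (b * c) \<le> (4 * cmod p) * cmod c"
      unfolding norm_mult using le that by (intro mult_right_mono) auto
    ultimately show ?thesis by (simp add: divide_le_eq mult_ac)
  qed
  consider "cmod a \<ge> n / 4" | "cmod d \<ge> n / 4" | "cmod a \<le> n / 4" "cmod d \<le> n / 4" by linarith
  then show ?thesis
  proof cases
    case 1
    then have "a \<noteq> 0" using n by auto
    then have "d - 1 / a = (b * c) / a" using det by (simp add: field_simps)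
    then have "cmod (d - 1 / a) \<le> 4 * cmod c" using off[OF 1] by (simp add: norm_divide)
    moreover have "infdist g diag_SL2C \<le> cmod (a - a) + cmod b + cmod c + cmod (d - 1 / a)"
      using dist[of a "1 / a"] norm_le[of a "1 / a"] \<open>a \<noteq> 0\<close> by simp
    moreover have "cmod (a - a) = 0" by simp
    ultimately show ?thesis using norm_ge_zero[of b] unfolding abcd[symmetric] distrib_left by linarith
  next
    case 2
    then have "d \<noteq> 0" using n by auto
    then have "a - 1 / d = (b * c) / d" using det by (simp add: field_simps)
    then have "cmod (a - 1 / d) \<le> 4 * cmod c" using off[OF 2] by (simp add: norm_divide)
    moreover have "infdist g diag_SL2C \<le> cmod (a - 1 / d) + cmod b + cmod c + cmod (d - d)"
      using dist[of "1 / d" d] norm_le[of "1 / d" d] \<open>d \<noteq> 0\<close> by simp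
    moreover have "cmod (d - d) = 0" by simp
    ultimately show ?thesis using norm_ge_zero[of b] unfolding abcd[symmetric] distrib_left by linarith
  next
    case 3
    have "(cmod a)\<^sup>2 \<le> (n / 4)\<^sup>2" "(cmod d)\<^sup>2 \<le> (n / 4)\<^sup>2" using 3 by (intro power_mono; simp)+
    moreover have "(n / 4)\<^sup>2 = n\<^sup>2 / 16" "(3 / 4 * n)\<^sup>2 = 9 / 16 * n\<^sup>2" by (simp_all add: power2_eq_square)
    moreover have "(cmod b)\<^sup>2 + (cmod c)\<^sup>2 \<le> (cmod b + cmod c)\<^sup>2" by (simp add: power2_eq_square algebra_simps)
    moreover have "0 \<le> n\<^sup>2" by simp
    ultimately have "(3 / 4 * n)\<^sup>2 \<le> (cmod b + cmod c)\<^sup>2" using n2 by linarith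
    then have "3 / 4 * n \<le> cmod b + cmod c" by (rule power2_le_imp_le) simp
    moreover have "infdist g diag_SL2C \<le> cmod (a - 1) + cmod b + cmod c + cmod (d - 1)"
      using dist[of 1 1] norm_le[of 1 1] by auto
    moreover have "cmod (a - 1) \<le> n / 4 + 1" "cmod (d - 1) \<le> n / 4 + 1"
      using norm_triangle_ineq4[of a 1] norm_triangle_ineq4[of d 1] 3 by auto
    ultimately show ?thesis using n(2) unfolding abcd[symmetric] distrib_left by linarith
  qed
qed

text \<open>To be applied to \<open>(a, d)\<close> and to \<open>(b, - c)\<close>, with
  \<open>m\<close> the size of the complementary pair. Nearly equal moduli and a product near 1
  force both moduli to be near 1, so \<open>e = a / |a|\<close> works. For \<open>m \<ge> 1\<close>
  this fails, but then \<open>n\<close> is itself of size \<open>m\<close>.\<close>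

lemma near_unit_pair:
  fixes a d :: complex and m n \<delta> :: real
  assumes p: "n / 2 \<le> max (cmod a) (cmod d)" and n: "1 \<le> n" and \<delta>: "\<delta> < 1/8" "0 \<le> \<delta>" and m: "0 \<le> m"
    and ad: "\<bar>cmod a - cmod d\<bar> \<le> \<delta> * n" and det: "cmod (a * d - 1) \<le> m\<^sup>2"
  shows "n \<le> 4 * m \<or> (\<exists>e. cmod e = 1 \<and> cmod (a - e) + cmod (d - cnj e) \<le> 7 * m + 32 * \<delta>)"
proof -
  define p where "p = max (cmod a) (cmod d)"
  have pn: "n \<le> 2 * p" "p \<ge> 1/2" using p n by (simp_all add: p_def)
  have "\<delta> * n \<le> 1/8 * (2 * p)" using \<delta> pn n by (intro mult_mono) auto
  then have ge: "cmod a \<ge> 3/4 * p" "cmod d \<ge> 3/4 * p" "cmod a \<le> p" "cmod d \<le> p"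
    using ad by (auto simp: p_def)
  have "3/4 * p\<^sup>2 \<le> cmod a * cmod d"
  proof (cases "cmod a \<le> cmod d")
    case True
    then have "p = cmod d" by (simp add: p_def)
    then show ?thesis using mult_right_mono[OF ge(1), of p] pn by (simp add: power2_eq_square mult_ac)
  next
    case False
    then have "p = cmod a" by (simp add: p_def)
    then show ?thesis using mult_left_mono[OF ge(2), of p] pn by (simp add: power2_eq_square mult_ac)
  qed
  moreover have ad1: "\<bar>cmod a * cmod d - 1\<bar> \<le> m\<^sup>2"
    using norm_triangle_ineq3[of "a * d" 1] det by (simp add: norm_mult)
  ultimately have p2: "3/4 * p\<^sup>2 \<le> 1 + m\<^sup>2" by linarith
  show ?thesis
  proof (cases "m \<ge> 1")
    case True
    then have "1 \<le> m\<^sup>2" by simp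
    then have "p\<^sup>2 \<le> 4 * m\<^sup>2" using p2 by linarith
    then have "p\<^sup>2 \<le> (2 * m)\<^sup>2" by (simp add: power_mult_distrib)
    then have "p \<le> 2 * m" by (rule power2_le_imp_le) (use m in simp)
    then show ?thesis using pn by simp
  next
    case False
    then have mm: "m\<^sup>2 \<le> m" "m\<^sup>2 \<le> 1" using m by (simp_all add: power2_eq_square mult_left_le power_le_one mult_le_one)
    have "p\<^sup>2 \<le> 2\<^sup>2" using p2 mm by simp
    then have p2: "p \<le> 2" by (rule power2_le_imp_le) simp
    then have n4: "\<delta> * n \<le> 4 * \<delta>" using pn \<delta> mult_left_mono[of n 4 \<delta>] by (simp add: mult.commute)
    have a: "cmod a \<ge> 3/8" using ge pn by simp
    then have a0: "a \<noteq> 0" by auto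
    have "cmod a * \<bar>cmod a - cmod d\<bar> \<le> 2 * (4 * \<delta>)"
      using ge p2 ad n4 by (intro mult_mono) auto
    then have "\<bar>cmod a * (cmod a - cmod d)\<bar> \<le> 8 * \<delta>" by (simp add: abs_mult)
    moreover have "(cmod a - 1) * (cmod a + 1) = (cmod a * cmod d - 1) + cmod a * (cmod a - cmod d)"
      by (simp add: algebra_simps)
    ultimately have "\<bar>(cmod a - 1) * (cmod a + 1)\<bar> \<le> m + 8 * \<delta>" using ad1 mm by linarith
    moreover have "\<bar>cmod a - 1\<bar> * 1 \<le> \<bar>cmod a - 1\<bar> * (cmod a + 1)" by (intro mult_left_mono) auto
    ultimately have a1: "\<bar>cmod a - 1\<bar> \<le> m + 8 * \<delta>" by (simp add: abs_mult)
    define e where "e = a / cmod a"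
    have e: "cmod e = 1" using a0 by (simp add: e_def norm_divide)
    have "a - e = e * (cmod a - 1)" using a0 by (simp add: e_def field_simps)
    moreover have abs1: "cmod (complex_of_real x - 1) = \<bar>x - 1\<bar>" for x
      using norm_of_real[of "x - 1", where ?'a = complex] by simp
    ultimately have ae: "cmod (a - e) \<le> m + 8 * \<delta>" using a1 e by (simp only: norm_mult) simp
    have "a * cnj e = cmod a"
      using a0 by (simp add: e_def complex_norm_square[symmetric] power2_eq_square)
    then have "a * (d - cnj e) = (a * d - 1) - (cmod a - 1)" by (simp add: algebra_simps)
    then have "cmod a * cmod (d - cnj e) \<le> cmod (a * d - 1) + cmod (cmod a - 1 :: complex)"
      using norm_triangle_ineq4[of "a * d - 1" "cmod a - 1"] norm_mult[of a "d - cnj e"] by simp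
    also have "cmod (cmod a - 1 :: complex) = \<bar>cmod a - 1\<bar>" by (rule norm_of_real)
    finally have "cmod a * cmod (d - cnj e) \<le> 2 * m + 8 * \<delta>" using det mm a1 by linarith
    moreover have "3/8 * cmod (d - cnj e) \<le> cmod a * cmod (d - cnj e)" using a by (intro mult_right_mono) auto
    ultimately have "3/8 * cmod (d - cnj e) \<le> 2 * m + 8 * \<delta>" by linarith
    then have "cmod (a - e) + cmod (d - cnj e) \<le> 7 * m + 32 * \<delta>" using ae m \<delta>(2) by linarith
    then show ?thesis using e by blast
  qed
qed

lemma infdist_mono_triv: "infdist g mono_SU2 \<le> norm g + 2"
proof -
  have "infdist g mono_SU2 \<le> norm (g - mat 1)" using infdist_le[OF mat_1_in_diag_mono(2), of g] by (simp add: dist_norm)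
  also have "\<dots> \<le> norm g + norm (mat 1 :: complex^2^2)" by (rule norm_triangle_ineq4)
  also have "norm (mat 1 :: complex^2^2) \<le> 2"
  proof -
    have "(norm (mat 1 :: complex^2^2))\<^sup>2 \<le> 2\<^sup>2" by (simp add: norm_mat_sq mat_def)
    then show ?thesis by (rule power2_le_imp_le) simp
  qed
  finally show ?thesis by simp
qed

text \<open>Dropping the smaller pair and normalizing the larger one gives a monomial matrix. The
  determinant says that the product of the larger pair is 1, up to sign and an error bounded by the
  square of the smaller maximum, as \<open>near_unit_pair\<close> requires.\<close>

lemma infdist_mono_le:
  assumes g: "g \<in> SL2C" and \<delta>: "0 \<le> \<delta>" "\<delta> < 1/8"
    and ad: "\<bar>cmod (g$1$1) - cmod (g$2$2)\<bar> \<le> \<delta> * norm g"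
    and bc: "\<bar>cmod (g$1$2) - cmod (g$2$1)\<bar> \<le> \<delta> * norm g"
  shows "infdist g mono_SU2 \<le> 32 * (min (max (cmod (g$1$1)) (cmod (g$2$2))) (max (cmod (g$1$2)) (cmod (g$2$1))) + \<delta>)"
proof -
  define a b c d where abcd: "a = g$1$1" "b = g$1$2" "c = g$2$1" "d = g$2$2"
  define n where "n = norm g"
  have n: "n\<^sup>2 \<ge> 2" "n \<ge> 1" using norm_SL2C_ge[OF g] by (simp_all add: n_def)
  define p r where "p = max (cmod a) (cmod d)" and "r = max (cmod b) (cmod c)"
  have n2: "n\<^sup>2 = (cmod a)\<^sup>2 + (cmod b)\<^sup>2 + (cmod c)\<^sup>2 + (cmod d)\<^sup>2" by (simp add: n_def norm_mat_sq abcd)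
  have "(cmod a)\<^sup>2 \<le> p\<^sup>2" "(cmod d)\<^sup>2 \<le> p\<^sup>2" "(cmod b)\<^sup>2 \<le> r\<^sup>2" "(cmod c)\<^sup>2 \<le> r\<^sup>2"
    by (auto simp: p_def r_def intro!: power_mono)
  then have npr: "n\<^sup>2 \<le> 2 * p\<^sup>2 + 2 * r\<^sup>2" using n2 by linarith
  have pr: "0 \<le> p" "0 \<le> r" by (auto simp: p_def r_def le_max_iff_disj)
  have det: "a * d - 1 = b * c" "b * (- c) - 1 = - (a * d)" 
    using g by (auto simp: SL2C_def det_2 abcd algebra_simps)
  note triv = infdist_mono_triv[of g, folded n_def]
  have norm_le: "norm (g - mat2 x y z w) \<le> cmod (a - x) + cmod (b - y) + cmod (c - z) + cmod (d - w)" for x y z w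
  proof -
    have "(norm (g - mat2 x y z w))\<^sup>2 = (cmod (a - x))\<^sup>2 + (cmod (b - y))\<^sup>2 + (cmod (c - z))\<^sup>2 + (cmod (d - w))\<^sup>2"
      by (simp add: norm_mat_sq abcd)
    also have "\<dots> \<le> (cmod (a - x) + cmod (b - y) + cmod (c - z) + cmod (d - w))\<^sup>2"
      by (simp add: power2_eq_square algebra_simps)
    finally show ?thesis by (rule power2_le_imp_le) simp
  qed
  have far: "infdist g mono_SU2 \<le> 32 * (m + \<delta>)" if "n \<le> 4 * m" for m
    using triv that n \<delta> by (simp add: algebra_simps)
  show ?thesis
  proof (cases "r \<le> p")
    case True
    then have "r\<^sup>2 \<le> p\<^sup>2" using pr by (intro power_mono) auto
    then have "n\<^sup>2 \<le> (2 * p)\<^sup>2" using npr by (simp add: power_mult_distrib)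
    then have "n \<le> 2 * p" by (rule power2_le_imp_le) (use pr in simp)
    moreover have "cmod (b * c) \<le> r\<^sup>2" unfolding norm_mult power2_eq_square by (intro mult_mono) (auto simp: r_def le_max_iff_disj)
    ultimately consider "n \<le> 4 * r" | e where "cmod e = 1" "cmod (a - e) + cmod (d - cnj e) \<le> 7 * r + 32 * \<delta>"
      using near_unit_pair[of n a d \<delta> r] n \<delta> pr ad det by (auto simp: p_def n_def abcd)
    then have "infdist g mono_SU2 \<le> 32 * (r + \<delta>)"
    proof cases
      case 2
      have "mat2 e 0 0 (cnj e) \<in> mono_SU2" using 2 SU2_mat2[of e 0] by (simp add: mono_SU2_def)
      then have "infdist g mono_SU2 \<le> norm (g - mat2 e 0 0 (cnj e))" using infdist_le[of _ _ g] by (auto simp: dist_norm)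
      also have "\<dots> \<le> cmod (a - e) + cmod b + cmod c + cmod (d - cnj e)" using norm_le[of e 0 0 "cnj e"] by simp
      also have "\<dots> \<le> 32 * (r + \<delta>)" using 2 pr by (auto simp: r_def)
      finally show ?thesis .
    qed (rule far)
    then have "infdist g mono_SU2 \<le> 32 * (min p r + \<delta>)" using True by (simp add: min_def)
    then show ?thesis unfolding p_def r_def abcd .
  next
    case False
    then have "p\<^sup>2 \<le> r\<^sup>2" using pr by (intro power_mono) auto
    then have "n\<^sup>2 \<le> (2 * r)\<^sup>2" using npr by (simp add: power_mult_distrib)
    then have "n \<le> 2 * r" by (rule power2_le_imp_le) (use pr in simp)
    moreover have "cmod (- (a * d)) \<le> p\<^sup>2" unfolding norm_minus_cancel norm_mult power2_eq_square by (intro mult_mono) (auto simp: p_def le_max_iff_disj)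
    ultimately consider "n \<le> 4 * p" | e where "cmod e = 1" "cmod (b - e) + cmod (- c - cnj e) \<le> 7 * p + 32 * \<delta>"
      using near_unit_pair[of n b "- c" \<delta> p] n \<delta> pr bc unfolding det(2) by (auto simp: r_def n_def abcd)
    then have "infdist g mono_SU2 \<le> 32 * (p + \<delta>)"
    proof cases
      case 2
      have "mat2 0 e (- cnj e) 0 \<in> mono_SU2" using 2 SU2_mat2[of 0 e] by (simp add: mono_SU2_def)
      then have "infdist g mono_SU2 \<le> norm (g - mat2 0 e (- cnj e) 0)" using infdist_le[of _ _ g] by (auto simp: dist_norm)
      also have "\<dots> \<le> cmod a + cmod (b - e) + cmod (c + cnj e) + cmod d" using norm_le[of 0 e "- cnj e" 0] by simp
      also have "cmod (c + cnj e) = cmod (- c - cnj e)" by (metis minus_add_distrib norm_minus_cancel uminus_add_conv_diff add.commute)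
      also have "cmod a + cmod (b - e) + cmod (- c - cnj e) + cmod d \<le> 32 * (p + \<delta>)" using 2 pr by (auto simp: p_def)
      finally show ?thesis .
    qed (rule far)
    then have "infdist g mono_SU2 \<le> 32 * (min p r + \<delta>)" using False by (simp add: min_def)
    then show ?thesis unfolding p_def r_def abcd .
  qed
qed

section \<open>The spherical trace function\<close>

text \<open>The division by \<open>r ^ (2 * l)\<close> stems from normalizing the first column in
  \<open>iwasawa_kappa\<close>. For imaginary \<open>\<nu>\<close> the modulus is independent of
  \<open>\<nu>\<close>, the source of all uniformity in \<open>\<nu>\<close>.\<close>

definition radial_factor :: "complex \<Rightarrow> nat \<Rightarrow> real \<Rightarrow> complex" where
  "radial_factor \<nu> l r = complex_of_real (r\<^sup>2) powr (\<nu> - 1) / of_real (r ^ (2 * l))"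

lemma spherical_haar:
  assumes haar: "haar_prob_SU2 \<mu>" and \<nu>: "Re \<nu> = 0"
  shows "spherical (distr \<mu> borel first_column) l (radial_factor \<nu> l)"
proof (intro spherical.intro sphere_measure_haar[OF haar] spherical_axioms.intro)
  have "radial_factor \<nu> l = (\<lambda>r. (if r = 0 then 0 else exp ((\<nu> - 1) * of_real (ln (r\<^sup>2)))) / of_real (r ^ (2 * l)))"
    by (auto simp: radial_factor_def powr_def Ln_of_real fun_eq_iff simp flip: of_real_power)
  also have "\<dots> \<in> borel_measurable borel" by measurable
  finally show "radial_factor \<nu> l \<in> borel_measurable borel" .
  fix r :: real assume r: "r > 0"
  have "cmod (complex_of_real (r\<^sup>2) powr (\<nu> - 1)) = (r\<^sup>2) powr (- 1)"
    using \<nu> by (subst norm_powr_real_powr) auto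
  also have "\<dots> = 1 / r\<^sup>2" using r by (simp add: powr_minus divide_inverse)
  finally show "cmod (radial_factor \<nu> l r) = 1 / r ^ (2 * l + 2)"
    using r by (simp add: radial_factor_def norm_divide norm_power power_add power2_eq_square)
qed

lemma matrix_inv_SU2:
  assumes "k \<in> SU2"
  shows "matrix_inv k = ctranspose k"
proof -
  have "k ** matrix_inv k = mat 1 \<and> matrix_inv k ** k = mat 1"
    unfolding matrix_inv_def by (rule someI[of _ "ctranspose k"]) (simp add: SU2_cancel[OF assms])
  then have "ctranspose k ** (k ** matrix_inv k) = ctranspose k" by simp
  then show ?thesis by (simp add: matrix_mul_assoc SU2_cancel[OF assms])
qed

lemma iwasawa_height_eq: "iwasawa_height g = (norm (first_column g))\<^sup>2"
  by (simp add: iwasawa_height_def norm_pair_sq first_column_def)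

text \<open>The integrand depends on \<open>k\<close> only through its first column
  \<open>x\<close>: the upper left entry of the conjugated matrix is
  \<open>herm (act g x) x\<close>, and the height is the squared norm of
  \<open>act g x\<close>.\<close>

lemma spherical_trace_eq:
  assumes haar: "haar_prob_SU2 \<mu>" and \<nu>: "Re \<nu> = 0"
  shows "spherical_trace \<mu> \<nu> l g = of_nat (2 * l + 1) * spherical.Phi (distr \<mu> borel first_column) l (radial_factor \<nu> l) g"
proof -
  interpret spherical "distr \<mu> borel first_column" l "radial_factor \<nu> l" by (rule spherical_haar[OF haar \<nu>])
  note [measurable] = first_column_measurable[OF haar]
  have "Phi g = (LINT k|\<mu>. cnj (herm (act g (first_column k)) (first_column k)) ^ (2 * l) * radial_factor \<nu> l (norm (act g (first_column k))))"
    unfolding Phi_def by (rule integral_distr) measurable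
  also have "\<dots> = (LINT k|\<mu>. psi l (iwasawa_kappa (matrix_inv k ** g ** k)) * complex_of_real (iwasawa_height (g ** k)) powr (\<nu> - 1))"
  proof (intro Bochner_Integration.integral_cong refl)
    fix k assume "k \<in> space \<mu>"
    then have k: "k \<in> SU2" by (simp add: space_haar[OF haar])
    define x z where "x = first_column k" and "z = act g x"
    define h where "h = matrix_inv k ** g ** k"
    have h: "first_column h = act (ctranspose k) z"
      by (simp add: h_def matrix_inv_SU2[OF k] first_column_mult act_mult x_def z_def)
    then have nh: "norm (first_column h) = norm z" by (simp add: norm_act_SU2 SU2_ctranspose[OF k])
    have "h$1$1 = fst (first_column h)" by (simp add: first_column_def)
    also have "\<dots> = herm z x" unfolding h by (simp add: act_def ctranspose_def transpose_def herm_def x_def first_column_def mult.commute)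
    finally have "psi l (iwasawa_kappa h) = cnj (herm z x) ^ (2 * l) / of_real (norm z ^ (2 * l))"
      by (simp add: psi_def iwasawa_kappa_def Let_def iwasawa_height_eq nh power_divide)
    moreover have "iwasawa_height (g ** k) = (norm z)\<^sup>2"
      by (simp add: iwasawa_height_eq first_column_mult z_def x_def)
    ultimately show "cnj (herm (act g (first_column k)) (first_column k)) ^ (2 * l) * radial_factor \<nu> l (norm (act g (first_column k))) =
      psi l (iwasawa_kappa (matrix_inv k ** g ** k)) * complex_of_real (iwasawa_height (g ** k)) powr (\<nu> - 1)"
      by (simp add: radial_factor_def flip: h_def z_def x_def)
  qed
  finally show ?thesis by (simp add: spherical_trace_def)
qed

lemma avg_spherical_trace_eq:
  assumes haar: "haar_prob_SU2 \<mu>" and \<nu>: "Re \<nu> = 0" and g: "g \<in> SL2C" and q: "\<bar>q\<bar> \<le> int l"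
  shows "avg_spherical_trace \<mu> \<nu> l q g = of_nat (2 * l + 1) * (of_nat (2 * l choose nat (int l + q)) * 
    spherical.coef (distr \<mu> borel first_column) l (radial_factor \<nu> l) (nat (int l + q)) g)"
proof -
  interpret spherical "distr \<mu> borel first_column" l "radial_factor \<nu> l" by (rule spherical_haar[OF haar \<nu>])
  have "integral {0..2 * pi} (\<lambda>r. spherical_trace \<mu> \<nu> l (g ** mat2 (cis r) 0 0 (cis (- r))) * exp (- 2 * of_int q * \<i> * of_real r)) =
      of_nat (2 * l + 1) * (2 * pi * (of_nat (2 * l choose nat (int l + q)) * coef (nat (int l + q)) g))"
    unfolding spherical_trace_eq[OF haar \<nu>] mult.assoc[of "of_nat (2 * l + 1)"] integral_mult_right integral_Phi_diag[OF g q] ..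
  then show ?thesis
    unfolding avg_spherical_trace_def by simp
qed

section \<open>Extreme coefficients, with constants uniform in \<open>l\<close> and
  \<open>X\<close>\<close>

context sphere_measure begin

lemma coef_0_bound:
  assumes \<eta>: "0 < \<eta>" "\<eta> \<le> 1"
  obtains C where "C > 0"
    "\<And>l X g. spherical \<sigma> l X \<Longrightarrow> l \<ge> 1 \<Longrightarrow> g \<in> SL2C \<Longrightarrow>
       real (2 * l + 1) * cmod (spherical.coef \<sigma> l X 0 g) \<le> C * norm g powr (- 2 + \<eta>)"
proof -
  obtain C where C: "C > 0" 
    "\<And>l g. l \<ge> 1 \<Longrightarrow> g \<in> SL2C \<Longrightarrow> trivial_bound l g \<le> ennreal (C / l * norm g powr (- 2 + \<eta>)) \<or> 
       trivial_bound l (ctranspose g) \<le> ennreal (C / l * norm g powr (- 2 + \<eta>))"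
    by (rule trivial_bound_ctranspose_le[OF \<eta>]) blast
  have "real (2 * l + 1) * cmod (spherical.coef \<sigma> l X 0 g) \<le> 3 * C * norm g powr (- 2 + \<eta>)"
    if X: "spherical \<sigma> l X" and l: "l \<ge> 1" and g: "g \<in> SL2C" for l X g
  proof -
    interpret spherical \<sigma> l X by (rule X)
    have "ennreal (cmod (coef 0 g)) \<le> ennreal (C / l * norm g powr (- 2 + \<eta>))"
      using C(2)[OF l g] norm_coef_le[OF g] by (auto intro: order_trans)
    then have "cmod (coef 0 g) \<le> C / l * norm g powr (- 2 + \<eta>)"
      using C(1) by (subst (asm) ennreal_le_iff) auto
    then have "real (2 * l + 1) * cmod (coef 0 g) \<le> real (3 * l) * (C / l * norm g powr (- 2 + \<eta>))"
      using l by (intro mult_mono) auto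
    also have "\<dots> = 3 * C * norm g powr (- 2 + \<eta>)" using l by simp
    finally show ?thesis .
  qed
  with C(1) show ?thesis by (intro that[of "3 * C"]) auto
qed

text \<open>The two bounds of \<open>norm_coef_le\<close> give decay in the larger off-diagonal
  entry, which is at least half of the sum; hence \<open>12 = 3 * 2^2\<close>.\<close>

lemma coef_0_decay:
  obtains C where "C > 0"
    "\<And>l X g. spherical \<sigma> l X \<Longrightarrow> l \<ge> 1 \<Longrightarrow> g \<in> SL2C \<Longrightarrow>
       real (2 * l + 1) * cmod (spherical.coef \<sigma> l X 0 g) \<le> 
       C * l * exp (- (l * ((cmod (g$1$2) + cmod (g$2$1)) / norm g)\<^sup>2 / 12))"
proof -
  obtain A where A: "A > 0"
    "\<And>g. g \<in> SL2C \<Longrightarrow> (\<integral>\<^sup>+x. ennreal (1 / (norm (act g x))\<^sup>2) \<partial>\<sigma>) \<le> ennreal (A * norm g powr (- 2 + 1))"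
    by (rule Xi_bound[of 1]) auto
  have tb: "trivial_bound l g \<le> ennreal (A * exp (- (l * (cmod (g$2$1))\<^sup>2 / (3 * (norm g)\<^sup>2))))"
    if g: "g \<in> SL2C" for l g
  proof -
    have "norm g powr (- 2 + 1) \<le> norm g powr 0"
      using norm_SL2C_ge(2)[OF g] by (intro powr_mono) auto
    then have "A * norm g powr (- 2 + 1) \<le> A * 1"
      using A(1) norm_SL2C_ge(2)[OF g] by (intro mult_left_mono) (auto split: if_splits)
    then have "(\<integral>\<^sup>+x. ennreal (1 / (norm (act g x))\<^sup>2) \<partial>\<sigma>) \<le> ennreal A"
      by (intro order_trans[OF A(2)[OF g]] ennreal_leI) simp
    then have "trivial_bound l g \<le> ennreal (exp (- (l * (cmod (g$2$1))\<^sup>2 / (3 * (norm g)\<^sup>2)))) * ennreal A"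
      by (intro order_trans[OF trivial_bound_decay[OF g]] mult_left_mono) auto
    then show ?thesis using A(1) by (simp add: mult.commute flip: ennreal_mult)
  qed
  have "real (2 * l + 1) * cmod (spherical.coef \<sigma> l X 0 g) \<le> 
       3 * A * l * exp (- (l * ((cmod (g$1$2) + cmod (g$2$1)) / norm g)\<^sup>2 / 12))"
    if X: "spherical \<sigma> l X" and l: "l \<ge> 1" and g: "g \<in> SL2C" for l X g
  proof -
    interpret spherical \<sigma> l X by (rule X)
    define n where "n = norm g"
    have n: "n > 0" using norm_SL2C_ge(2)[OF g] unfolding n_def by linarith
    define m where "m = cmod (g$1$2) + cmod (g$2$1)"
    have ent: "(ctranspose g)$2$1 = cnj (g$1$2)" by (simp add: ctranspose_def transpose_def)
    have "cmod (coef 0 g) \<le> A * exp (- (l * t\<^sup>2 / (3 * n\<^sup>2)))" if "t = cmod (g$1$2) \<or> t = cmod (g$2$1)" for t :: real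
      using that
    proof
      assume t: "t = cmod (g$2$1)"
      have "ennreal (cmod (coef 0 g)) \<le> ennreal (A * exp (- (l * t\<^sup>2 / (3 * n\<^sup>2))))"
        using order_trans[OF norm_coef_le(1)[OF g] tb[OF g]] by (simp only: t n_def)
      then show ?thesis using A(1) by (subst (asm) ennreal_le_iff) auto
    next
      assume t: "t = cmod (g$1$2)"
      have "ennreal (cmod (coef 0 g)) \<le> ennreal (A * exp (- (l * t\<^sup>2 / (3 * n\<^sup>2))))"
        using order_trans[OF norm_coef_le(2)[OF g] tb[OF ctranspose_SL2C[OF g]]] by (simp only: t n_def ent norm_ctranspose complex_mod_cnj)
      then show ?thesis using A(1) by (subst (asm) ennreal_le_iff) auto
    qed
    then have "cmod (coef 0 g) \<le> A * exp (- (l * (max (cmod (g$1$2)) (cmod (g$2$1)))\<^sup>2 / (3 * n\<^sup>2)))"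
      by (simp add: max_def)
    also have "\<dots> \<le> A * exp (- (l * (m / n)\<^sup>2 / 12))"
    proof -
      have "(m / 2)\<^sup>2 \<le> (max (cmod (g$1$2)) (cmod (g$2$1)))\<^sup>2" by (intro power_mono) (auto simp: m_def)
      then have "l * (m / 2)\<^sup>2 / (3 * n\<^sup>2) \<le> l * (max (cmod (g$1$2)) (cmod (g$2$1)))\<^sup>2 / (3 * n\<^sup>2)"
        by (intro divide_right_mono mult_left_mono) auto
      moreover have "l * (m / 2)\<^sup>2 / (3 * n\<^sup>2) = l * (m / n)\<^sup>2 / 12" by (simp add: power_divide)
      ultimately show ?thesis using A(1) by simp
    qed
    finally have "real (2 * l + 1) * cmod (coef 0 g) \<le> real (3 * l) * (A * exp (- (l * (m / n)\<^sup>2 / 12)))"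
      using l by (intro mult_mono) auto
    then show ?thesis by (simp add: m_def n_def mult_ac)
  qed
  with A(1) show ?thesis by (intro that[of "3 * A"]) auto
qed

end

section \<open>The weight-zero coefficient as an average over two angles\<close>

context spherical begin

definition zonal :: "complex^2^2 \<Rightarrow> real" where
  "zonal g = real (2 * l + 1) * (real (2 * l choose l) * cmod (coef l g))"

text \<open>Outside the box of \<open>E\<close> and \<open>E'\<close> the extreme coefficient is
  below \<open>B2\<close>; inside, \<open>B1\<close> is added. The average carries
  \<open>4 ^ l\<close> against two central binomial coefficients, one of which \<open>zonal\<close>
  gives back, so that \<open>2 * sqrt l\<close> remains.\<close>

lemma zonal_le:
  assumes l: "l \<ge> 1" and g: "g \<in> SL2C"
    and E: "E \<in> sets period" "emeasure period E \<le> ennreal P" "0 \<le> P"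
    and E': "E' \<in> sets period" "emeasure period E' \<le> ennreal P'" "0 \<le> P'"
    and B: "0 \<le> B1" "0 \<le> B2"
    and le: "\<And>\<alpha> \<beta>. \<alpha> \<in> {0..2 * pi} \<Longrightarrow> \<beta> \<in> {0..2 * pi} \<Longrightarrow> 
      real (2 * l + 1) * cmod (coef 0 (equator_conj g \<alpha> \<beta>)) \<le> B1 * indicator E \<alpha> * indicator E' \<beta> + B2"
  shows "zonal g \<le> 2 * sqrt (real l) * (B1 * P * P' + B2)"
proof -
  define K where "K = 4 ^ l / real (2 * l + 1)"
  have K: "K \<ge> 0" by (simp add: K_def)
  define c where "c = real (2 * l choose l)"
  have c: "c > 0" by (simp add: c_def)
  have affine: "(\<integral>\<^sup>+r. a * indicator A r + b \<partial>period) = a * emeasure period A + b * ennreal (2 * pi)"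
    if "A \<in> sets period" for A and a b :: ennreal
    using that by (subst nn_integral_add) (simp_all add: nn_integral_cmult_indicator space_period emeasure_period_space)
  have "ennreal (4 * pi\<^sup>2 * (c\<^sup>2 * norm (coef l g))) \<le> (\<integral>\<^sup>+\<alpha>. \<integral>\<^sup>+\<beta>. ennreal (4 ^ l * norm (coef 0 (equator_conj g \<alpha> \<beta>))) \<partial>period \<partial>period)"
    unfolding c_def by (rule coef_middle_le[OF g])
  also have "\<dots> \<le> (\<integral>\<^sup>+\<alpha>. (\<integral>\<^sup>+\<beta>. (ennreal (K * B1) * indicator E \<alpha>) * indicator E' \<beta> + ennreal (K * B2) \<partial>period) \<partial>period)"
  proof (intro nn_integral_mono)
    fix \<alpha> \<beta> assume "\<alpha> \<in> space period" "\<beta> \<in> space period"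
    then have "real (2 * l + 1) * cmod (coef 0 (equator_conj g \<alpha> \<beta>)) \<le> B1 * indicator E \<alpha> * indicator E' \<beta> + B2"
      by (intro le) (simp_all add: space_period)
    then have "K * (real (2 * l + 1) * cmod (coef 0 (equator_conj g \<alpha> \<beta>))) \<le> K * (B1 * indicator E \<alpha> * indicator E' \<beta> + B2)"
      using K by (rule mult_left_mono)
    moreover have "K * (real (2 * l + 1) * x) = 4 ^ l * x" for x by (simp add: K_def)
    ultimately have "4 ^ l * cmod (coef 0 (equator_conj g \<alpha> \<beta>)) \<le> K * B1 * indicator E \<alpha> * indicator E' \<beta> + K * B2"
      by (simp only: distrib_left mult.assoc)
    then have "ennreal (4 ^ l * cmod (coef 0 (equator_conj g \<alpha> \<beta>))) \<le> ennreal (K * B1 * indicator E \<alpha> * indicator E' \<beta> + K * B2)"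
      by (rule ennreal_leI)
    also have "\<dots> = (ennreal (K * B1) * indicator E \<alpha>) * indicator E' \<beta> + ennreal (K * B2)"
      using K B by (auto simp: indicator_def)
    finally show "ennreal (4 ^ l * cmod (coef 0 (equator_conj g \<alpha> \<beta>))) \<le> (ennreal (K * B1) * indicator E \<alpha>) * indicator E' \<beta> + ennreal (K * B2)" .
  qed
  also have "\<dots> = (\<integral>\<^sup>+\<alpha>. (ennreal (K * B1) * emeasure period E') * indicator E \<alpha> + ennreal (K * B2) * ennreal (2 * pi) \<partial>period)"
    unfolding affine[OF E'(1)] by (simp only: mult_ac)
  also have "\<dots> = (ennreal (K * B1) * emeasure period E') * emeasure period E + ennreal (K * B2) * ennreal (2 * pi) * ennreal (2 * pi)"
    by (rule affine[OF E(1)])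
  also have "\<dots> \<le> (ennreal (K * B1) * ennreal P') * ennreal P + ennreal (K * B2) * ennreal (2 * pi) * ennreal (2 * pi)"
    using E E' by (intro add_right_mono mult_mono mult_left_mono) auto
  also have "\<dots> = ennreal (K * B1 * P' * P + K * B2 * (2 * pi) * (2 * pi))"
    using K B E(3) E'(3) by (simp flip: ennreal_mult ennreal_plus)
  finally have "4 * pi\<^sup>2 * (c\<^sup>2 * norm (coef l g)) \<le> K * B1 * P' * P + K * B2 * (2 * pi) * (2 * pi)"
    using K B E(3) E'(3) by (subst (asm) ennreal_le_iff) auto
  \<comment> \<open>\<open>P\<close> and \<open>P'\<close> bound unnormalized measures. Giving the
    main term a surplus factor \<open>4 * pi\<^sup>2\<close> lets that factor cancel on both
    sides.\<close>
  also have "\<dots> \<le> 4 * pi\<^sup>2 * (K * (B1 * P * P' + B2))"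
  proof -
    have "1 \<le> 4 * pi\<^sup>2" using pi_ge_two power_mono[of 2 pi 2] by simp
    then have "1 * (K * B1 * P' * P) \<le> 4 * pi\<^sup>2 * (K * B1 * P' * P)" using K B E(3) E'(3) by (intro mult_right_mono) auto
    then show ?thesis by (simp add: algebra_simps power2_eq_square)
  qed
  finally have "c\<^sup>2 * norm (coef l g) \<le> K * (B1 * P * P' + B2)" by simp
  then have "real (2 * l + 1) * (c\<^sup>2 * norm (coef l g)) \<le> real (2 * l + 1) * (K * (B1 * P * P' + B2))"
    by (intro mult_left_mono) auto
  also have "\<dots> = 4 ^ l * (B1 * P * P' + B2)" by (simp add: K_def)
  also have "\<dots> \<le> (2 * sqrt (real l) * c) * (B1 * P * P' + B2)"
    unfolding c_def using B E(3) E'(3) by (intro mult_right_mono central_binomial_sqrt_bound l) auto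
  finally have "c * zonal g \<le> c * (2 * sqrt (real l) * (B1 * P * P' + B2))"
    by (simp add: zonal_def c_def power2_eq_square mult_ac)
  then show ?thesis using c by simp
qed

lemma equator_conj_facts:
  assumes g: "g \<in> SL2C"
  shows "equator_conj g \<alpha> \<beta> \<in> SL2C" "norm (equator_conj g \<alpha> \<beta>) = norm g"
    "cmod (g$1$1 - cis (- 2 * \<alpha>) * g$2$2) \<le> cmod ((equator_conj g \<alpha> \<beta>)$1$2) + cmod ((equator_conj g \<alpha> \<beta>)$2$1)"
    "cmod (g$1$2 - cis (2 * \<beta>) * g$2$1) \<le> cmod ((equator_conj g \<alpha> \<beta>)$1$2) + cmod ((equator_conj g \<alpha> \<beta>)$2$1)"
proof -
  have k: "equator_rot (cnj (cis (\<alpha> + \<beta>))) \<in> SU2" "ctranspose (equator_rot (cis (\<alpha> - \<beta>))) \<in> SU2"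
    by (rule equator_rot_SU2, simp) (rule SU2_ctranspose[OF equator_rot_SU2], simp)
  show "equator_conj g \<alpha> \<beta> \<in> SL2C" "norm (equator_conj g \<alpha> \<beta>) = norm g"
    unfolding equator_conj_def using k g by (auto simp: norm_mult_SU2 intro: SL2C_mult SU2_subset_SL2C)
  have "cnj (cis (\<alpha> - \<beta>)) * cnj (cis (\<alpha> + \<beta>)) = cis (- 2 * \<alpha>)" "cis (\<alpha> + \<beta>) * cnj (cis (\<alpha> - \<beta>)) = cis (2 * \<beta>)"
    by (simp_all add: cis_cnj cis_mult)
  then show "cmod (g$1$1 - cis (- 2 * \<alpha>) * g$2$2) \<le> cmod ((equator_conj g \<alpha> \<beta>)$1$2) + cmod ((equator_conj g \<alpha> \<beta>)$2$1)"
    "cmod (g$1$2 - cis (2 * \<beta>) * g$2$1) \<le> cmod ((equator_conj g \<alpha> \<beta>)$1$2) + cmod ((equator_conj g \<alpha> \<beta>)$2$1)"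
    using equator_conj_entries[of "cis (\<alpha> + \<beta>)" "cis (\<alpha> - \<beta>)" g] unfolding equator_conj_def by simp_all
qed

end

context sphere_measure begin

text \<open>By the reverse triangle inequality the differences of moduli bound the off-diagonal part
  of every rotated matrix from below, whatever the angles. So all extreme coefficients in the
  average decay, and the exceptional sets can be taken empty.\<close>

lemma zonal_far:
  obtains C where "C > 0"
    "\<And>l X g t. spherical \<sigma> l X \<Longrightarrow> l \<ge> 1 \<Longrightarrow> g \<in> SL2C \<Longrightarrow> t \<ge> 0 \<Longrightarrow>
       t * norm g \<le> max \<bar>cmod (g$1$1) - cmod (g$2$2)\<bar> \<bar>cmod (g$1$2) - cmod (g$2$1)\<bar> \<Longrightarrow>
       spherical.zonal \<sigma> l X g \<le> C * (real l)\<^sup>2 * exp (- (l * t\<^sup>2 / 12))"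
proof -
  obtain C where C: "C > 0"
    "\<And>l X g. spherical \<sigma> l X \<Longrightarrow> l \<ge> 1 \<Longrightarrow> g \<in> SL2C \<Longrightarrow>
       real (2 * l + 1) * cmod (spherical.coef \<sigma> l X 0 g) \<le> 
       C * l * exp (- (l * ((cmod (g$1$2) + cmod (g$2$1)) / norm g)\<^sup>2 / 12))"
    by (rule coef_0_decay) blast
  have "spherical.zonal \<sigma> l X g \<le> 2 * C * (real l)\<^sup>2 * exp (- (l * t\<^sup>2 / 12))"
    if X: "spherical \<sigma> l X" and l: "l \<ge> 1" and g: "g \<in> SL2C" and t: "t \<ge> 0"
      and far: "t * norm g \<le> max \<bar>cmod (g$1$1) - cmod (g$2$2)\<bar> \<bar>cmod (g$1$2) - cmod (g$2$1)\<bar>" for l X g t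
  proof -
    interpret spherical \<sigma> l X by (rule X)
    define B where "B = C * l * exp (- (l * t\<^sup>2 / 12))"
    have n: "norm g > 0" using norm_SL2C_ge(2)[OF g] by linarith
    have "zonal g \<le> 2 * sqrt (real l) * (0 * 0 * 0 + B)"
    proof (rule zonal_le[OF l g, where E = "{}" and E' = "{}"])
      fix \<alpha> \<beta>
      define h where "h = equator_conj g \<alpha> \<beta>"
      define m where "m = cmod (h$1$2) + cmod (h$2$1)"
      have "\<bar>cmod (g$1$1) - cmod (g$2$2)\<bar> \<le> m"
        using equator_conj_facts(3)[OF g, of \<alpha> \<beta>] norm_triangle_ineq3[of "g$1$1" "cis (- 2 * \<alpha>) * g$2$2"]
        by (simp add: norm_mult m_def h_def)
      moreover have "\<bar>cmod (g$1$2) - cmod (g$2$1)\<bar> \<le> m"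
        using equator_conj_facts(4)[OF g, of \<beta> \<alpha>] norm_triangle_ineq3[of "g$1$2" "cis (2 * \<beta>) * g$2$1"]
        by (simp add: norm_mult m_def h_def)
      ultimately have "t \<le> m / norm g" using far n by (simp add: le_divide_eq)
      then have "t\<^sup>2 \<le> (m / norm g)\<^sup>2" using t by (intro power_mono) auto
      then have "l * t\<^sup>2 / 12 \<le> l * (m / norm g)\<^sup>2 / 12" by (intro divide_right_mono mult_left_mono) auto
      then have "C * l * exp (- (l * (m / norm g)\<^sup>2 / 12)) \<le> B"
        unfolding B_def using C(1) by (intro mult_left_mono) auto
      moreover have "real (2 * l + 1) * cmod (coef 0 h) \<le> C * l * exp (- (l * (m / norm g)\<^sup>2 / 12))"
        using C(2)[OF X l equator_conj_facts(1)[OF g]] by (simp add: h_def m_def equator_conj_facts(2)[OF g])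
      ultimately show "real (2 * l + 1) * cmod (coef 0 (equator_conj g \<alpha> \<beta>)) \<le> 0 * indicator {} \<alpha> * indicator {} \<beta> + B"
        by (simp add: h_def)
    qed (use C(1) in \<open>auto simp: B_def\<close>)
    also have "\<dots> \<le> 2 * real l * B"
    proof -
      have "sqrt (real l) \<le> real l" using l by (intro real_le_lsqrt) (auto simp: power2_eq_square)
      then have "sqrt (real l) * B \<le> real l * B" using C(1) by (intro mult_right_mono) (auto simp: B_def)
      then show ?thesis by simp
    qed
    also have "\<dots> = 2 * C * (real l)\<^sup>2 * exp (- (l * t\<^sup>2 / 12))" by (simp add: B_def power2_eq_square)
    finally show ?thesis .
  qed
  with C(1) show ?thesis by (intro that[of "2 * C"]) auto
qed

text \<open>Multiplying by the inverse phase exchanges \<open>a\<close> and \<open>d\<close>, so the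
  arc bound holds with either modulus. The product form with \<open>max\<close> also covers
  \<open>a = d = 0\<close>, and 8 exceeds \<open>2 * pi\<close>.\<close>

lemma arc_set:
  fixes a d :: complex
  assumes s: "\<bar>s\<bar> = 1" and \<eta>: "\<eta> \<ge> 0"
  obtains P E where "P \<ge> 0" "P \<le> 8" "P * max (cmod a) (cmod d) \<le> 30 * \<eta>"
    "E \<in> sets period" "emeasure period E \<le> ennreal P" 
    "\<And>r. r \<in> {0..2 * pi} \<Longrightarrow> cmod (a - cis (2 * s * r) * d) \<le> \<eta> \<Longrightarrow> r \<in> E"
proof -
  define E where "E = {r \<in> {0..2 * pi}. cmod (a - cis (2 * s * r) * d) \<le> \<eta>}"
  define P where "P = enn2real (emeasure period E)"
  have fin: "emeasure period E < \<infinity>" using emeasure_period_le[of E] by (rule le_less_trans) simp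
  then have P: "emeasure period E = ennreal P" by (simp add: P_def)
  have "ennreal P \<le> ennreal (2 * pi)" unfolding P[symmetric] by (rule emeasure_period_le)
  then have P8: "P \<le> 8" using pi_less_4 by (subst (asm) ennreal_le_iff) auto
  have b1: "P * cmod d \<le> 30 * \<eta>"
  proof (cases "d = 0")
    case False
    have "ennreal P \<le> ennreal (30 * (\<eta> / cmod d))"
      unfolding P[symmetric] E_def by (rule arc_measure[OF False s \<eta>])
    then have "P \<le> 30 * (\<eta> / cmod d)" using \<eta> by (subst (asm) ennreal_le_iff) auto
    then show ?thesis using False by (simp add: field_simps)
  qed (use \<eta> in simp)
  have b2: "P * cmod a \<le> 30 * \<eta>"
  proof (cases "a = 0")
    case False
    have "cmod (a - cis (2 * s * r) * d) = cmod (d - cis (2 * (- s) * r) * a)" for r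
    proof -
      have "cis (2 * s * r) * (d - cis (2 * (- s) * r) * a) = - (a - cis (2 * s * r) * d)"
      proof -
        have "cis (2 * s * r) * cis (2 * (- s) * r) = 1" by (simp add: cis_mult)
        then show ?thesis unfolding right_diff_distrib mult.assoc[symmetric] by simp
      qed
      then have "cmod (cis (2 * s * r) * (d - cis (2 * (- s) * r) * a)) = cmod (a - cis (2 * s * r) * d)"
        by (simp only: norm_minus_cancel)
      then show ?thesis by (simp add: norm_mult)
    qed
    then have "E = {r \<in> {0..2 * pi}. cmod (d - cis (2 * (- s) * r) * a) \<le> \<eta>}" by (simp add: E_def)
    then have "ennreal P \<le> ennreal (30 * (\<eta> / cmod a))"
      unfolding P[symmetric] using arc_measure[OF False, of "- s" \<eta> d] s \<eta> by simp
    then have "P \<le> 30 * (\<eta> / cmod a)" using \<eta> by (subst (asm) ennreal_le_iff) auto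
    then show ?thesis using False by (simp add: field_simps)
  qed (use \<eta> in simp)
  have "closed {r. cmod (a - cis (2 * s * r) * d) \<le> \<eta>}"
    by (intro closed_Collect_le continuous_intros)
  then have "{0..2 * pi} \<inter> {r. cmod (a - cis (2 * s * r) * d) \<le> \<eta>} \<in> sets (restrict_space borel {0..2 * pi})"
    by (intro sets_restrict_space_iff[THEN iffD2] conjI sets.Int borel_closed) auto
  moreover have "{0..2 * pi} \<inter> {r. cmod (a - cis (2 * s * r) * d) \<le> \<eta>} = E" by (auto simp: E_def)
  ultimately have "E \<in> sets period" unfolding sets_period by simp
  then show ?thesis
    using P P8 b1 b2 by (intro that[of P E]) (auto simp: P_def max_def E_def)
qed

text \<open>\<open>T\<close> is the contribution of the angles for which the rotated matrix is
  diagonal up to \<open>\<delta> * norm g\<close>. Its two bounds use the admissible angles in two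
  ways, without and with the size of the smaller pair of entries.\<close>

lemma zonal_near:
  obtains C where "C > 0"
    "\<And>l X g \<delta>. spherical \<sigma> l X \<Longrightarrow> l \<ge> 1 \<Longrightarrow> g \<in> SL2C \<Longrightarrow> \<delta> \<ge> 0 \<Longrightarrow>
       \<bar>cmod (g$1$1) - cmod (g$2$2)\<bar> \<le> \<delta> * norm g \<Longrightarrow> \<bar>cmod (g$1$2) - cmod (g$2$1)\<bar> \<le> \<delta> * norm g \<Longrightarrow>
       \<exists>T. 0 \<le> T \<and> spherical.zonal \<sigma> l X g \<le> T + C * (real l)\<^sup>2 * exp (- (l * \<delta>\<^sup>2 / 12)) \<and>
         T \<le> C * (sqrt (real l) * \<delta>) \<and> T * (sqrt (real l) * infdist g mono_SU2) \<le> C * (l * \<delta>\<^sup>2)"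
proof -
  \<comment> \<open>The exponent 1 leaves decay like \<open>1 / norm g\<close>, which cancels the
    factor \<open>n\<close> in the estimate \<open>key\<close>.\<close>
  obtain C1 where C1: "C1 > 0"
    "\<And>l X g. spherical \<sigma> l X \<Longrightarrow> l \<ge> 1 \<Longrightarrow> g \<in> SL2C \<Longrightarrow>
       real (2 * l + 1) * cmod (spherical.coef \<sigma> l X 0 g) \<le> C1 * norm g powr (- 2 + 1)"
    by (rule coef_0_bound[of 1]) auto
  obtain C2 where C2: "C2 > 0"
    "\<And>l X g. spherical \<sigma> l X \<Longrightarrow> l \<ge> 1 \<Longrightarrow> g \<in> SL2C \<Longrightarrow>
       real (2 * l + 1) * cmod (spherical.coef \<sigma> l X 0 g) \<le> 
       C2 * l * exp (- (l * ((cmod (g$1$2) + cmod (g$2$1)) / norm g)\<^sup>2 / 12))"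
    by (rule coef_0_decay) blast
  \<comment> \<open>\<open>200000 * C1\<close> is twice the constant of \<open>key\<close> and also
    exceeds the \<open>960 * C1\<close> in the first bound on \<open>T\<close>;
    \<open>2 * C2\<close> is for the exponentially small part.\<close>
  define C where "C = 200000 * C1 + 2 * C2"
  have "\<exists>T. 0 \<le> T \<and> spherical.zonal \<sigma> l X g \<le> T + C * (real l)\<^sup>2 * exp (- (l * \<delta>\<^sup>2 / 12)) \<and>
         T \<le> C * (sqrt (real l) * \<delta>) \<and> T * (sqrt (real l) * infdist g mono_SU2) \<le> C * (l * \<delta>\<^sup>2)"
    if X: "spherical \<sigma> l X" and l: "l \<ge> 1" and g: "g \<in> SL2C" and \<delta>: "\<delta> \<ge> 0"
      and ad: "\<bar>cmod (g$1$1) - cmod (g$2$2)\<bar> \<le> \<delta> * norm g" and bc: "\<bar>cmod (g$1$2) - cmod (g$2$1)\<bar> \<le> \<delta> * norm g"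
    for l X g \<delta>
  proof -
    interpret spherical \<sigma> l X by (rule X)
    define n where "n = norm g"
    have n: "n \<ge> 1" using norm_SL2C_ge(2)[OF g] by (simp add: n_def)
    define \<Delta> where "\<Delta> = infdist g mono_SU2"
    have \<Delta>: "\<Delta> \<ge> 0" by (simp add: \<Delta>_def infdist_nonneg)
    define p r where "p = max (cmod (g$1$1)) (cmod (g$2$2))" and "r = max (cmod (g$1$2)) (cmod (g$2$1))"
    have pr0: "0 \<le> p" "0 \<le> r" by (auto simp: p_def r_def le_max_iff_disj)
    have "(cmod (g$1$1))\<^sup>2 \<le> p\<^sup>2" "(cmod (g$2$2))\<^sup>2 \<le> p\<^sup>2" "(cmod (g$1$2))\<^sup>2 \<le> r\<^sup>2" "(cmod (g$2$1))\<^sup>2 \<le> r\<^sup>2"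
      by (auto simp: p_def r_def intro!: power_mono)
    then have "n\<^sup>2 \<le> 2 * p\<^sup>2 + 2 * r\<^sup>2" unfolding n_def norm_mat_sq by linarith
    moreover have "p\<^sup>2 \<le> (max p r)\<^sup>2" "r\<^sup>2 \<le> (max p r)\<^sup>2" using pr0 by (auto intro!: power_mono)
    ultimately have "n\<^sup>2 \<le> (2 * max p r)\<^sup>2" by (simp only: power_mult_distrib) simp
    then have npr: "n \<le> 2 * max p r" by (rule power2_le_imp_le) (use pr0 in auto)
    obtain P E where P: "P \<ge> 0" "P \<le> 8" "P * p \<le> 30 * (\<delta> * n)" and E: "E \<in> sets period" "emeasure period E \<le> ennreal P" 
      "\<And>x. x \<in> {0..2 * pi} \<Longrightarrow> cmod (g$1$1 - cis (2 * (- 1) * x) * g$2$2) \<le> \<delta> * n \<Longrightarrow> x \<in> E"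
      unfolding p_def using \<delta> n by (elim arc_set[of "- 1" "\<delta> * n" "g$1$1" "g$2$2", rotated 2]) auto
    obtain P' E' where P': "P' \<ge> 0" "P' \<le> 8" "P' * r \<le> 30 * (\<delta> * n)" and E': "E' \<in> sets period" "emeasure period E' \<le> ennreal P'" 
      "\<And>x. x \<in> {0..2 * pi} \<Longrightarrow> cmod (g$1$2 - cis (2 * 1 * x) * g$2$1) \<le> \<delta> * n \<Longrightarrow> x \<in> E'"
      unfolding r_def using \<delta> n by (elim arc_set[of 1 "\<delta> * n" "g$1$2" "g$2$1", rotated 2]) auto
    have small: "P * P' \<le> 480 * \<delta>" "P * P' * min p r \<le> 1800 * \<delta>\<^sup>2 * n"
    proof -
      \<comment> \<open>\<open>Q\<close> belongs to the pair with the larger maximum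
        \<open>s\<close>, which is at least \<open>n / 2\<close>; hence
        \<open>Q \<le> 60 * \<delta>\<close>. The other measure is bounded once by 8 and once
        through \<open>Q' * s'\<close>.\<close>
      have *: "Q * Q' \<le> 480 * \<delta> \<and> Q * Q' * s' \<le> 1800 * \<delta>\<^sup>2 * n"
        if Q: "0 \<le> Q" "Q \<le> 8" "Q * s \<le> 30 * (\<delta> * n)" and Q': "0 \<le> Q'" "Q' \<le> 8" "Q' * s' \<le> 30 * (\<delta> * n)" and s: "n \<le> 2 * s"
        for Q Q' s s' :: real
      proof -
        have "Q * n \<le> Q * (2 * s)" using Q s by (intro mult_left_mono) auto
        then have "Q * n \<le> 60 * \<delta> * n" using Q by simp
        then have Q60: "Q \<le> 60 * \<delta>" using n by (simp add: mult_right_le_imp_le)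
        then have "Q * Q' \<le> 60 * \<delta> * 8" using Q Q' \<delta> by (intro mult_mono) auto
        moreover have "Q * (Q' * s') \<le> Q * (30 * (\<delta> * n))" using Q Q' by (intro mult_left_mono) auto
        moreover have "Q * (30 * (\<delta> * n)) \<le> 60 * \<delta> * (30 * (\<delta> * n))" using Q60 \<delta> n by (intro mult_right_mono) auto
        ultimately show ?thesis by (simp add: power2_eq_square mult_ac)
      qed
      have "P * P' \<le> 480 * \<delta> \<and> P * P' * min p r \<le> 1800 * \<delta>\<^sup>2 * n"
      proof (cases "r \<le> p")
        case True
        then show ?thesis using *[OF P P'] npr by (simp add: max_def min_def split: if_splits)
      next
        case False
        then show ?thesis using *[OF P' P] npr by (simp add: max_def min_def mult.commute split: if_splits)
      qed
      then show "P * P' \<le> 480 * \<delta>" "P * P' * min p r \<le> 1800 * \<delta>\<^sup>2 * n" by auto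
    qed
    define B2 where "B2 = C2 * l * exp (- (l * \<delta>\<^sup>2 / 12))"
    define T where "T = 2 * sqrt (real l) * (C1 / n * P * P')"
    have T0: "0 \<le> T" using C1(1) P P' n by (simp add: T_def)
    have "zonal g \<le> 2 * sqrt (real l) * (C1 / n * P * P' + B2)"
    proof (rule zonal_le[OF l g E(1,2) P(1) E'(1,2) P'(1)])
      fix \<alpha> \<beta> assume \<alpha>: "\<alpha> \<in> {0..2 * pi}" and \<beta>: "\<beta> \<in> {0..2 * pi}"
      define h where "h = equator_conj g \<alpha> \<beta>"
      have h: "h \<in> SL2C" "norm h = n" by (simp_all add: h_def n_def equator_conj_facts[OF g])
      define m where "m = cmod (h$1$2) + cmod (h$2$1)"
      show "real (2 * l + 1) * cmod (coef 0 (equator_conj g \<alpha> \<beta>)) \<le> C1 / n * indicator E \<alpha> * indicator E' \<beta> + B2"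
      proof (cases "m \<le> \<delta> * n")
        case True
        then have "\<alpha> \<in> E" "\<beta> \<in> E'"
          using equator_conj_facts(3)[OF g, of \<alpha> \<beta>] equator_conj_facts(4)[OF g, of \<beta> \<alpha>] \<alpha> \<beta>
          by (auto intro!: E(3) E'(3) simp: m_def h_def)
        moreover have "n powr (- 2 + 1) = 1 / n" using n by (simp add: powr_minus_divide)
        then have "real (2 * l + 1) * cmod (coef 0 h) \<le> C1 / n" using C1(2)[OF X l h(1)] by (simp add: h(2))
        ultimately show ?thesis using C2(1) by (simp add: h_def B2_def add_increasing2)
      next
        case False
        then have "\<delta> \<le> m / n" using n by (simp add: le_divide_eq)
        then have "\<delta>\<^sup>2 \<le> (m / n)\<^sup>2" using \<delta> by (intro power_mono) auto
        then have "l * \<delta>\<^sup>2 / 12 \<le> l * (m / n)\<^sup>2 / 12" by (intro divide_right_mono mult_left_mono) auto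
        then have "C2 * l * exp (- (l * (m / n)\<^sup>2 / 12)) \<le> B2"
          unfolding B2_def using C2(1) by (intro mult_left_mono) auto
        moreover have "real (2 * l + 1) * cmod (coef 0 h) \<le> C2 * l * exp (- (l * (m / n)\<^sup>2 / 12))"
          using C2(2)[OF X l h(1)] by (simp add: h(2) m_def)
        ultimately show ?thesis using C1(1) n by (simp add: h_def add_increasing)
      qed
    qed (use C1(1) C2(1) n in \<open>auto simp: B2_def\<close>)
    then have z: "zonal g \<le> T + 2 * sqrt (real l) * B2" by (simp add: T_def distrib_left)
    have "sqrt (real l) \<le> real l" using l by (intro real_le_lsqrt) (auto simp: power2_eq_square)
    then have "sqrt (real l) * B2 \<le> real l * B2" using C2(1) by (intro mult_right_mono) (auto simp: B2_def)
    also have "\<dots> = C2 * (real l)\<^sup>2 * exp (- (l * \<delta>\<^sup>2 / 12))" by (simp add: B2_def power2_eq_square)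
    finally have "2 * sqrt (real l) * B2 \<le> 2 * C2 * ((real l)\<^sup>2 * exp (- (l * \<delta>\<^sup>2 / 12)))" by simp
    also have "\<dots> \<le> C * ((real l)\<^sup>2 * exp (- (l * \<delta>\<^sup>2 / 12)))"
      using C1(1) by (intro mult_right_mono) (auto simp: C_def)
    finally have z2: "zonal g \<le> T + C * (real l)\<^sup>2 * exp (- (l * \<delta>\<^sup>2 / 12))" using z by (simp add: mult.assoc)
    have T1: "T \<le> C * (sqrt (real l) * \<delta>)"
    proof -
      have "C1 / n \<le> C1" using C1(1) n by (simp add: divide_le_eq)
      then have "C1 / n * (P * P') \<le> C1 * (480 * \<delta>)" using C1(1) P P' n by (intro mult_mono[OF _ small(1)]) auto
      then have "T \<le> 2 * sqrt (real l) * (C1 * (480 * \<delta>))" unfolding T_def by (intro mult_left_mono) (auto simp: mult.assoc)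
      also have "\<dots> = (960 * C1) * (sqrt (real l) * \<delta>)" by simp
      also have "\<dots> \<le> C * (sqrt (real l) * \<delta>)" using C1(1) C2(1) \<delta> by (intro mult_right_mono) (auto simp: C_def)
      finally show ?thesis .
    qed
    \<comment> \<open>For small \<open>\<delta>\<close> the distance is controlled by the smaller
      maximum. Otherwise \<open>1 \<le> 8 * \<delta>\<close>, and the trivial bound
      \<open>3 * n\<close> for the distance suffices.\<close>
    have key: "P * P' * \<Delta> \<le> 100000 * \<delta>\<^sup>2 * n"
    proof (cases "\<delta> < 1/8")
      case True
      have d: "\<Delta> \<le> 32 * (min p r + \<delta>)"
        unfolding \<Delta>_def p_def r_def by (rule infdist_mono_le[OF g \<delta> True ad bc])
      have "P * P' * \<Delta> \<le> P * P' * (32 * (min p r + \<delta>))" using P P' d by (intro mult_left_mono) auto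
      also have "\<dots> = 32 * (P * P' * min p r) + 32 * (P * P' * \<delta>)" by (simp add: algebra_simps)
      also have "\<dots> \<le> 32 * (1800 * \<delta>\<^sup>2 * n) + 32 * (480 * \<delta> * \<delta>)"
        using small \<delta> by (intro add_mono mult_left_mono mult_right_mono) auto
      also have "480 * \<delta> * \<delta> \<le> 480 * \<delta>\<^sup>2 * n"
        using n mult_left_mono[of 1 n "480 * \<delta>\<^sup>2"] by (simp add: power2_eq_square)
      finally have "P * P' * \<Delta> \<le> 72960 * (\<delta>\<^sup>2 * n)" by (simp add: mult_ac)
      moreover have "0 \<le> \<delta>\<^sup>2 * n" using n by simp
      ultimately show ?thesis by linarith
    next
      case False
      have "\<Delta> \<le> 3 * n" using infdist_mono_triv[of g] n by (simp add: \<Delta>_def n_def)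
      then have "P * P' * \<Delta> \<le> 480 * \<delta> * (3 * n)" using \<open>\<Delta> \<le> 3 * n\<close> \<delta> \<Delta> by (intro mult_mono[OF small(1)]) auto
      also have "\<dots> \<le> 480 * \<delta> * (3 * n) * (8 * \<delta>)" using False \<delta> n mult_left_mono[of 1 "8 * \<delta>" "480 * \<delta> * (3 * n)"] by simp
      also have "\<dots> = 11520 * (\<delta>\<^sup>2 * n)" by (simp add: power2_eq_square)
      finally have "P * P' * \<Delta> \<le> 11520 * (\<delta>\<^sup>2 * n)" .
      moreover have "0 \<le> \<delta>\<^sup>2 * n" using n by simp
      ultimately show ?thesis by linarith
    qed
    have "T * (sqrt (real l) * \<Delta>) = 2 * real l * (C1 / n) * (P * P' * \<Delta>)"
      by (simp add: T_def mult_ac)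
    also have "\<dots> \<le> 2 * real l * (C1 / n) * (100000 * \<delta>\<^sup>2 * n)"
      using key C1(1) n by (intro mult_left_mono) auto
    also have "\<dots> = 200000 * C1 * (l * \<delta>\<^sup>2)" using n by simp
    also have "\<dots> \<le> C * (l * \<delta>\<^sup>2)" using C2(1) by (intro mult_right_mono) (auto simp: C_def)
    finally have T2: "T * (sqrt (real l) * \<Delta>) \<le> C * (l * \<delta>\<^sup>2)" .
    show ?thesis using T0 z2 T1 T2 unfolding \<Delta>_def by blast
  qed
  moreover have "C > 0" using C1(1) C2(1) by (simp add: C_def)
  ultimately show ?thesis by (intro that[of C]) auto
qed

end

section \<open>Logarithmic thresholds and powers of l\<close>

lemma D_fun_le:
  "D_fun g \<le> 4 * norm g * max \<bar>cmod (g$1$1) - cmod (g$2$2)\<bar> \<bar>cmod (g$1$2) - cmod (g$2$1)\<bar>"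
proof -
  have *: "\<bar>(cmod x)\<^sup>2 - (cmod y)\<^sup>2\<bar> \<le> 2 * norm g * M"
    if "cmod x \<le> norm g" "cmod y \<le> norm g" "\<bar>cmod x - cmod y\<bar> \<le> M" for x y M
  proof -
    have "\<bar>(cmod x)\<^sup>2 - (cmod y)\<^sup>2\<bar> = (cmod x + cmod y) * \<bar>cmod x - cmod y\<bar>"
      by (simp add: power2_eq_square square_diff_square_factored abs_mult)
    also have "\<dots> \<le> (2 * norm g) * M" using that by (intro mult_mono) auto
    finally show ?thesis .
  qed
  show ?thesis
    using *[OF norm_entry_le norm_entry_le max.cobounded1, of 1 1 2 2 "\<bar>cmod (g$1$2) - cmod (g$2$1)\<bar>"]
      *[OF norm_entry_le norm_entry_le max.cobounded2, of 1 2 2 1 "\<bar>cmod (g$1$1) - cmod (g$2$2)\<bar>"]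
    unfolding D_fun_def by linarith
qed

lemma exp_ln_bound:
  assumes "l \<ge> 1" "B * ln (real l) \<le> A"
  shows "exp (- A) \<le> real l powr (- B)"
proof -
  have "exp (- A) \<le> exp (- (B * ln (real l)))" using assms by simp
  also have "\<dots> = real l powr (- B)" using assms by (simp add: powr_def)
  finally show ?thesis .
qed

lemma power2_powr_mult: "l \<ge> 1 \<Longrightarrow> (real l)\<^sup>2 * real l powr (- (\<Lambda> + 2)) = real l powr (- \<Lambda>)"
proof -
  assume "l \<ge> 1"
  then have "(real l)\<^sup>2 = real l powr 2" by simp
  then have "(real l)\<^sup>2 * real l powr (- (\<Lambda> + 2)) = real l powr (2 + - (\<Lambda> + 2))"
    by (simp only: powr_add)
  then show ?thesis by simp
qed

text \<open>The threshold for \<open>D_fun\<close> has \<open>ln l\<close> rather than its root, so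
  the exponent it produces contains the square of the logarithm. This trades the square for the
  logarithm; at \<open>l = 1\<close> both sides vanish.\<close>

lemma ln_sq_ge: "l \<ge> 1 \<Longrightarrow> ln (real l) \<le> 2 * (ln (real l))\<^sup>2"
proof (cases "l = 1")
  case False
  assume "l \<ge> 1"
  with False have l: "real l \<ge> 2" by simp
  have "1 - 1 / 2 \<le> ln (2 :: real)" using ln_one_minus_pos_upper_bound[of "1/2 :: real"] by (simp add: ln_div)
  also have "\<dots> \<le> ln (real l)" using l by simp
  finally have "1 \<le> 2 * ln (real l)" by simp
  then have "1 * ln (real l) \<le> (2 * ln (real l)) * ln (real l)" using l by (intro mult_right_mono) auto
  then show ?thesis by (simp add: power2_eq_square)
qed simp

text \<open>For \<open>s = sqrt l * \<delta>\<close>: the two bounds on \<open>T\<close> involve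
  \<open>s\<close> and its square, and \<open>2 * s \<le> 1 + s^2\<close> reduces the first to the
  second.\<close>

lemma ln_powr_absorb:
  assumes "l \<ge> 1" "\<epsilon> > 0" "s\<^sup>2 = K * ln (real l)" "K \<ge> 0"
  shows "s\<^sup>2 \<le> (1 + K / \<epsilon>) * real l powr \<epsilon>" "s \<le> (1 + K / \<epsilon>) * real l powr \<epsilon>"
proof -
  have "ln (real l) \<le> real l powr \<epsilon> / \<epsilon>" using assms by (intro ln_powr_bound) auto
  then have "s\<^sup>2 \<le> K * (real l powr \<epsilon> / \<epsilon>)" unfolding assms(3) using assms(4) by (rule mult_left_mono)
  also have "\<dots> = K / \<epsilon> * real l powr \<epsilon>" by simp
  finally have "s\<^sup>2 \<le> K / \<epsilon> * real l powr \<epsilon>" .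
  moreover have "1 \<le> real l powr \<epsilon>" using assms by (intro ge_one_powr_ge_zero) auto
  moreover have "2 * s \<le> 1 + s\<^sup>2" using zero_le_power2[of "s - 1"]
    by (simp add: power2_eq_square algebra_simps)
  moreover have "0 \<le> s\<^sup>2" by simp
  ultimately show "s\<^sup>2 \<le> (1 + K / \<epsilon>) * real l powr \<epsilon>" "s \<le> (1 + K / \<epsilon>) * real l powr \<epsilon>"
    unfolding distrib_right by linarith+
qed

context sphere_measure begin

lemma zonal_bound:
  assumes \<epsilon>: "\<epsilon> > 0" and \<Lambda>: "\<Lambda> > 0"
  obtains C where
    "\<And>l X g. spherical \<sigma> l X \<Longrightarrow> l \<ge> 1 \<Longrightarrow> g \<in> SL2C \<Longrightarrow> spherical.zonal \<sigma> l X g \<le>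
      C * (real l powr \<epsilon> * (if infdist g mono_SU2 = 0 then 1 else min 1 (1 / (sqrt (real l) * infdist g mono_SU2))) + real l powr (- \<Lambda>))"
proof -
  obtain C1 where C1: "C1 > 0"
    "\<And>l X g t. spherical \<sigma> l X \<Longrightarrow> l \<ge> 1 \<Longrightarrow> g \<in> SL2C \<Longrightarrow> t \<ge> 0 \<Longrightarrow>
       t * norm g \<le> max \<bar>cmod (g$1$1) - cmod (g$2$2)\<bar> \<bar>cmod (g$1$2) - cmod (g$2$1)\<bar> \<Longrightarrow>
       spherical.zonal \<sigma> l X g \<le> C1 * (real l)\<^sup>2 * exp (- (l * t\<^sup>2 / 12))"
    by (rule zonal_far) blast
  obtain C2 where C2: "C2 > 0"
    "\<And>l X g \<delta>. spherical \<sigma> l X \<Longrightarrow> l \<ge> 1 \<Longrightarrow> g \<in> SL2C \<Longrightarrow> \<delta> \<ge> 0 \<Longrightarrow>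
       \<bar>cmod (g$1$1) - cmod (g$2$2)\<bar> \<le> \<delta> * norm g \<Longrightarrow> \<bar>cmod (g$1$2) - cmod (g$2$1)\<bar> \<le> \<delta> * norm g \<Longrightarrow>
       \<exists>T. 0 \<le> T \<and> spherical.zonal \<sigma> l X g \<le> T + C2 * (real l)\<^sup>2 * exp (- (l * \<delta>\<^sup>2 / 12)) \<and>
         T \<le> C2 * (sqrt (real l) * \<delta>) \<and> T * (sqrt (real l) * infdist g mono_SU2) \<le> C2 * (l * \<delta>\<^sup>2)"
    by (rule zonal_near) blast
  \<comment> \<open>With this \<open>K\<close> the exponential becomes at most
    \<open>l powr (- (\<Lambda> + 2))\<close>; 12 is the denominator in the exponent, and the extra
    2 pays for the factor \<open>l\<^sup>2\<close>.\<close>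
  define K where "K = 12 * (\<Lambda> + 2)"
  define A where "A = 1 + K / \<epsilon>"
  define C where "C = C1 + C2 + C2 * A"
  have K: "K \<ge> 0" using \<Lambda> by (simp add: K_def)
  have A: "A \<ge> 0" using K \<epsilon> by (simp add: A_def)
  have "spherical.zonal \<sigma> l X g \<le>
      C * (real l powr \<epsilon> * (if infdist g mono_SU2 = 0 then 1 else min 1 (1 / (sqrt (real l) * infdist g mono_SU2))) + real l powr (- \<Lambda>))"
    if X: "spherical \<sigma> l X" and l: "l \<ge> 1" and g: "g \<in> SL2C" for l X g
  proof -
    interpret spherical \<sigma> l X by (rule X)
    define \<Delta> where "\<Delta> = infdist g mono_SU2"
    have \<Delta>: "\<Delta> \<ge> 0" by (simp add: \<Delta>_def infdist_nonneg)
    define R where "R = (if \<Delta> = 0 then 1 else min 1 (1 / (sqrt (real l) * \<Delta>)))"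
    have R: "R \<ge> 0" using \<Delta> by (simp add: R_def)
    define \<delta> where "\<delta> = sqrt (K * ln (real l) / l)"
    have ln0: "0 \<le> ln (real l)" using l by simp
    have \<delta>: "\<delta> \<ge> 0" using K ln0 by (simp add: \<delta>_def)
    have l\<delta>: "l * \<delta>\<^sup>2 = K * ln (real l)" using K ln0 l by (simp add: \<delta>_def)
    have "exp (- (l * \<delta>\<^sup>2 / 12)) \<le> real l powr (- (\<Lambda> + 2))"
      by (rule exp_ln_bound[OF l]) (simp add: l\<delta> K_def algebra_simps)
    then have "(real l)\<^sup>2 * exp (- (l * \<delta>\<^sup>2 / 12)) \<le> (real l)\<^sup>2 * real l powr (- (\<Lambda> + 2))" by (intro mult_left_mono) auto
    then have decay: "(real l)\<^sup>2 * exp (- (l * \<delta>\<^sup>2 / 12)) \<le> real l powr (- \<Lambda>)" unfolding power2_powr_mult[OF l] .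
    have "zonal g \<le> C2 * A * (real l powr \<epsilon> * R) + (C1 + C2) * real l powr (- \<Lambda>)"
    proof (cases "\<bar>cmod (g$1$1) - cmod (g$2$2)\<bar> \<le> \<delta> * norm g \<and> \<bar>cmod (g$1$2) - cmod (g$2$1)\<bar> \<le> \<delta> * norm g")
      case False
      then have "\<delta> * norm g \<le> max \<bar>cmod (g$1$1) - cmod (g$2$2)\<bar> \<bar>cmod (g$1$2) - cmod (g$2$1)\<bar>" by auto
      from C1(2)[OF X l g \<delta> this] have "zonal g \<le> C1 * ((real l)\<^sup>2 * exp (- (l * \<delta>\<^sup>2 / 12)))" by (simp add: mult.assoc)
      also have "\<dots> \<le> C1 * real l powr (- \<Lambda>)" using C1(1) decay by (intro mult_left_mono) auto
      finally have "zonal g \<le> C1 * real l powr (- \<Lambda>)" .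
      moreover have "0 \<le> C2 * A * (real l powr \<epsilon> * R)" "0 \<le> C2 * real l powr (- \<Lambda>)" using C2(1) A R by auto
      ultimately show ?thesis unfolding distrib_right by linarith
    next
      case True
      then obtain T where T: "0 \<le> T" "zonal g \<le> T + C2 * (real l)\<^sup>2 * exp (- (l * \<delta>\<^sup>2 / 12))"
         "T \<le> C2 * (sqrt (real l) * \<delta>)" "T * (sqrt (real l) * \<Delta>) \<le> C2 * (l * \<delta>\<^sup>2)"
        using C2(2)[OF X l g \<delta>] unfolding \<Delta>_def by blast
      have s: "(sqrt (real l) * \<delta>)\<^sup>2 = K * ln (real l)" using l\<delta> by (simp add: power_mult_distrib)
      note absorb = ln_powr_absorb[OF l \<epsilon> s K, folded A_def]
      have "C2 * (sqrt (real l) * \<delta>) \<le> C2 * (A * real l powr \<epsilon>)" using absorb(2) C2(1) by (intro mult_left_mono) auto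
      with T(3) have T1: "T \<le> C2 * A * real l powr \<epsilon>" by simp
      have "C2 * (l * \<delta>\<^sup>2) \<le> C2 * (A * real l powr \<epsilon>)" using absorb(1) C2(1) unfolding s l\<delta> by (intro mult_left_mono) auto
      with T(4) have T2: "T * (sqrt (real l) * \<Delta>) \<le> C2 * A * real l powr \<epsilon>" by simp
      \<comment> \<open>The two bounds on \<open>T\<close> are the two entries of the
        minimum.\<close>
      have "T \<le> C2 * A * (real l powr \<epsilon> * R)"
      proof (cases "\<Delta> = 0")
        case True
        then show ?thesis using T1 by (simp add: R_def)
      next
        case False
        then have "sqrt (real l) * \<Delta> > 0" using \<Delta> l by simp
        then have "T \<le> (C2 * A * real l powr \<epsilon>) / (sqrt (real l) * \<Delta>)" using T2 by (simp only: pos_le_divide_eq)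
        then show ?thesis using T1 False by (simp add: R_def min_def mult.assoc)
      qed
      moreover have "C2 * (real l)\<^sup>2 * exp (- (l * \<delta>\<^sup>2 / 12)) \<le> C2 * real l powr (- \<Lambda>)"
        unfolding mult.assoc using C2(1) decay by (intro mult_left_mono) auto
      moreover have "0 \<le> C1 * real l powr (- \<Lambda>)" using C1(1) by simp
      ultimately show ?thesis using T(2) unfolding distrib_right by linarith
    qed
    also have "\<dots> \<le> C * (real l powr \<epsilon> * R) + C * real l powr (- \<Lambda>)"
      using C1(1) C2(1) A R by (intro add_mono mult_right_mono) (auto simp: C_def)
    finally show ?thesis by (simp only: R_def \<Delta>_def distrib_left)
  qed
  then show ?thesis by (rule that)
qed

text \<open>Threshold and bound share one constant in the theorem, and that constant also serves the
  extreme weights. Hence the form for all \<open>K\<close> above \<open>K0\<close>.\<close>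

lemma zonal_decay:
  assumes \<Lambda>: "\<Lambda> > 0"
  obtains K0 where
    "\<And>K l X g. K \<ge> K0 \<Longrightarrow> spherical \<sigma> l X \<Longrightarrow> l \<ge> 1 \<Longrightarrow> g \<in> SL2C \<Longrightarrow>
      \<not> D_fun g \<le> K * (norm g)\<^sup>2 * ln (real l) / sqrt (real l) \<Longrightarrow> spherical.zonal \<sigma> l X g \<le> K * real l powr (- \<Lambda>)"
proof -
  obtain C where C: "C > 0"
    "\<And>l X g t. spherical \<sigma> l X \<Longrightarrow> l \<ge> 1 \<Longrightarrow> g \<in> SL2C \<Longrightarrow> t \<ge> 0 \<Longrightarrow>
       t * norm g \<le> max \<bar>cmod (g$1$1) - cmod (g$2$2)\<bar> \<bar>cmod (g$1$2) - cmod (g$2$1)\<bar> \<Longrightarrow>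
       spherical.zonal \<sigma> l X g \<le> C * (real l)\<^sup>2 * exp (- (l * t\<^sup>2 / 12))"
    by (rule zonal_far) blast
  \<comment> \<open>\<open>384 = 2 * 4^2 * 12\<close>: 2 from \<open>ln_sq_ge\<close>, 4 from
    \<open>D_fun_le\<close>, and 12 from the exponent in \<open>zonal_far\<close>. The summand 2
    pays for \<open>l\<^sup>2\<close>.\<close>
  define K0 where "K0 = max C (384 * (\<Lambda> + 2))"
  have "spherical.zonal \<sigma> l X g \<le> K * real l powr (- \<Lambda>)"
    if K: "K \<ge> K0" and X: "spherical \<sigma> l X" and l: "l \<ge> 1" and g: "g \<in> SL2C"
      and D: "\<not> D_fun g \<le> K * (norm g)\<^sup>2 * ln (real l) / sqrt (real l)" for K l X g
  proof -
    have K': "K \<ge> C" "K \<ge> 384 * (\<Lambda> + 2)" using K by (auto simp: K0_def)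
    have n: "norm g > 0" using norm_SL2C_ge(2)[OF g] by linarith
    have ln0: "0 \<le> ln (real l)" using l by simp
    define t where "t = K * ln (real l) / (4 * sqrt (real l))"
    have t: "t \<ge> 0" using C(1) K' ln0 by (simp add: t_def)
    define M where "M = max \<bar>cmod (g$1$1) - cmod (g$2$2)\<bar> \<bar>cmod (g$1$2) - cmod (g$2$1)\<bar>"
    have "4 * norm g * (t * norm g) = K * (norm g)\<^sup>2 * ln (real l) / sqrt (real l)"
      by (simp add: t_def power2_eq_square)
    also have "\<dots> \<le> 4 * norm g * M" using D D_fun_le[of g] by (simp add: M_def)
    finally have "t * norm g \<le> M" using n by simp
    from C(2)[OF X l g t this[unfolded M_def]] have "spherical.zonal \<sigma> l X g \<le> C * ((real l)\<^sup>2 * exp (- (l * t\<^sup>2 / 12)))" by (simp add: mult.assoc)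
    also have "\<dots> \<le> C * ((real l)\<^sup>2 * real l powr (- (\<Lambda> + 2)))"
    proof (intro mult_left_mono exp_ln_bound[OF l])
      have "384 * 1 \<le> K" using K' \<Lambda> by simp
      then have "384 * (\<Lambda> + 2) * 1 \<le> K * (K / 384)" using K' \<Lambda> by (intro mult_mono) auto
      then have "\<Lambda> + 2 \<le> K\<^sup>2 / 384 / 384" by (simp add: power2_eq_square)
      also have "\<dots> \<le> K\<^sup>2 / 384" by simp
      finally have "(\<Lambda> + 2) * ln (real l) \<le> K\<^sup>2 / 384 * (2 * (ln (real l))\<^sup>2)"
        using ln_sq_ge[OF l] ln0 by (intro mult_mono) auto
      also have "\<dots> = l * t\<^sup>2 / 12" using l by (simp add: t_def power_mult_distrib power_divide)
      finally show "(\<Lambda> + 2) * ln (real l) \<le> l * t\<^sup>2 / 12" .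
    qed (use C(1) in auto)
    also have "\<dots> = C * real l powr (- \<Lambda>)" by (simp only: power2_powr_mult[OF l])
    also have "\<dots> \<le> K * real l powr (- \<Lambda>)" using K' by (intro mult_right_mono) auto
    finally show ?thesis .
  qed
  then show ?thesis by (rule that)
qed

end

context spherical begin

text \<open>The coefficients of the two extreme weights are conjugate by the Weyl element.\<close>

lemma extreme_coef:
  assumes g: "g \<in> SL2C" and j: "j = 0 \<or> j = 2 * l"
  obtains h where "h \<in> SL2C" "norm h = norm g" "coef j g = coef 0 h"
    "cmod (h$1$2) + cmod (h$2$1) = cmod (g$1$2) + cmod (g$2$1)"
proof (cases "j = 0")
  case True
  with g show ?thesis by (intro that[of g]) auto
next
  case False
  define h where "h = mat2 (g$2$2) (- g$2$1) (- g$1$2) (g$1$1)"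
  have "h \<in> SL2C" using g by (simp add: h_def SL2C_mat2 SL2C_def det_2 mult.commute)
  moreover have "(norm h)\<^sup>2 = (norm g)\<^sup>2" unfolding norm_mat_sq by (simp add: h_def)
  ultimately show ?thesis
    using coef_top[OF g] False j by (intro that[of h]) (auto simp: h_def)
qed

end

context sphere_measure begin

lemma extreme_bound:
  assumes \<epsilon>: "\<epsilon> > 0"
  obtains C where "C > 0"
    "\<And>l X g j. spherical \<sigma> l X \<Longrightarrow> l \<ge> 1 \<Longrightarrow> g \<in> SL2C \<Longrightarrow> j = 0 \<or> j = 2 * l \<Longrightarrow>
       real (2 * l + 1) * cmod (spherical.coef \<sigma> l X j g) \<le> C * norm g powr (- 2 + \<epsilon>) * real l powr \<epsilon>"
proof -
  \<comment> \<open>The estimate behind \<open>coef_0_bound\<close> is restricted to exponents up to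
    1. Since \<open>norm g \<ge> 1\<close>, the result for \<open>\<eta>\<close> implies the one for
    \<open>\<epsilon>\<close>.\<close>
  define \<eta> where "\<eta> = min \<epsilon> 1"
  have \<eta>: "0 < \<eta>" "\<eta> \<le> 1" "\<eta> \<le> \<epsilon>" using \<epsilon> by (auto simp: \<eta>_def)
  obtain C where C: "C > 0"
    "\<And>l X g. spherical \<sigma> l X \<Longrightarrow> l \<ge> 1 \<Longrightarrow> g \<in> SL2C \<Longrightarrow>
       real (2 * l + 1) * cmod (spherical.coef \<sigma> l X 0 g) \<le> C * norm g powr (- 2 + \<eta>)"
    by (rule coef_0_bound[OF \<eta>(1,2)]) blast
  have "real (2 * l + 1) * cmod (spherical.coef \<sigma> l X j g) \<le> C * norm g powr (- 2 + \<epsilon>) * real l powr \<epsilon>"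
    if X: "spherical \<sigma> l X" and l: "l \<ge> 1" and g: "g \<in> SL2C" and j: "j = 0 \<or> j = 2 * l" for l X g j
  proof -
    interpret spherical \<sigma> l X by (rule X)
    obtain h where h: "h \<in> SL2C" "norm h = norm g" "coef j g = coef 0 h"
      by (rule extreme_coef[OF g j]) 
    have "real (2 * l + 1) * cmod (coef j g) \<le> C * norm g powr (- 2 + \<eta>)"
      using C(2)[OF X l h(1)] by (simp add: h)
    also have "\<dots> \<le> C * norm g powr (- 2 + \<epsilon>) * 1"
      using C(1) \<eta>(3) norm_SL2C_ge(2)[OF g] by (simp add: powr_mono)
    also have "\<dots> \<le> C * norm g powr (- 2 + \<epsilon>) * real l powr \<epsilon>"
      using C(1) l \<epsilon> by (intro mult_left_mono ge_one_powr_ge_zero) auto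
    finally show ?thesis .
  qed
  with C(1) show ?thesis by (rule that)
qed

lemma extreme_decay:
  assumes \<Lambda>: "\<Lambda> > 0"
  obtains K0 where
    "\<And>K l X g j. K \<ge> K0 \<Longrightarrow> spherical \<sigma> l X \<Longrightarrow> l \<ge> 1 \<Longrightarrow> g \<in> SL2C \<Longrightarrow> j = 0 \<or> j = 2 * l \<Longrightarrow>
      \<not> infdist g diag_SL2C \<le> K * norm g * sqrt (ln (real l)) / sqrt (real l) \<Longrightarrow> 
      real (2 * l + 1) * cmod (spherical.coef \<sigma> l X j g) \<le> K * real l powr (- \<Lambda>)"
proof -
  obtain C where C: "C > 0"
    "\<And>l X g. spherical \<sigma> l X \<Longrightarrow> l \<ge> 1 \<Longrightarrow> g \<in> SL2C \<Longrightarrow>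
       real (2 * l + 1) * cmod (spherical.coef \<sigma> l X 0 g) \<le> 
       C * l * exp (- (l * ((cmod (g$1$2) + cmod (g$2$1)) / norm g)\<^sup>2 / 12))"
    by (rule coef_0_decay) blast
  \<comment> \<open>\<open>300 = 5^2 * 12\<close>, with 5 from \<open>infdist_diag_le\<close> and 12
    from the exponent in \<open>coef_0_decay\<close>. The summand 1 pays for the factor
    \<open>l\<close>.\<close>
  define K0 where "K0 = max C (300 * (\<Lambda> + 1))"
  have "real (2 * l + 1) * cmod (spherical.coef \<sigma> l X j g) \<le> K * real l powr (- \<Lambda>)"
    if K: "K \<ge> K0" and X: "spherical \<sigma> l X" and l: "l \<ge> 1" and g: "g \<in> SL2C" and j: "j = 0 \<or> j = 2 * l"
      and D: "\<not> infdist g diag_SL2C \<le> K * norm g * sqrt (ln (real l)) / sqrt (real l)" for K l X g j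
  proof -
    interpret spherical \<sigma> l X by (rule X)
    obtain h where h: "h \<in> SL2C" "norm h = norm g" "coef j g = coef 0 h"
      "cmod (h$1$2) + cmod (h$2$1) = cmod (g$1$2) + cmod (g$2$1)"
      by (rule extreme_coef[OF g j]) 
    have K': "K \<ge> C" "K \<ge> 300 * (\<Lambda> + 1)" using K by (auto simp: K0_def)
    have n: "norm g > 0" using norm_SL2C_ge(2)[OF g] by linarith
    have ln0: "0 \<le> ln (real l)" using l by simp
    define t where "t = K * sqrt (ln (real l)) / (5 * sqrt (real l))"
    have t: "t \<ge> 0" using C(1) K' ln0 by (simp add: t_def)
    define m where "m = cmod (g$1$2) + cmod (g$2$1)"
    have "5 * (t * norm g) = K * norm g * sqrt (ln (real l)) / sqrt (real l)" by (simp add: t_def)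
    also have "\<dots> \<le> 5 * m" using D infdist_diag_le[OF g] by (simp add: m_def)
    finally have "t \<le> m / norm g" using n by (simp add: le_divide_eq)
    then have "t\<^sup>2 \<le> (m / norm g)\<^sup>2" using t by (intro power_mono) auto
    then have t2: "l * t\<^sup>2 / 12 \<le> l * (m / norm g)\<^sup>2 / 12" by (intro divide_right_mono mult_left_mono) auto
    have "real (2 * l + 1) * cmod (coef j g) \<le> C * l * exp (- (l * (m / norm g)\<^sup>2 / 12))"
      using C(2)[OF X l h(1)] by (simp add: h m_def)
    also have "\<dots> \<le> C * l * real l powr (- (\<Lambda> + 1))"
    proof (intro mult_left_mono exp_ln_bound[OF l])
      have "300 * 1 \<le> K" using K' \<Lambda> by simp
      then have "300 * (\<Lambda> + 1) * 1 \<le> K * (K / 300)" using K' \<Lambda> by (intro mult_mono) auto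
      then have "\<Lambda> + 1 \<le> K\<^sup>2 / 300 / 300" by (simp add: power2_eq_square)
      also have "\<dots> \<le> K\<^sup>2 / 300" by simp
      finally have "(\<Lambda> + 1) * ln (real l) \<le> K\<^sup>2 / 300 * ln (real l)"
        using ln0 by (intro mult_right_mono) auto
      also have "\<dots> = l * t\<^sup>2 / 12" using l ln0 by (simp add: t_def power_mult_distrib power_divide)
      also note t2
      finally show "(\<Lambda> + 1) * ln (real l) \<le> l * (m / norm g)\<^sup>2 / 12" .
    qed (use C(1) in auto)
    also have "\<dots> = C * real l powr (- \<Lambda>)"
    proof -
      have "real l * real l powr (- (\<Lambda> + 1)) = real l powr (1 + (- (\<Lambda> + 1)))"
        using l by (subst powr_add) simp
      then show ?thesis by simp
    qed
    also have "\<dots> \<le> K * real l powr (- \<Lambda>)" using K' by (intro mult_right_mono) auto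
    finally show ?thesis .
  qed
  then show ?thesis by (rule that)
qed

end

section \<open>Choice of the constants and conclusion\<close>

lemma cmod_avg_zonal:
  assumes haar: "haar_prob_SU2 \<mu>" and \<nu>: "Re \<nu> = 0" and g: "g \<in> SL2C"
  shows "cmod (avg_spherical_trace \<mu> \<nu> l 0 g) = spherical.zonal (distr \<mu> borel first_column) l (radial_factor \<nu> l) g"
proof -
  interpret spherical "distr \<mu> borel first_column" l "radial_factor \<nu> l" by (rule spherical_haar[OF haar \<nu>])
  show ?thesis
    unfolding zonal_def using avg_spherical_trace_eq[OF haar \<nu> g, of 0 l] by (simp only: norm_mult norm_of_nat) simp
qed

lemma cmod_avg_extreme:
  assumes haar: "haar_prob_SU2 \<mu>" and \<nu>: "Re \<nu> = 0" and g: "g \<in> SL2C" and q: "q \<in> {int l, - int l}"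
  shows "\<exists>j. (j = 0 \<or> j = 2 * l) \<and> cmod (avg_spherical_trace \<mu> \<nu> l q g) = 
    real (2 * l + 1) * cmod (spherical.coef (distr \<mu> borel first_column) l (radial_factor \<nu> l) j g)"
proof -
  define j where "j = nat (int l + q)"
  have j: "j = 0 \<or> j = 2 * l" using q by (auto simp: j_def)
  then have "2 * l choose j = 1" by auto
  moreover have "\<bar>q\<bar> \<le> int l" using q by auto
  ultimately show ?thesis
    using avg_spherical_trace_eq[OF haar \<nu> g, of q l] j unfolding j_def[symmetric]
    by (intro exI[of _ j]) (simp only: norm_mult norm_of_nat, simp)
qed

theorem theorem6:
  fixes \<mu> :: "(complex^2^2) measure"
  assumes haar: "haar_prob_SU2 \<mu>"
  shows "\<exists>(C :: real \<Rightarrow> real \<Rightarrow> real) (C' :: real \<Rightarrow> real) (C\<^sub>\<Lambda> :: real \<Rightarrow> real).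
    \<forall>\<epsilon> > 0. \<forall>\<Lambda> > 0. \<forall>l :: nat. l \<ge> 1 \<longrightarrow> (\<forall>\<nu> :: complex. Re \<nu> = 0 \<longrightarrow> (\<forall>g \<in> SL2C.
      (cmod (avg_spherical_trace \<mu> \<nu> l 0 g)
         \<le> C \<epsilon> \<Lambda> * (real l powr \<epsilon> *
              (if infdist g mono_SU2 = 0 then 1
               else min 1 (1 / (sqrt (real l) * infdist g mono_SU2)))
            + real l powr (- \<Lambda>))) \<and>
      (\<not> D_fun g \<le> C\<^sub>\<Lambda> \<Lambda> * (norm g)\<^sup>2 * ln (real l) / sqrt (real l) \<longrightarrow>
         cmod (avg_spherical_trace \<mu> \<nu> l 0 g) \<le> C\<^sub>\<Lambda> \<Lambda> * real l powr (- \<Lambda>)) \<and>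
      (\<forall>q \<in> {int l, - int l}.
         cmod (avg_spherical_trace \<mu> \<nu> l q g)
           \<le> C' \<epsilon> * norm g powr (- 2 + \<epsilon>) * real l powr \<epsilon> \<and>
         (\<not> infdist g diag_SL2C \<le> C\<^sub>\<Lambda> \<Lambda> * norm g * sqrt (ln (real l)) / sqrt (real l) \<longrightarrow>
            cmod (avg_spherical_trace \<mu> \<nu> l q g) \<le> C\<^sub>\<Lambda> \<Lambda> * real l powr (- \<Lambda>)))))"
proof -
  define \<sigma> where "\<sigma> = distr \<mu> borel first_column"
  interpret sphere_measure \<sigma> unfolding \<sigma>_def by (rule sphere_measure_haar[OF haar])
  have sph: "spherical \<sigma> l (radial_factor \<nu> l)" if "Re \<nu> = 0" for \<nu> l
    unfolding \<sigma>_def by (rule spherical_haar[OF haar that])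
  \<comment> \<open>The constants must be functions of \<open>\<epsilon>\<close> and
    \<open>\<Lambda>\<close> fixed before all other variables. Folding each estimate into a
    predicate keeps the four applications of choice first-order.\<close>
  define Z where "Z \<epsilon> \<Lambda> c \<longleftrightarrow> (\<forall>l X g. spherical \<sigma> l X \<longrightarrow> l \<ge> 1 \<longrightarrow> g \<in> SL2C \<longrightarrow> spherical.zonal \<sigma> l X g \<le>
      c * (real l powr \<epsilon> * (if infdist g mono_SU2 = 0 then 1 else min 1 (1 / (sqrt (real l) * infdist g mono_SU2))) + real l powr (- \<Lambda>)))"
    for \<epsilon> \<Lambda> c :: real
  define ZD where "ZD \<Lambda> k \<longleftrightarrow> (\<forall>K l X g. K \<ge> k \<longrightarrow> spherical \<sigma> l X \<longrightarrow> l \<ge> 1 \<longrightarrow> g \<in> SL2C \<longrightarrow>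
      \<not> D_fun g \<le> K * (norm g)\<^sup>2 * ln (real l) / sqrt (real l) \<longrightarrow> spherical.zonal \<sigma> l X g \<le> K * real l powr (- \<Lambda>))" for \<Lambda> k :: real
  define Ex where "Ex \<epsilon> c \<longleftrightarrow> (\<forall>l X g j. spherical \<sigma> l X \<longrightarrow> l \<ge> 1 \<longrightarrow> g \<in> SL2C \<longrightarrow> j = 0 \<or> j = 2 * l \<longrightarrow>
       real (2 * l + 1) * cmod (spherical.coef \<sigma> l X j g) \<le> c * norm g powr (- 2 + \<epsilon>) * real l powr \<epsilon>)" for \<epsilon> c :: real
  define ED where "ED \<Lambda> k \<longleftrightarrow> (\<forall>K l X g j. K \<ge> k \<longrightarrow> spherical \<sigma> l X \<longrightarrow> l \<ge> 1 \<longrightarrow> g \<in> SL2C \<longrightarrow> j = 0 \<or> j = 2 * l \<longrightarrow>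
      \<not> infdist g diag_SL2C \<le> K * norm g * sqrt (ln (real l)) / sqrt (real l) \<longrightarrow> 
      real (2 * l + 1) * cmod (spherical.coef \<sigma> l X j g) \<le> K * real l powr (- \<Lambda>))" for \<Lambda> k :: real
  have "\<exists>c. Z \<epsilon> \<Lambda> c" if "\<epsilon> > 0" "\<Lambda> > 0" for \<epsilon> \<Lambda>
    unfolding Z_def by (rule zonal_bound[OF that]) blast
  then obtain C where C: "\<And>\<epsilon> \<Lambda>. \<epsilon> > 0 \<Longrightarrow> \<Lambda> > 0 \<Longrightarrow> Z \<epsilon> \<Lambda> (C \<epsilon> \<Lambda>)" by metis
  have "\<exists>c. Ex \<epsilon> c" if "\<epsilon> > 0" for \<epsilon>
    unfolding Ex_def by (rule extreme_bound[OF that]) blast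
  then obtain C' where C': "\<And>\<epsilon>. \<epsilon> > 0 \<Longrightarrow> Ex \<epsilon> (C' \<epsilon>)" by metis
  have "\<exists>k. ZD \<Lambda> k" if "\<Lambda> > 0" for \<Lambda>
    unfolding ZD_def by (rule zonal_decay[OF that]) blast
  then obtain K1 where K1: "\<And>\<Lambda>. \<Lambda> > 0 \<Longrightarrow> ZD \<Lambda> (K1 \<Lambda>)" by metis
  have "\<exists>k. ED \<Lambda> k" if "\<Lambda> > 0" for \<Lambda>
    unfolding ED_def by (rule extreme_decay[OF that]) blast
  then obtain K2 where K2: "\<And>\<Lambda>. \<Lambda> > 0 \<Longrightarrow> ED \<Lambda> (K2 \<Lambda>)" by metis
  show ?thesis
  proof (intro exI allI impI ballI conjI)
    fix \<epsilon> \<Lambda> :: real and l :: nat and \<nu> :: complex and g :: "complex^2^2"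
    assume *: "\<epsilon> > 0" "\<Lambda> > 0" "l \<ge> 1" "Re \<nu> = 0" "g \<in> SL2C"
    note zon = cmod_avg_zonal[OF haar *(4,5), of l, folded \<sigma>_def]
    show "cmod (avg_spherical_trace \<mu> \<nu> l 0 g) \<le> C \<epsilon> \<Lambda> * (real l powr \<epsilon> *
        (if infdist g mono_SU2 = 0 then 1 else min 1 (1 / (sqrt (real l) * infdist g mono_SU2))) + real l powr (- \<Lambda>))"
      unfolding zon using C[OF *(1,2)] sph[OF *(4)] *(3,5) unfolding Z_def by blast
    \<comment> \<open>The single constant \<open>C\<^sub>\<Lambda>\<close> is the larger of the two
      thresholds; both decay statements hold for every constant above their own threshold.\<close>
    show "cmod (avg_spherical_trace \<mu> \<nu> l 0 g) \<le> max (K1 \<Lambda>) (K2 \<Lambda>) * real l powr (- \<Lambda>)"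
      if "\<not> D_fun g \<le> max (K1 \<Lambda>) (K2 \<Lambda>) * (norm g)\<^sup>2 * ln (real l) / sqrt (real l)"
      unfolding zon by (rule K1[OF *(2), unfolded ZD_def, rule_format, OF max.cobounded1 sph[OF *(4)] *(3,5) that])
    fix q assume q: "q \<in> {int l, - int l}"
    obtain j where j: "j = 0 \<or> j = 2 * l" "cmod (avg_spherical_trace \<mu> \<nu> l q g) = real (2 * l + 1) * cmod (spherical.coef \<sigma> l (radial_factor \<nu> l) j g)"
      using cmod_avg_extreme[OF haar *(4,5) q] unfolding \<sigma>_def by blast
    show "cmod (avg_spherical_trace \<mu> \<nu> l q g) \<le> C' \<epsilon> * norm g powr (- 2 + \<epsilon>) * real l powr \<epsilon>"
      unfolding j(2) using C'[OF *(1)] sph[OF *(4)] *(3,5) j(1) unfolding Ex_def by blast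
    show "cmod (avg_spherical_trace \<mu> \<nu> l q g) \<le> max (K1 \<Lambda>) (K2 \<Lambda>) * real l powr (- \<Lambda>)"
      if "\<not> infdist g diag_SL2C \<le> max (K1 \<Lambda>) (K2 \<Lambda>) * norm g * sqrt (ln (real l)) / sqrt (real l)"
      unfolding j(2) by (rule K2[OF *(2), unfolded ED_def, rule_format, OF max.cobounded2 sph[OF *(4)] *(3,5) j(1) that])
  qed
qed

end
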